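(* Let $d\ge 1$, let $\mathbb T^d=\mathbb R^d/\mathbb Z^d$ carry Lebesgue probability measure $m$ and the Euclidean metric $\mathbf d$, and let $\mu$ be a probability measure on $G=\mathrm{Aut}(\mathbb T^d)$. Let $G_\mu$ denote the group generated by the support of $\mu$, and assume that there is no nontrivial $G_\mu$-invariant factor torus $\overline T$ of $\mathbb T^d$ such that the projection of $G_\mu$ on $\mathrm{Aut}(\overline T)$ is amenable. Let $(X_n)_{n\ge 0}$ be the random walk on $\mathbb T^d$ driven by $\mu$ with initial distribution $m$. Then for every $x_0\in\mathbb T^d$, with $\Delta(x)=-\log\mathbf d(x,x_0)$, for $\mathbf P$-almost every random walk, $$\limsup_{n\to\infty}\frac{\Delta(X_n)}{\log n}=\frac1d .$$
   Context: $\mathrm{Aut}(\mathbb T^d)$ is the group of linear automorphisms of $\mathbb T^d$, identified with the integer matrices of determinant $\pm1$ (a discrete group). Random walk: $\mathbf P=\mu^{\otimes\mathbb N}\otimes m$ on $G^{\mathbb N}\times\mathbb T^d$, and for $(\bar g,x)$ with $\bar g=(g_1,g_2,\dots)$ one sets $X_0=x$, $X_n=g_n\cdots g_1x$ for $n\geq 1$. $\Delta(x_0)=+\infty$ by convention (an event of probability $0$). *)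

theory Defs
  imports
    "HOL-Probability.Probability"
    "HOL-Algebra.Coset"
    "HOL-Algebra.Bij"
    "HOL-Algebra.Generated_Groups"
begin

section \<open>The torus\<close>

definition int_lattice :: "(real ^ 'n::finite) set" where
  "int_lattice = {v. \<forall>i. v $ i \<in> \<int>}"

lemma int_lattice_0 [simp]: "0 \<in> int_lattice"
  by (simp add: int_lattice_def)

lemma int_lattice_add: "u \<in> int_lattice \<Longrightarrow> v \<in> int_lattice \<Longrightarrow> u + v \<in> int_lattice"
  by (simp add: int_lattice_def)

lemma int_lattice_diff: "u \<in> int_lattice \<Longrightarrow> v \<in> int_lattice \<Longrightarrow> u - v \<in> int_lattice"
  by (simp add: int_lattice_def)

lemma int_lattice_minus_iff [simp]: "- v \<in> int_lattice \<longleftrightarrow> v \<in> int_lattice"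
  by (simp add: int_lattice_def)

lemma closed_int_lattice: "closed (int_lattice :: (real ^ 'n::finite) set)"
proof -
  have "closed {v :: real ^ 'n. v $ i \<in> \<int>}" for i
    using continuous_closed_vimage[of "\<int> :: real set" "\<lambda>v :: real ^ 'n. v $ i"]
    by (auto simp: vimage_def)
  then have "closed (\<Inter>i. {v :: real ^ 'n. v $ i \<in> \<int>})"
    by auto
  also have "(\<Inter>i. {v :: real ^ 'n. v $ i \<in> \<int>}) = int_lattice"
    by (auto simp: int_lattice_def)
  finally show ?thesis .
qed

definition torus_rel :: "real ^ 'n::finite \<Rightarrow> real ^ 'n \<Rightarrow> bool" where
  "torus_rel u v \<longleftrightarrow> u - v \<in> int_lattice"

lemma equivp_torus_rel: "equivp torus_rel"
proof (rule equivpI)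
  show "reflp torus_rel"
    by (simp add: reflp_def torus_rel_def)
  show "symp torus_rel"
    unfolding symp_def torus_rel_def using int_lattice_minus_iff by (metis minus_diff_eq)
  show "transp torus_rel"
    unfolding transp_def torus_rel_def by (auto dest: int_lattice_add)
qed

quotient_type (overloaded) 'n torus = "real ^ 'n::finite" / torus_rel
  morphisms rep_torus to_torus
  by (rule equivp_torus_rel)

instantiation torus :: (finite) ab_group_add
begin

lift_definition zero_torus :: "'a torus" is 0 .

lift_definition plus_torus :: "'a torus \<Rightarrow> 'a torus \<Rightarrow> 'a torus" is "(+)"
  unfolding torus_rel_def add_diff_add by (rule int_lattice_add)

lift_definition minus_torus :: "'a torus \<Rightarrow> 'a torus \<Rightarrow> 'a torus" is "(-)"
  unfolding torus_rel_def by (drule (1) int_lattice_diff) (simp add: algebra_simps)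

lift_definition uminus_torus :: "'a torus \<Rightarrow> 'a torus" is uminus
  unfolding torus_rel_def by (metis int_lattice_minus_iff minus_diff_minus)

instance
  by standard (transfer; simp add: torus_rel_def algebra_simps)+

end

text \<open>The Euclidean metric of the torus is the quotient metric: the distance between the
  classes of \<^term>\<open>u\<close> and \<^term>\<open>v\<close> is the infimum of the Euclidean norms of
  \<^term>\<open>u - v - z\<close>, for \<^term>\<open>z\<close> in the integer lattice.\<close>

lemma infdist_int_lattice_add:
  fixes u v :: "real ^ 'n::finite"
  shows "infdist (u + v) int_lattice \<le> infdist u int_lattice + infdist v int_lattice"
proof -
  have ne: "(int_lattice :: (real ^ 'n) set) \<noteq> {}"
    using int_lattice_0 by blast
  have 1: "infdist (u + v) int_lattice \<le> dist u a + dist v b"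
    if "a \<in> int_lattice" "b \<in> int_lattice" for a b
    using infdist_le2[OF int_lattice_add[OF that]] dist_triangle_add by blast
  have 2: "infdist (u + v) int_lattice - dist u a \<le> infdist v int_lattice"
    if "a \<in> int_lattice" for a
    unfolding infdist_notempty[OF ne, of v]
    by (rule cINF_greatest[OF ne]) (use 1 that in \<open>simp add: algebra_simps\<close>)
  have "infdist (u + v) int_lattice - infdist v int_lattice \<le> infdist u int_lattice"
    unfolding infdist_notempty[OF ne, of u]
    by (rule cINF_greatest[OF ne]) (use 2 in \<open>simp add: algebra_simps\<close>)
  then show ?thesis
    by simp
qed

lemma infdist_int_lattice_cong:
  fixes u v :: "real ^ 'n::finite"
  assumes "u - v \<in> int_lattice"
  shows "infdist u int_lattice = infdist v int_lattice"
proof (rule antisym)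
  show "infdist u int_lattice \<le> infdist v int_lattice"
    using infdist_int_lattice_add[of v "u - v"] assms by simp
  have "v - u \<in> int_lattice"
    using assms by (metis int_lattice_minus_iff minus_diff_eq)
  then show "infdist v int_lattice \<le> infdist u int_lattice"
    using infdist_int_lattice_add[of u "v - u"] by simp
qed

lemma infdist_int_lattice_minus:
  fixes u :: "real ^ 'n::finite"
  shows "infdist (- u) int_lattice = infdist u int_lattice"
proof -
  have ne: "(int_lattice :: (real ^ 'n) set) \<noteq> {}"
    using int_lattice_0 by blast
  have le: "infdist (- w) int_lattice \<le> infdist w int_lattice" for w :: "real ^ 'n"
    unfolding infdist_notempty[OF ne, of w]
  proof (rule cINF_greatest[OF ne])
    fix a :: "real ^ 'n"
    assume "a \<in> int_lattice"
    then have "infdist (- w) int_lattice \<le> dist (- w) (- a)"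
      by (intro infdist_le) simp
    then show "infdist (- w) int_lattice \<le> dist w a"
      by (simp add: dist_norm norm_minus_commute)
  qed
  show ?thesis
    using le[of u] le[of "- u"] by simp
qed

instantiation torus :: (finite) metric_space
begin

lift_definition dist_torus :: "'a torus \<Rightarrow> 'a torus \<Rightarrow> real"
  is "\<lambda>u v. infdist (u - v) int_lattice"
proof -
  fix u u' v v' :: "real ^ 'a"
  assume "torus_rel u u'" "torus_rel v v'"
  then have "(u - u') - (v - v') \<in> int_lattice"
    unfolding torus_rel_def by (rule int_lattice_diff)
  then show "infdist (u - v) int_lattice = infdist (u' - v') int_lattice"
    by (intro infdist_int_lattice_cong) (simp add: algebra_simps)
qed

definition uniformity_torus :: "('a torus \<times> 'a torus) filter" where
  "uniformity_torus = (INF e\<in>{0<..}. principal {(x, y). dist x y < e})"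

definition open_torus :: "'a torus set \<Rightarrow> bool" where
  "open_torus U \<longleftrightarrow> (\<forall>x\<in>U. eventually (\<lambda>(x', y). x' = x \<longrightarrow> y \<in> U) uniformity)"

instance
proof
  show "(dist x y = 0) = (x = y)" for x y :: "'a torus"
  proof transfer
    fix u v :: "real ^ 'a"
    show "(infdist (u - v) int_lattice = 0) = torus_rel u v"
      unfolding torus_rel_def
      using in_closed_iff_infdist_zero[OF closed_int_lattice] int_lattice_0 by blast
  qed
  show "dist x y \<le> dist x z + dist y z" for x y z :: "'a torus"
  proof transfer
    fix u v w :: "real ^ 'a"
    show "infdist (u - v) int_lattice \<le> infdist (u - w) int_lattice + infdist (v - w) int_lattice"
      using infdist_int_lattice_add[of "u - w" "w - v"] infdist_int_lattice_minus[of "v - w"]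
      by simp
  qed
qed (simp_all add: uniformity_torus_def open_torus_def)

end

lemma dist_to_torus_le: "dist (to_torus u) (to_torus v) \<le> dist u v"
  by (simp add: dist_torus.abs_eq) (metis int_lattice_0 infdist_le dist_norm diff_zero)

lemma continuous_on_to_torus: "continuous_on A to_torus"
  unfolding continuous_on_iff using dist_to_torus_le by (meson le_less_trans)

lemma measurable_to_torus [measurable]: "to_torus \<in> borel_measurable borel"
  by (intro borel_measurable_continuous_onI continuous_on_to_torus)

definition unit_cube :: "(real ^ 'n::finite) set" where
  "unit_cube = {v. \<forall>i. 0 \<le> v $ i \<and> v $ i < 1}"

definition torus_measure :: "'n::finite torus measure" where
  "torus_measure = distr (restrict_space lborel unit_cube) borel to_torus"

lemma unit_cube_sets [measurable]: "unit_cube \<in> sets borel"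
  unfolding unit_cube_def by measurable

lemma emeasure_unit_cube: "emeasure lborel (unit_cube :: (real ^ 'n::finite) set) = 1"
proof (rule antisym)
  have One: "(1 :: real ^ 'n) \<bullet> b = 1" if "b \<in> Basis" for b
    using that by (auto simp: Basis_vec_def inner_axis)
  have *: "emeasure lborel (cbox 0 (1 :: real ^ 'n)) = 1" "emeasure lborel (box 0 (1 :: real ^ 'n)) = 1"
    by (simp_all add: emeasure_lborel_cbox_eq emeasure_lborel_box_eq One)
  have "unit_cube \<subseteq> cbox 0 (1 :: real ^ 'n)" "box 0 (1 :: real ^ 'n) \<subseteq> unit_cube"
    by (auto simp: unit_cube_def mem_box_cart less_imp_le)
  then show "emeasure lborel (unit_cube :: (real ^ 'n) set) \<le> 1"
    "1 \<le> emeasure lborel (unit_cube :: (real ^ 'n) set)"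
    using emeasure_mono[of unit_cube "cbox 0 (1 :: real ^ 'n)" lborel]
      emeasure_mono[of "box 0 (1 :: real ^ 'n)" unit_cube lborel]
    by (simp_all add: *)
qed

lemma prob_space_torus_measure: "prob_space torus_measure"
  unfolding torus_measure_def
proof (rule prob_space.prob_space_distr)
  show "prob_space (restrict_space lborel (unit_cube :: (real ^ 'a) set))"
    by (rule prob_spaceI)
      (simp add: space_restrict_space emeasure_restrict_space emeasure_unit_cube)
  show "to_torus \<in> restrict_space lborel (unit_cube :: (real ^ 'a) set) \<rightarrow>\<^sub>M borel"
    by (intro measurable_restrict_space1) simp
qed


section \<open>Automorphisms and factor tori\<close>

definition torus_Aut :: "(int ^ 'n::finite ^ 'n) monoid" where
  "torus_Aut = \<lparr>carrier = {A. det A = 1 \<or> det A = - 1}, mult = (**), one = mat 1\<rparr>"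

lemma det_map_matrix_of_int:
  "det (map_matrix real_of_int A) = real_of_int (det (A :: int ^ 'n::finite ^ 'n))"
  by (simp add: det_def)

lemma map_matrix_of_int_mult:
  "map_matrix real_of_int (A ** B) = map_matrix real_of_int A ** map_matrix real_of_int B"
  by (simp add: vec_eq_iff matrix_matrix_mult_def)

lemma map_matrix_of_int_one: "map_matrix real_of_int (mat 1) = mat 1"
  by (simp add: vec_eq_iff mat_def)

lemma map_matrix_of_int_inject:
  "map_matrix real_of_int A = map_matrix real_of_int B \<longleftrightarrow> A = B"
  by (simp add: vec_eq_iff)

lemma int_matrix_left_inverse:
  fixes A :: "int ^ 'n::finite ^ 'n"
  assumes "det A = 1 \<or> det A = - 1"
  shows "\<exists>B. (det B = 1 \<or> det B = - 1) \<and> B ** A = mat 1"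
proof -
  let ?A = "map_matrix real_of_int A"
  define C where "C j k = det (\<chi> i l. if l = k then (if i = j then 1 else 0) else A $ i $ l)" for j k
  define B where "B = (\<chi> k j. det A * C j k)"
  have d: "det ?A \<noteq> 0" "det A * det A = 1"
    using assms by (auto simp: det_map_matrix_of_int)
  have "?A *v (\<chi> k. real_of_int (B $ k $ j)) = axis j 1" for j
  proof -
    have "map_matrix real_of_int (\<chi> i l. if l = k then (if i = j then 1 else 0) else A $ i $ l)
        = (\<chi> i l. if l = k then axis j 1 $ i else ?A $ i $ l)" for k
      by (simp add: vec_eq_iff axis_def)
    then have "real_of_int (C j k) = det (\<chi> i l. if l = k then axis j 1 $ i else ?A $ i $ l)" for k
      unfolding C_def det_map_matrix_of_int[symmetric] by simp
    moreover have "real_of_int (B $ k $ j) = real_of_int (C j k) / det ?A" for k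
      using assms unfolding B_def det_map_matrix_of_int by (elim disjE) simp_all
    ultimately have "(\<chi> k. real_of_int (B $ k $ j))
        = (\<chi> k. det (\<chi> i l. if l = k then axis j 1 $ i else ?A $ i $ l) / det ?A)"
      by simp
    then show ?thesis
      using cramer[OF d(1)] by blast
  qed
  then have "?A ** map_matrix real_of_int B = mat 1"
    by (auto simp: vec_eq_iff matrix_matrix_mult_def matrix_vector_mult_def mat_def axis_def)
  then have "map_matrix real_of_int B ** ?A = mat 1"
    by (simp add: matrix_left_right_inverse)
  then have BA: "B ** A = mat 1"
    by (simp only: map_matrix_of_int_mult[symmetric] map_matrix_of_int_one[symmetric]
        map_matrix_of_int_inject)
  have "det B * det A = 1"
    using arg_cong[OF BA, of det] by (simp add: det_mul)
  then have "det B = 1 \<or> det B = - 1"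
    using assms by (elim disjE) simp_all
  with BA show ?thesis
    by blast
qed

lemma group_torus_Aut: "group torus_Aut"
proof (rule groupI)
  fix A :: "int ^ 'a ^ 'a"
  assume "A \<in> carrier torus_Aut"
  then show "\<exists>B\<in>carrier torus_Aut. B \<otimes>\<^bsub>torus_Aut\<^esub> A = \<one>\<^bsub>torus_Aut\<^esub>"
    using int_matrix_left_inverse[of A] by (auto simp: torus_Aut_def)
qed (auto simp: torus_Aut_def det_mul matrix_mul_assoc)

lift_definition torus_act :: "int ^ 'n::finite ^ 'n \<Rightarrow> 'n torus \<Rightarrow> 'n torus"
  is "\<lambda>A v. map_matrix real_of_int A *v v"
proof -
  fix A :: "int ^ 'n ^ 'n" and u v :: "real ^ 'n"
  assume "torus_rel u v"
  then show "torus_rel (map_matrix real_of_int A *v u) (map_matrix real_of_int A *v v)"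
    unfolding torus_rel_def matrix_vector_mult_diff_distrib[symmetric]
    by (auto simp: int_lattice_def matrix_vector_mult_def)
qed

lemma torus_act_mult: "torus_act (A ** B) x = torus_act A (torus_act B x)"
  by transfer (simp add: torus_rel_def map_matrix_of_int_mult matrix_vector_mul_assoc)

lemma torus_act_one: "torus_act (mat 1) x = x"
  by transfer (simp add: torus_rel_def map_matrix_of_int_one)

lemma torus_act_add: "torus_act A (x + y) = torus_act A x + torus_act A y"
  by transfer (simp add: torus_rel_def matrix_vector_right_distrib)

definition torus_group :: "'n::finite torus monoid" where
  "torus_group = \<lparr>carrier = UNIV, mult = (+), one = 0\<rparr>"

lemma comm_group_torus_group: "comm_group torus_group"
  by (rule comm_groupI) (auto simp: torus_group_def algebra_simps intro: exI[of _ "- _"])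

text \<open>A factor torus is the quotient \<^term>\<open>torus_group Mod S\<close> by a closed subgroup
  \<^term>\<open>S\<close> (such a quotient is compact, connected and abelian Lie, hence again a torus); it is
  nontrivial iff \<^term>\<open>S \<noteq> UNIV\<close>. It is invariant when the automorphisms in
  \<^term>\<open>\<Gamma>\<close> descend to automorphisms of the quotient.\<close>

definition invariant_factor_torus ::
    "(int ^ 'n::finite ^ 'n) set \<Rightarrow> 'n torus set \<Rightarrow> bool" where
  "invariant_factor_torus \<Gamma> S \<longleftrightarrow>
     subgroup S torus_group \<and> closed S \<and> (\<forall>A\<in>\<Gamma>. torus_act A ` S = S)"

text \<open>The elements of the quotient are cosets, and the automorphism induced by \<^term>\<open>A\<close> maps
  a coset to its image under the action of \<^term>\<open>A\<close>.\<close>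

definition induced_aut ::
    "'n::finite torus set \<Rightarrow> int ^ 'n ^ 'n \<Rightarrow> 'n torus set \<Rightarrow> 'n torus set" where
  "induced_aut S A = (\<lambda>C\<in>carrier (torus_group Mod S). torus_act A ` C)"

definition factor_projection ::
    "(int ^ 'n::finite ^ 'n) set \<Rightarrow> 'n torus set \<Rightarrow> ('n torus set \<Rightarrow> 'n torus set) monoid" where
  "factor_projection \<Gamma> S = AutoGroup (torus_group Mod S) \<lparr>carrier := induced_aut S ` \<Gamma>\<rparr>"

lemma normal_torus_group: "subgroup S torus_group \<Longrightarrow> S \<lhd> torus_group"
  by (simp add: comm_group.normal_iff_subgroup[OF comm_group_torus_group])

lemma carrier_factor: "carrier (torus_group Mod S) = range (\<lambda>x. (\<lambda>y. y + x) ` S)"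
  by (auto simp: carrier_FactGroup torus_group_def r_coset_def)

lemma torus_act_coset:
  assumes "torus_act A ` S = S"
  shows "torus_act A ` (\<lambda>y. y + x) ` S = (\<lambda>y. y + torus_act A x) ` S"
proof -
  have "torus_act A ` (\<lambda>y. y + x) ` S = (\<lambda>y. y + torus_act A x) ` torus_act A ` S"
    by (simp add: image_image torus_act_add)
  then show ?thesis
    by (simp add: assms)
qed

text \<open>The induced maps are automorphisms of the factor torus, and they form a group.\<close>

lemma induced_aut_hom:
  fixes \<Gamma> :: "(int ^ 'n::finite ^ 'n) set"
  assumes \<Gamma>: "subgroup \<Gamma> torus_Aut" and S: "invariant_factor_torus \<Gamma> S"
  shows "induced_aut S \<in> hom (torus_Aut \<lparr>carrier := \<Gamma>\<rparr>) (AutoGroup (torus_group Mod S))"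
proof -
  let ?Q = "torus_group Mod S" and ?C = "carrier (torus_group Mod S)"
  have act: "torus_act A ` C \<in> ?C" if "A \<in> \<Gamma>" "C \<in> ?C" for A C
    using that S torus_act_coset[of A S] by (auto simp: carrier_factor invariant_factor_torus_def)
  have inv: "\<exists>B\<in>\<Gamma>. B ** A = mat 1 \<and> A ** B = mat 1" if "A \<in> \<Gamma>" for A
    using that subgroup.m_inv_closed[OF \<Gamma>, of A] subgroup.mem_carrier[OF \<Gamma>, of A]
      group.l_inv[OF group_torus_Aut, of A] group.r_inv[OF group_torus_Aut, of A]
    by (auto simp: torus_Aut_def)
  have auto: "induced_aut S A \<in> auto ?Q" if A: "A \<in> \<Gamma>" for A
  proof -
    obtain B where B: "B \<in> \<Gamma>" "B ** A = mat 1" "A ** B = mat 1"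
      using inv A by blast
    have BA: "torus_act B ` torus_act A ` C = C" "torus_act A ` torus_act B ` C = C" for C
      using B by (simp_all add: image_image torus_act_mult[symmetric] torus_act_one)
    have "bij_betw (induced_aut S A) ?C ?C"
      by (rule bij_betw_byWitness[where f' = "\<lambda>C. torus_act B ` C"])
        (auto simp: induced_aut_def BA act A B)
    moreover have "induced_aut S A \<in> extensional ?C"
      by (simp add: induced_aut_def)
    moreover have "induced_aut S A \<in> hom ?Q ?Q"
    proof (rule homI)
      fix C D
      assume CD: "C \<in> ?C" "D \<in> ?C"
      interpret normal S torus_group
        using S by (simp add: invariant_factor_torus_def normal_torus_group)
      have "C \<otimes>\<^bsub>?Q\<^esub> D \<in> ?C"
        using CD by (intro monoid.m_closed group.is_monoid factorgroup_is_group)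
      moreover have "torus_act A ` (C <#>\<^bsub>torus_group\<^esub> D)
          = torus_act A ` C <#>\<^bsub>torus_group\<^esub> torus_act A ` D"
        by (simp add: set_mult_def torus_group_def image_UN torus_act_add)
      ultimately show "induced_aut S A (C \<otimes>\<^bsub>?Q\<^esub> D)
          = induced_aut S A C \<otimes>\<^bsub>?Q\<^esub> induced_aut S A D"
        using CD by (simp add: induced_aut_def)
    qed (simp add: induced_aut_def act A)
    ultimately show ?thesis
      by (simp add: auto_def Bij_def)
  qed
  show ?thesis
  proof (rule homI)
    fix A B
    assume "A \<in> carrier (torus_Aut \<lparr>carrier := \<Gamma>\<rparr>)" "B \<in> carrier (torus_Aut \<lparr>carrier := \<Gamma>\<rparr>)"
    then have AB: "A \<in> \<Gamma>" "B \<in> \<Gamma>"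
      by simp_all
    then have "induced_aut S A \<in> Bij ?C" "induced_aut S B \<in> Bij ?C"
      using auto by (auto simp: auto_def)
    moreover have "induced_aut S (A ** B) = compose ?C (induced_aut S A) (induced_aut S B)"
      using AB act by (auto simp: fun_eq_iff induced_aut_def compose_def image_image torus_act_mult)
    ultimately show "induced_aut S (A \<otimes>\<^bsub>torus_Aut \<lparr>carrier := \<Gamma>\<rparr>\<^esub> B)
        = induced_aut S A \<otimes>\<^bsub>AutoGroup ?Q\<^esub> induced_aut S B"
      by (simp add: AutoGroup_def BijGroup_def torus_Aut_def)
  qed (use auto in \<open>simp add: AutoGroup_def\<close>)
qed

lemma group_factor_projection:
  assumes \<Gamma>: "subgroup \<Gamma> torus_Aut" and S: "invariant_factor_torus \<Gamma> S"
  shows "group (factor_projection \<Gamma> S)"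
proof -
  interpret normal S torus_group
    using S by (simp add: invariant_factor_torus_def normal_torus_group)
  interpret Q: group "AutoGroup (torus_group Mod S)"
    by (intro group.AutoGroup factorgroup_is_group)
  interpret group_hom "torus_Aut \<lparr>carrier := \<Gamma>\<rparr>" "AutoGroup (torus_group Mod S)" "induced_aut S"
    using induced_aut_hom[OF \<Gamma> S] subgroup.subgroup_is_group[OF \<Gamma> group_torus_Aut] Q.is_group
    by (simp add: group_hom_def group_hom_axioms_def)
  show ?thesis
    using subgroup.subgroup_is_group[OF img_is_subgroup Q.is_group]
    by (simp add: factor_projection_def)
qed

text \<open>Amenability of a group with the discrete topology: there is a left-invariant finitely
  additive probability measure on all its subsets.\<close>

definition amenable :: "('a, 'b) monoid_scheme \<Rightarrow> bool" where
  "amenable G \<longleftrightarrow> group G \<and>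
     (\<exists>\<nu> :: 'a set \<Rightarrow> real.
        (\<forall>A. A \<subseteq> carrier G \<longrightarrow> 0 \<le> \<nu> A) \<and>
        \<nu> (carrier G) = 1 \<and>
        (\<forall>A B. A \<subseteq> carrier G \<longrightarrow> B \<subseteq> carrier G \<longrightarrow> A \<inter> B = {} \<longrightarrow> \<nu> (A \<union> B) = \<nu> A + \<nu> B) \<and>
        (\<forall>g A. g \<in> carrier G \<longrightarrow> A \<subseteq> carrier G \<longrightarrow> \<nu> (g <#\<^bsub>G\<^esub> A) = \<nu> A))"


section \<open>The random walk\<close>

text \<open>Increments are indexed from 0: \<^term>\<open>g 0\<close>, \<^term>\<open>g 1\<close>, \dots are
  $g_1$, $g_2$, \dots, so that the position at time $n$ is $g_n \cdots g_1 x$. As the group of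
  automorphisms is countable and discrete, its probability measures are the probability mass
  functions supported in it.\<close>

primrec walk :: "(nat \<Rightarrow> int ^ 'n::finite ^ 'n) \<Rightarrow> 'n torus \<Rightarrow> nat \<Rightarrow> 'n torus" where
  "walk g x 0 = x"
| "walk g x (Suc n) = torus_act (g n) (walk g x n)"

definition walk_measure ::
    "(int ^ 'n::finite ^ 'n) pmf \<Rightarrow> ((nat \<Rightarrow> int ^ 'n ^ 'n) \<times> 'n torus) measure" where
  "walk_measure \<mu> = (\<Pi>\<^sub>M i\<in>UNIV. measure_pmf \<mu>) \<Otimes>\<^sub>M torus_measure"

definition log_dist :: "'n::finite torus \<Rightarrow> 'n torus \<Rightarrow> ereal" where
  "log_dist x0 x = (if x = x0 then \<infinity> else ereal (- ln (dist x x0)))"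

end

theory Submission
  imports Defs "HOL-Real_Asymp.Real_Asymp"
begin

text \<open>Write $P f(a) = \int f(aA)\,d\mu(A)$ for the averaging operator on functions on the nonzero frequencies
  $a \in \mathbb Z^d$. If no power of \<open>P\<close> contracts the \<open>\<ell>\<^sup>2\<close> norm, there is a $G_\mu$-invariant mean
  on the nonzero frequencies. A subspace \<open>W\<close> of least dimension which carries enough of this mean is
  $G_\mu$-invariant, and independent samples of the mean span \<open>W\<close> with positive probability. As the image
  of $G_\mu$ in the linear group of \<open>W\<close> acts freely on spanning tuples, it is amenable; so the
  annihilator of \<open>W\<close> gives a factor torus which the hypothesis excludes. Hence the correlations of
  trigonometric polynomials along the walk decay exponentially, at a rate that does not depend on
  their degree.

  The balls are replaced by the kernel $\prod_i \cos^{2M}(\pi x_i)$ with $M$ about $r^{-2}$: it is a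
  trigonometric polynomial with nonnegative coefficients, at least $1/2$ on a ball of radius
  proportional to $r$, exponentially small outside a slightly larger ball, and of mean about $r^d$. Borel-Cantelli with
  the first moment gives the upper bound. The variance of the number of visits is
  at most a constant times its mean, so Chebyshev's inequality and Borel-Cantelli along dyadic blocks
  of times give the lower bound.\<close>

section \<open>Invariant means\<close>

text \<open>Passing to frequencies is what makes the gap usable. By orthogonality, the correlation
  of two characters at times n and n + k is the probability that the k increments in between carry
  one frequency to the other. Only absolute values of coefficients enter such a bound, so a gap for
  nonnegative functions on the nonzero frequencies is enough. A single frequency can have a large
  stabiliser, so an invariant mean on frequencies does not by itself live on a group; this is why
  several independent samples are taken. The kernel imitates an indicator function in the respect
  that matters: its coefficients add up to 1 and none exceeds its mean, so its squared L2 norm is at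
  most its mean. Unlike the indicator of a ball it has finitely many frequencies, and all sums stay
  finite. The price is a tail outside the ball. In the lower bound M is a small power larger than
  r^-2, which makes the tail negligible and costs only an eps in the exponent.\<close>

definition bdd_fun :: "('a \<Rightarrow> real) \<Rightarrow> bool" where
  "bdd_fun f \<longleftrightarrow> (\<exists>B. \<forall>x. \<bar>f x\<bar> \<le> B)"

lemma bdd_funI: "(\<And>x. \<bar>f x\<bar> \<le> B) \<Longrightarrow> bdd_fun f"
  by (auto simp: bdd_fun_def)

lemma bdd_fun_add: "bdd_fun f \<Longrightarrow> bdd_fun g \<Longrightarrow> bdd_fun (\<lambda>x. f x + g x)"
  unfolding bdd_fun_def by (meson abs_triangle_ineq add_mono order_trans)

lemma bdd_fun_cmult: "bdd_fun f \<Longrightarrow> bdd_fun (\<lambda>x. c * f x)"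
  unfolding bdd_fun_def by (metis abs_ge_zero abs_mult mult_left_mono)

lemma bdd_fun_of_bool [simp]: "bdd_fun (\<lambda>x. of_bool (P x))"
  by (rule bdd_funI[of _ 1]) simp

lemma bdd_fun_const [simp]: "bdd_fun (\<lambda>x. c)"
  by (rule bdd_funI[of _ "\<bar>c\<bar>"]) simp

lemma bdd_fun_compose: "bdd_fun f \<Longrightarrow> bdd_fun (\<lambda>x. f (h x))" for h
  by (auto simp: bdd_fun_def)

text \<open>A finitely additive probability measure, written as a functional so that it can be
  iterated: the mass of a set is the value at its indicator. \<open>M\<close> is total, but only its
  values on bounded functions are constrained.\<close>

definition is_mean :: "(('a \<Rightarrow> real) \<Rightarrow> real) \<Rightarrow> bool" where
  "is_mean M \<longleftrightarrow>
     (\<forall>f g. bdd_fun f \<longrightarrow> bdd_fun g \<longrightarrow> M (\<lambda>x. f x + g x) = M f + M g) \<and>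
     (\<forall>f c. bdd_fun f \<longrightarrow> M (\<lambda>x. c * f x) = c * M f) \<and>
     (\<forall>f. bdd_fun f \<longrightarrow> (\<forall>x. 0 \<le> f x) \<longrightarrow> 0 \<le> M f) \<and>
     M (\<lambda>x. 1) = 1"

context
  fixes M :: "('a \<Rightarrow> real) \<Rightarrow> real"
  assumes M: "is_mean M"
begin

lemma mean_add: "bdd_fun f \<Longrightarrow> bdd_fun g \<Longrightarrow> M (\<lambda>x. f x + g x) = M f + M g"
  using M by (simp add: is_mean_def)

lemma mean_cmult: "bdd_fun f \<Longrightarrow> M (\<lambda>x. c * f x) = c * M f"
  using M by (simp add: is_mean_def)

lemma mean_nonneg: "bdd_fun f \<Longrightarrow> (\<And>x. 0 \<le> f x) \<Longrightarrow> 0 \<le> M f"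
  using M by (simp add: is_mean_def)

lemma mean_const: "M (\<lambda>x. c) = c"
  using mean_cmult[of "\<lambda>x. 1" c] M by (simp add: is_mean_def)

lemma mean_mono:
  assumes "bdd_fun f" "bdd_fun g" "\<And>x. f x \<le> g x"
  shows "M f \<le> M g"
proof -
  have "bdd_fun (\<lambda>x. g x + (-1) * f x)"
    by (intro bdd_fun_add bdd_fun_cmult assms)
  then have "0 \<le> M (\<lambda>x. g x + (-1) * f x)"
    using assms(3) by (intro mean_nonneg) auto
  also have "\<dots> = M g + (-1) * M f"
    using assms by (simp only: mean_add bdd_fun_cmult mean_cmult)
  finally show ?thesis by simp
qed

lemma mean_abs_le:
  assumes "\<And>x. \<bar>f x\<bar> \<le> B"
  shows "\<bar>M f\<bar> \<le> B"
proof -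
  have "bdd_fun f" using assms by (rule bdd_funI)
  moreover have "f x \<le> B" "- B \<le> f x" for x
    using assms[of x] by auto
  ultimately show ?thesis
    using mean_mono[of f "\<lambda>_. B"] mean_mono[of "\<lambda>_. - B" f] by (simp add: mean_const abs_le_iff)
qed

end

text \<open>The law of \<open>r\<close> independent samples of the mean. Means do not satisfy
  Fubini's theorem, so the order is fixed: the head of the list is the outermost variable.\<close>

primrec iter_mean :: "(('a \<Rightarrow> real) \<Rightarrow> real) \<Rightarrow> nat \<Rightarrow> ('a list \<Rightarrow> real) \<Rightarrow> real" where
  "iter_mean M 0 f = f []"
| "iter_mean M (Suc r) f = M (\<lambda>x. iter_mean M r (\<lambda>xs. f (x # xs)))"

lemma iter_mean_abs_le:
  assumes M: "is_mean M" and f: "\<And>xs. \<bar>f xs\<bar> \<le> B"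
  shows "\<bar>iter_mean M r f\<bar> \<le> B"
  using f
proof (induction r arbitrary: f)
  case (Suc r)
  show ?case
    unfolding iter_mean.simps by (intro mean_abs_le[OF M] Suc.IH Suc.prems)
qed simp

lemma bdd_fun_iter_mean:
  assumes "is_mean M" "bdd_fun f"
  shows "bdd_fun (\<lambda>x. iter_mean M r (\<lambda>xs. f (x # xs)))"
proof -
  obtain B where "\<bar>f xs\<bar> \<le> B" for xs
    using assms(2) by (auto simp: bdd_fun_def)
  then show ?thesis
    by (intro bdd_funI[of _ B] iter_mean_abs_le[OF assms(1)])
qed

lemma is_mean_iter_mean:
  assumes M: "is_mean M"
  shows "is_mean (iter_mean M r)"
proof (induction r)
  case (Suc r)
  show ?case
    unfolding is_mean_def
  proof (intro conjI allI impI)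
    fix f g :: "'a list \<Rightarrow> real"
    assume "bdd_fun f" "bdd_fun g"
    then show "iter_mean M (Suc r) (\<lambda>x. f x + g x) = iter_mean M (Suc r) f + iter_mean M (Suc r) g"
      by (simp add: mean_add[OF Suc] bdd_fun_compose[of _ "(#) _"] mean_add[OF M] bdd_fun_iter_mean[OF M])
  next
    fix f :: "'a list \<Rightarrow> real" and c
    assume "bdd_fun f"
    then show "iter_mean M (Suc r) (\<lambda>x. c * f x) = c * iter_mean M (Suc r) f"
      by (simp add: mean_cmult[OF Suc] bdd_fun_compose[of _ "(#) _"] mean_cmult[OF M] bdd_fun_iter_mean[OF M])
  next
    fix f :: "'a list \<Rightarrow> real"
    assume "bdd_fun f" "\<forall>xs. 0 \<le> f xs"
    then show "0 \<le> iter_mean M (Suc r) f"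
      by (auto intro!: mean_nonneg[OF M] mean_nonneg[OF Suc] bdd_fun_iter_mean[OF M] bdd_fun_compose[of f "(#) _"])
  qed (simp add: mean_const[OF M] mean_const[OF Suc])
qed (simp add: is_mean_def)

lemma iter_mean_map:
  assumes M: "is_mean M" and inv: "\<And>h. bdd_fun h \<Longrightarrow> M (\<lambda>x. h (T x)) = M h" and f: "bdd_fun f"
  shows "iter_mean M r (\<lambda>xs. f (map T xs)) = iter_mean M r f"
  using f
proof (induction r arbitrary: f)
  case (Suc r)
  have "iter_mean M (Suc r) (\<lambda>xs. f (map T xs)) = M (\<lambda>x. iter_mean M r (\<lambda>xs. f (T x # xs)))"
    using Suc.IH[OF bdd_fun_compose[OF Suc.prems]] by simp
  also have "\<dots> = iter_mean M (Suc r) f"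
    using inv[OF bdd_fun_iter_mean[OF M Suc.prems]] by simp
  finally show ?case .
qed simp

lemma span_span_Un: "span (span A \<union> B) = span (A \<union> B)"
proof (rule subset_antisym)
  have "span A \<subseteq> span (A \<union> B)" "B \<subseteq> span (A \<union> B)"
    using span_mono[of A "A \<union> B"] span_superset[of "A \<union> B"] by auto
  then show "span (span A \<union> B) \<subseteq> span (A \<union> B)"
    by (intro span_minimal) auto
  show "span (A \<union> B) \<subseteq> span (span A \<union> B)"
    using span_superset[of A] by (intro span_mono) auto
qed

text \<open>If every proper subspace of \<^term>\<open>W\<close> misses a part of \<^term>\<open>W\<close> of mass at least
  \<^term>\<open>\<delta>\<close>, then, choosing vectors one after another, each new one leaves the span of the
  previous ones with mass at least \<^term>\<open>\<delta>\<close>.\<close>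

lemma iter_mean_spanning:
  fixes rv :: "'a \<Rightarrow> 'v::euclidean_space"
  assumes M: "is_mean M" and W: "subspace W" and "0 \<le> \<delta>"
    and gap: "\<And>U. subspace U \<Longrightarrow> U \<subset> W \<Longrightarrow> \<delta> \<le> M (\<lambda>x. of_bool (rv x \<in> W - U))"
    and U: "subspace U" "U \<subseteq> W" "dim U + r = dim W"
  shows "\<delta> ^ r \<le> iter_mean M r (\<lambda>xs. of_bool (span (U \<union> rv ` set xs) = W))"
  using U
proof (induction r arbitrary: U)
  case 0
  then have "U = W"
    using W by (metis add.right_neutral subspace_dim_equal le_refl)
  then show ?case
    using W by (simp add: span_eq_iff)
next
  case (Suc r)
  then have "U \<noteq> W" by auto
  then have "\<delta> \<le> M (\<lambda>x. of_bool (rv x \<in> W - U))"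
    using Suc.prems by (intro gap) auto
  then have "\<delta> ^ Suc r \<le> \<delta> ^ r * M (\<lambda>x. of_bool (rv x \<in> W - U))"
    using mult_left_mono[of \<delta> _ "\<delta> ^ r"] \<open>0 \<le> \<delta>\<close> by (simp add: mult.commute[of \<delta>])
  also have "\<dots> = M (\<lambda>x. \<delta> ^ r * of_bool (rv x \<in> W - U))"
    by (simp add: mean_cmult[OF M])
  also have "\<dots> \<le> M (\<lambda>x. iter_mean M r (\<lambda>xs. of_bool (span (U \<union> rv ` set (x # xs)) = W)))"
  proof (rule mean_mono[OF M])
    show "bdd_fun (\<lambda>x. \<delta> ^ r * of_bool (rv x \<in> W - U))"
      by (simp add: bdd_fun_cmult)
    show "bdd_fun (\<lambda>x. iter_mean M r (\<lambda>xs. of_bool (span (U \<union> rv ` set (x # xs)) = W)))"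
      by (rule bdd_fun_iter_mean[OF M]) simp
    fix x
    show "\<delta> ^ r * of_bool (rv x \<in> W - U)
        \<le> iter_mean M r (\<lambda>xs. of_bool (span (U \<union> rv ` set (x # xs)) = W))"
    proof (cases "rv x \<in> W - U")
      case True
      \<comment> \<open>The new vector lies outside \<open>U\<close>, so the dimension grows by
        exactly one and \<open>r\<close> samples remain.\<close>
      let ?U = "span (insert (rv x) U)"
      have "?U \<subseteq> W"
        using True Suc.prems W by (intro span_minimal) auto
      moreover have "dim ?U + r = dim W"
        using True Suc.prems by (simp add: dim_insert span_eq_iff[THEN iffD2])
      ultimately have "\<delta> ^ r \<le> iter_mean M r (\<lambda>xs. of_bool (span (?U \<union> rv ` set xs) = W))"
        by (intro Suc.IH) auto
      then show ?thesis
        using True by (simp add: span_span_Un)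
    next
      case False
      then show ?thesis
        by (auto intro!: mean_nonneg[OF is_mean_iter_mean[OF M]])
    qed
  qed
  finally show ?case by simp
qed

text \<open>The threshold \<open>1 - 2\<^sup>-\<^sup>r\<close> is such that if two subspaces of dimension
  \<^term>\<open>r\<close> exceed it, then their intersection exceeds the threshold for all dimensions
  below \<^term>\<open>r\<close>.\<close>

lemma invariant_subspace_of_mean:
  fixes rv :: "'a \<Rightarrow> 'v::euclidean_space" and L :: "'g \<Rightarrow> 'v \<Rightarrow> 'v"
  assumes M: "is_mean M"
    and inv: "\<And>g h. g \<in> \<Gamma> \<Longrightarrow> bdd_fun h \<Longrightarrow> M (\<lambda>x. h (T g x)) = M h"
    and L: "\<And>g. g \<in> \<Gamma> \<Longrightarrow> linear (L g)" "\<And>g. g \<in> \<Gamma> \<Longrightarrow> bij (L g)"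
      "\<And>g x. g \<in> \<Gamma> \<Longrightarrow> rv (T g x) = L g (rv x)"
    and M0: "M (\<lambda>x. of_bool (rv x = 0)) = 0"
  obtains W \<delta> where "subspace W" "W \<noteq> {0}" "\<And>g w. g \<in> \<Gamma> \<Longrightarrow> L g w \<in> W \<longleftrightarrow> w \<in> W" "0 < \<delta>"
    "\<And>U. subspace U \<Longrightarrow> U \<subset> W \<Longrightarrow> \<delta> \<le> M (\<lambda>x. of_bool (rv x \<in> W - U))"
proof -
  define m where "m W = M (\<lambda>x. of_bool (rv x \<in> W))" for W :: "'v set"
  define big where "big r \<longleftrightarrow> (\<exists>W. subspace W \<and> dim W = r \<and> 1 - (1/2) ^ r < m W)" for r :: nat
  have "big DIM('v)"
    unfolding big_def m_def using mean_const[OF M, of 1] by (intro exI[of _ "UNIV :: 'v set"] conjI) simp_all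
  define r where "r = (LEAST r. big r)"
  have "big r"
    unfolding r_def by (rule LeastI) fact
  then obtain W where W: "subspace W" "dim W = r" "1 - (1/2) ^ r < m W"
    by (auto simp: big_def)
  have less: "m U \<le> 1 - (1/2) ^ dim U" if "subspace U" "dim U < r" for U
    using that not_less_Least[of "dim U" big] unfolding r_def big_def by force
  have half: "(1/2) ^ dim U \<ge> 2 * (1/2 :: real) ^ r" if "dim U < r" for U :: "'v set"
  proof -
    have "(1/2 :: real) ^ r \<le> (1/2) ^ Suc (dim U)"
      using that by (intro power_decreasing) auto
    then show ?thesis by simp
  qed
  \<comment> \<open>In dimension 0 the threshold is 0, which the mass 0 of the zero space does not
    exceed.\<close>
  have ne: "W \<noteq> {0}"
  proof
    assume "W = {0}"
    then show False
      using W M0 by (simp add: m_def)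
  qed
  have "L g w \<in> W \<longleftrightarrow> w \<in> W" if g: "g \<in> \<Gamma>" for g w
  proof -
    let ?V = "L g -` W"
    have V: "subspace ?V"
      using L(1)[OF g] W(1) by (rule linear_subspace_vimage)
    have "dim ?V = dim (L g ` ?V)"
      by (rule dim_image_eq[OF L(1)[OF g], symmetric])
        (rule inj_on_subset[OF bij_is_inj[OF L(2)[OF g]] subset_UNIV])
    also have "L g ` ?V = W"
      using L(2)[OF g] by (simp add: bij_is_surj surj_image_vimage_eq)
    finally have dV: "dim ?V = r"
      using W by simp
    have "m ?V = m W"
      unfolding m_def using inv[OF g, of "\<lambda>x. of_bool (rv x \<in> W)"] by (simp add: L(3)[OF g])
    \<comment> \<open>Two sets of mass above 1 - 2^-r meet in mass above 1 - 2 * 2^-r, which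
      \<open>less\<close> and \<open>half\<close> exclude in dimension below \<open>r\<close>; so
      the preimage and \<open>W\<close> coincide.\<close>
    have "m ?V + m W \<le> 1 + m (?V \<inter> W)"
    proof -
      have "m ?V + m W = M (\<lambda>x. of_bool (rv x \<in> ?V) + of_bool (rv x \<in> W))"
        unfolding m_def by (rule mean_add[OF M, symmetric]) auto
      also have "\<dots> \<le> M (\<lambda>x. 1 + of_bool (rv x \<in> ?V \<inter> W))"
        by (rule mean_mono[OF M]) (auto intro!: bdd_fun_add)
      also have "\<dots> = 1 + m (?V \<inter> W)"
        unfolding m_def by (subst mean_add[OF M]) (auto simp: mean_const[OF M])
      finally show ?thesis .
    qed
    then have big: "1 - 2 * (1/2) ^ r < m (?V \<inter> W)"
      using W \<open>m ?V = m W\<close> by simp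
    have VW: "subspace (?V \<inter> W)"
      using V W(1) by (rule subspace_inter)
    have "\<not> dim (?V \<inter> W) < r"
    proof
      assume "dim (?V \<inter> W) < r"
      then show False
        using less[OF VW] half[of "?V \<inter> W"] big by linarith
    qed
    then have "?V \<inter> W = W" "?V \<inter> W = ?V"
      using subspace_dim_equal[OF VW W(1)] subspace_dim_equal[OF VW V] W(2) dV
      by (metis Int_lower2 not_less order_refl, metis Int_lower1 not_less order_refl)
    then show ?thesis by blast
  qed
  \<comment> \<open>Here \<delta> is 2^-r: \<open>W\<close> has mass above 1 - 2^-r, and a proper
    subspace has mass at most 1 - 2 * 2^-r by minimality of \<open>r\<close>.\<close>
  moreover have "(1/2) ^ r \<le> M (\<lambda>x. of_bool (rv x \<in> W - U))" if U: "subspace U" "U \<subset> W" for U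
  proof -
    have "dim U \<noteq> r"
      using subspace_dim_equal[OF U(1) W(1)] U W by auto
    moreover have "dim U \<le> r"
      using U W dim_subset[of U W] by auto
    ultimately have "dim U < r" by simp
    have "m W = M (\<lambda>x. of_bool (rv x \<in> U) + of_bool (rv x \<in> W - U))"
      unfolding m_def using U by (intro arg_cong[where f = M] ext) (auto simp: of_bool_def)
    also have "\<dots> = m U + M (\<lambda>x. of_bool (rv x \<in> W - U))"
      unfolding m_def by (rule mean_add[OF M]) auto
    finally show ?thesis
      using less[OF U(1) \<open>dim U < r\<close>] half[OF \<open>dim U < r\<close>] W by simp
  qed
  ultimately show ?thesis
    using that[OF W(1) ne, of "(1 / 2) ^ r"] by simp
qed

section \<open>Characters of the torus and factor tori\<close>

definition int_vec :: "int ^ 'n::finite \<Rightarrow> real ^ 'n" where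
  "int_vec a = (\<chi> i. real_of_int (a $ i))"

lemma int_vec_vector_matrix_mult:
  "int_vec (a v* A) = int_vec a v* map_matrix real_of_int A"
  by (simp add: vec_eq_iff int_vec_def vector_matrix_mult_def)

lemma int_vec_eq_0_iff [simp]: "int_vec a = 0 \<longleftrightarrow> a = 0"
  by (simp add: vec_eq_iff int_vec_def)

lemma int_vec_inner: "int_vec a \<bullet> u = (\<Sum>i\<in>UNIV. real_of_int (a $ i) * u $ i)"
  by (simp add: int_vec_def inner_vec_def)

lemma int_vec_inner_lattice:
  assumes "z \<in> int_lattice"
  shows "int_vec a \<bullet> z \<in> \<int>"
  using assms by (auto simp: int_lattice_def int_vec_inner intro!: Ints_sum)

lemma cis_2pi_add_Ints:
  assumes "t \<in> \<int>"
  shows "cis (2 * pi * (s + t)) = cis (2 * pi * s)"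
proof -
  have "cis (2 * pi * (s + t)) = cis (2 * pi * s) * cis (2 * pi * t)"
    by (simp add: distrib_left cis_mult)
  then show ?thesis
    using cis_multiple_2pi[OF assms] by simp
qed

lemma cis_2pi_inner_lattice:
  assumes "u - v \<in> int_lattice"
  shows "cis (2 * pi * (int_vec a \<bullet> u)) = cis (2 * pi * (int_vec a \<bullet> v))"
  using cis_2pi_add_Ints[OF int_vec_inner_lattice[OF assms, of a], of "int_vec a \<bullet> v"]
  by (simp add: inner_diff_right)

lift_definition torus_char :: "int ^ 'n::finite \<Rightarrow> 'n torus \<Rightarrow> complex"
  is "\<lambda>a u. cis (2 * pi * (int_vec a \<bullet> u))"
  by (rule cis_2pi_inner_lattice) (simp add: torus_rel_def)

lemma torus_char_plus: "torus_char a (x + y) = torus_char a x * torus_char a y"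
  by transfer (simp add: inner_add_right cis_mult distrib_left)

lemma norm_torus_char [simp]: "norm (torus_char a x) = 1"
  by transfer simp

lemma torus_char_0 [simp]: "torus_char 0 x = 1"
  by transfer (simp add: int_vec_inner)

lemma torus_char_0_right [simp]: "torus_char a 0 = 1"
  by transfer simp

lemma torus_char_minus: "torus_char a (- x) = cnj (torus_char a x)"
  by transfer (simp add: cis_cnj)

lemma torus_char_diff: "torus_char a (x - y) = torus_char a x * cnj (torus_char a y)"
  using torus_char_plus[of a x "- y"] by (simp add: torus_char_minus)

lemma torus_char_mult_cnj: "torus_char a x * cnj (torus_char b x) = torus_char (a - b) x"
  by transfer (simp add: cis_cnj cis_mult int_vec_inner sum_subtractf left_diff_distrib right_diff_distrib)

lemma torus_char_act: "torus_char a (torus_act A x) = torus_char (a v* A) x"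
  by transfer (simp add: int_vec_vector_matrix_mult dot_lmul_matrix)

lemma torus_char_nontrivial:
  assumes "a \<noteq> 0"
  obtains x where "torus_char a x \<noteq> 1"
proof -
  obtain i where i: "a $ i \<noteq> 0"
    using assms by (auto simp: vec_eq_iff)
  \<comment> \<open>Half a period in a coordinate where \<open>a\<close> does not vanish: the
    character takes the value -1 there.\<close>
  have "int_vec a \<bullet> axis i (1 / (2 * real_of_int (a $ i))) = 1 / 2"
    using i by (simp add: inner_axis int_vec_def)
  then have "torus_char a (to_torus (axis i (1 / (2 * real_of_int (a $ i))))) = cis (2 * pi * (1 / 2))"
    by (simp only: torus_char.abs_eq)
  then show ?thesis
    using that[of "to_torus (axis i (1 / (2 * real_of_int (a $ i))))"] by simp
qed

text \<open>The metric is an infimum over lattice translates and the character does not see the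
  translate, so the Euclidean bound passes to the infimum. This is how continuity, and with it
  measurability, is obtained on the quotient.\<close>

lemma torus_char_lipschitz:
  "norm (torus_char a x - torus_char a y) \<le> 2 * pi * norm (int_vec a) * dist x y"
proof transfer
  fix a :: "int ^ 'n" and u v :: "real ^ 'n"
  let ?L = "norm (cis (2 * pi * (int_vec a \<bullet> u)) - cis (2 * pi * (int_vec a \<bullet> v)))"
  have ne: "(int_lattice :: (real ^ 'n) set) \<noteq> {}"
    using int_lattice_0 by blast
  have cis: "norm (cis s - cis t) \<le> \<bar>s - t\<bar>" for s t :: real
  proof -
    have "norm (cis s - cis t) = norm (cis t * (cis (s - t) - 1))"
      by (simp add: right_diff_distrib cis_mult)
    also have "\<dots> = norm (exp (\<i> * of_real (s - t)) - 1)"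
      by (simp only: norm_mult norm_cis mult_1 cis_conv_exp[of "s - t"])
    also have "\<dots> = 2 * \<bar>sin ((s - t) / 2)\<bar>"
      by (rule dist_exp_i_1)
    also have "\<dots> \<le> \<bar>s - t\<bar>"
      using abs_sin_x_le_abs_x[of "(s - t) / 2"] by simp
    finally show ?thesis .
  qed
  show "?L \<le> 2 * pi * norm (int_vec a) * infdist (u - v) int_lattice"
  proof (cases "int_vec a = 0")
    case False
    have "?L / (2 * pi * norm (int_vec a)) \<le> infdist (u - v) int_lattice"
      unfolding infdist_notempty[OF ne]
    proof (rule cINF_greatest[OF ne])
      fix z :: "real ^ 'n"
      assume "z \<in> int_lattice"
      then have "cis (2 * pi * (int_vec a \<bullet> u)) = cis (2 * pi * (int_vec a \<bullet> (u - z)))"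
        by (intro cis_2pi_inner_lattice) simp
      then have "?L \<le> \<bar>2 * pi * (int_vec a \<bullet> (u - z)) - 2 * pi * (int_vec a \<bullet> v)\<bar>"
        using cis by metis
      also have "\<dots> = 2 * pi * \<bar>int_vec a \<bullet> (u - v - z)\<bar>"
        by (simp add: inner_diff_right abs_mult right_diff_distrib flip: right_diff_distrib)
      also have "\<dots> \<le> 2 * pi * (norm (int_vec a) * dist (u - v) z)"
        unfolding dist_norm by (intro mult_left_mono Cauchy_Schwarz_ineq2) simp
      finally show "?L / (2 * pi * norm (int_vec a)) \<le> dist (u - v) z"
        using False by (simp add: field_simps)
    qed
    then show ?thesis
      using False by (simp add: field_simps)
  qed (simp add: int_vec_inner infdist_nonneg)
qed

lemma continuous_torus_char: "continuous_on A (torus_char a)"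
proof (rule continuous_on_subset[OF _ subset_UNIV])
  have "(2 * pi * norm (int_vec a))-lipschitz_on UNIV (torus_char a)"
    by (rule lipschitz_onI) (simp_all add: dist_norm torus_char_lipschitz)
  then show "continuous_on UNIV (torus_char a)"
    by (rule lipschitz_on_continuous_on)
qed

lemma measurable_torus_char [measurable]: "torus_char a \<in> borel_measurable borel"
  by (intro borel_measurable_continuous_onI continuous_torus_char)

section \<open>Factor tori from invariant subspaces of frequencies\<close>

lemma subgroup_torus_Aut_inverse:
  assumes "subgroup \<Gamma> torus_Aut" "A \<in> \<Gamma>"
  obtains B where "B \<in> \<Gamma>" "B ** A = mat 1" "A ** B = mat 1"
  using that[of "inv\<^bsub>torus_Aut\<^esub> A"] subgroup.m_inv_closed[OF assms] subgroup.mem_carrier[OF assms]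
    group.l_inv[OF group_torus_Aut, of A] group.r_inv[OF group_torus_Aut, of A]
  by (auto simp: torus_Aut_def)

definition annihilator :: "(real ^ 'n::finite) set \<Rightarrow> 'n torus set" where
  "annihilator W = {x. \<forall>a. int_vec a \<in> W \<longrightarrow> torus_char a x = 1}"

text \<open>\<open>torus_char_act\<close> moves a matrix from the point to the frequency, where it
  preserves \<open>W\<close>. That the annihilator is mapped onto itself, and not only into itself,
  comes from the inverse matrix in the group.\<close>

lemma invariant_factor_torus_annihilator:
  assumes \<Gamma>: "subgroup \<Gamma> torus_Aut"
    and W: "\<And>A w. A \<in> \<Gamma> \<Longrightarrow> w v* map_matrix real_of_int A \<in> W \<longleftrightarrow> w \<in> W"
  shows "invariant_factor_torus \<Gamma> (annihilator W)"
  unfolding invariant_factor_torus_def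
proof (intro conjI ballI)
  interpret T: group torus_group
    using comm_group_torus_group by (rule comm_group.axioms)
  have inv: "inv\<^bsub>torus_group\<^esub> x = - x" for x :: "'a torus"
    by (rule T.inv_equality) (auto simp: torus_group_def)
  show "subgroup (annihilator W) torus_group"
  proof (rule T.subgroupI)
    show "annihilator W \<noteq> {}"
      by (auto simp: annihilator_def intro: exI[of _ 0])
    show "inv\<^bsub>torus_group\<^esub> x \<in> annihilator W" if "x \<in> annihilator W" for x
      using that by (auto simp: inv annihilator_def torus_char_minus)
  qed (auto simp: annihilator_def torus_group_def torus_char_plus)
  have "annihilator W = (\<Inter>a\<in>{a. int_vec a \<in> W}. torus_char a -` {1})"
    by (auto simp: annihilator_def)
  also have "closed \<dots>"
    by (intro closed_INT ballI closed_vimage continuous_torus_char) simp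
  finally show "closed (annihilator W)" .
  fix A
  assume A: "A \<in> \<Gamma>"
  have sub: "torus_act A x \<in> annihilator W" if "x \<in> annihilator W" "A \<in> \<Gamma>" for A x
    using that by (auto simp: annihilator_def torus_char_act int_vec_vector_matrix_mult W)
  obtain B where B: "B \<in> \<Gamma>" "B ** A = mat 1" "A ** B = mat 1"
    using subgroup_torus_Aut_inverse[OF \<Gamma> A] .
  show "torus_act A ` annihilator W = annihilator W"
  proof
    show "torus_act A ` annihilator W \<subseteq> annihilator W"
      using sub A by blast
    show "annihilator W \<subseteq> torus_act A ` annihilator W"
    proof
      fix x
      assume "x \<in> annihilator W"
      then have "torus_act B x \<in> annihilator W"
        using sub B by blast
      moreover have "x = torus_act A (torus_act B x)"
        by (simp add: torus_act_mult[symmetric] B torus_act_one)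
      ultimately show "x \<in> torus_act A ` annihilator W"
        by blast
    qed
  qed
qed

text \<open>The cosets of \<open>A x\<close> and \<open>B x\<close> agree as soon as every character
  with frequency in \<open>W\<close> agrees at the two points. So the induced automorphism depends
  only on the action on \<open>W\<close>.\<close>

lemma induced_aut_annihilator_cong:
  assumes S: "invariant_factor_torus \<Gamma> (annihilator W)" and AB: "A \<in> \<Gamma>" "B \<in> \<Gamma>"
    and eq: "\<And>w. w \<in> W \<Longrightarrow> w v* map_matrix real_of_int A = w v* map_matrix real_of_int B"
  shows "induced_aut (annihilator W) A = induced_aut (annihilator W) B"
  unfolding induced_aut_def
proof (rule restrict_ext)
  let ?S = "annihilator W"
  fix C
  assume "C \<in> carrier (torus_group Mod ?S)"
  then obtain x where x: "C = (\<lambda>y. y + x) ` ?S"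
    by (auto simp: carrier_factor)
  have char: "torus_char a (torus_act A x) = torus_char a (torus_act B x)" if "int_vec a \<in> W" for a
  proof -
    have "int_vec (a v* A) = int_vec (a v* B)"
      unfolding int_vec_vector_matrix_mult by (rule eq) fact
    then have "a v* A = a v* B"
      by (simp add: int_vec_def vec_eq_iff)
    then show ?thesis
      by (simp add: torus_char_act)
  qed
  have "(\<lambda>y. y + torus_act A x) ` ?S = (\<lambda>y. y + torus_act B x) ` ?S"
  proof -
    have sub: "(\<lambda>y. y + u) ` ?S \<subseteq> (\<lambda>y. y + v) ` ?S"
      if uv: "\<And>a. int_vec a \<in> W \<Longrightarrow> torus_char a u = torus_char a v" for u v
    proof
      fix z
      assume "z \<in> (\<lambda>y. y + u) ` ?S"
      then obtain y where y: "y \<in> ?S" "z = y + u" by blast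
      have "torus_char a v * cnj (torus_char a v) = 1" for a
        by (simp add: torus_char_mult_cnj)
      then have "y + u - v \<in> ?S"
        using y uv by (auto simp: annihilator_def torus_char_plus torus_char_diff)
      then show "z \<in> (\<lambda>y. y + v) ` ?S"
        using y by (auto intro!: image_eqI[of _ _ "y + u - v"])
    qed
    show ?thesis
      using sub[of "torus_act A x" "torus_act B x"] sub[of "torus_act B x" "torus_act A x"] char
      by (intro subset_antisym) auto
  qed
  then show "torus_act A ` C = torus_act B ` C"
    using S AB by (simp add: x torus_act_coset invariant_factor_torus_def)
qed


text \<open>A spanning list of vectors of \<^term>\<open>W\<close> is fixed only by elements acting trivially on
  \<^term>\<open>W\<close>. So, once a representative is chosen in every orbit of such lists, the list
  determines the element of the induced group that moves it to its representative, and the mean on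
  lists can be pushed forward to that group.\<close>

lemma amenable_factor_of_invariant_mean:
  fixes \<Gamma> :: "(int ^ 'n::finite ^ 'n) set" and M :: "(int ^ 'n \<Rightarrow> real) \<Rightarrow> real"
  assumes \<Gamma>: "subgroup \<Gamma> torus_Aut" and M: "is_mean M"
    and inv: "\<And>A h. A \<in> \<Gamma> \<Longrightarrow> bdd_fun h \<Longrightarrow> M (\<lambda>a. h (a v* A)) = M h"
    and M0: "M (\<lambda>a. of_bool (a = 0)) = 0"
  shows "\<exists>S. invariant_factor_torus \<Gamma> S \<and> S \<noteq> UNIV \<and> amenable (factor_projection \<Gamma> S)"
proof -
  define L where "L A w = w v* map_matrix real_of_int A" for A :: "int ^ 'n ^ 'n" and w :: "real ^ 'n"
  have L_mult: "L (A ** B) w = L B (L A w)" for A B w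
    by (simp add: L_def map_matrix_of_int_mult vector_matrix_mul_assoc)
  have L_one: "L (mat 1) w = w" for w
    by (simp add: L_def map_matrix_of_int_one)
  have lin: "linear (L A)" for A
  proof -
    have "L A = (\<lambda>w. transpose (map_matrix real_of_int A) *v w)"
      by (simp add: L_def fun_eq_iff)
    then show ?thesis
      using matrix_vector_mul_linear by metis
  qed
  have bij: "bij (L A)" if A: "A \<in> \<Gamma>" for A
  proof -
    obtain B where B: "B ** A = mat 1" "A ** B = mat 1"
      using subgroup_torus_Aut_inverse[OF \<Gamma> A] by metis
    then have "L A (L B w) = w" "L B (L A w) = w" for w
      by (simp_all add: L_mult[symmetric] L_one)
    then show ?thesis
      by (intro o_bij[of "L B"]) (auto simp: fun_eq_iff)
  qed
  have L_int_vec: "int_vec (a v* A) = L A (int_vec a)" for A a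
    by (simp add: L_def int_vec_vector_matrix_mult)
  have M0': "M (\<lambda>a. of_bool (int_vec a = 0)) = 0"
    using M0 by simp
  obtain W \<delta> where W: "subspace W" "W \<noteq> {0}" "\<And>A w. A \<in> \<Gamma> \<Longrightarrow> L A w \<in> W \<longleftrightarrow> w \<in> W"
    and "0 < \<delta>"
    and gap: "\<And>U. subspace U \<Longrightarrow> U \<subset> W \<Longrightarrow> \<delta> \<le> M (\<lambda>a. of_bool (int_vec a \<in> W - U))"
    using invariant_subspace_of_mean[where T = "\<lambda>A a. a v* A", OF M inv lin bij L_int_vec M0'] by blast
  let ?S = "annihilator W" and ?r = "dim W"
  let ?i = "induced_aut ?S"
  have S: "invariant_factor_torus \<Gamma> ?S"
    using W(3) by (intro invariant_factor_torus_annihilator[OF \<Gamma>]) (auto simp: L_def)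
  \<comment> \<open>By \<open>gap\<close> for the zero subspace, \<open>W - {0}\<close> carries mass
    at least \<delta> and so contains a frequency; its character shows that the annihilator is
    proper.\<close>
  have "\<exists>a. a \<noteq> 0 \<and> int_vec a \<in> W"
  proof (rule ccontr)
    assume "\<not> ?thesis"
    then have "(\<lambda>a. of_bool (int_vec a \<in> W - {0})) = (\<lambda>a. 0 :: real)"
      by (auto simp: fun_eq_iff)
    moreover have "\<delta> \<le> M (\<lambda>a. of_bool (int_vec a \<in> W - {0}))"
      using W by (intro gap) (auto dest: subspace_0)
    ultimately show False
      using mean_const[OF M, of 0] \<open>0 < \<delta>\<close> by simp
  qed
  then obtain a where a: "a \<noteq> 0" "int_vec a \<in> W"
    by blast
  obtain x where "torus_char a x \<noteq> 1"
    using torus_char_nontrivial[OF a(1)] .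
  then have "x \<notin> ?S"
    using a by (auto simp: annihilator_def)
  then have "?S \<noteq> UNIV"
    by blast
  define spanning where "spanning xs \<longleftrightarrow> span (int_vec ` set xs) = W" for xs :: "(int ^ 'n) list"
  define act where "act A xs = map (\<lambda>a. a v* A) xs" for A :: "int ^ 'n ^ 'n" and xs :: "(int ^ 'n) list"
  have act_mult: "act (A ** B) xs = act B (act A xs)" for A B xs
    by (simp add: act_def vector_matrix_mul_assoc)
  have act_one: "act (mat 1) xs = xs" for xs
    by (simp add: act_def)
  have int_vec_act: "int_vec ` set (act A xs) = L A ` int_vec ` set xs" for A xs
    by (simp add: act_def image_image L_def int_vec_vector_matrix_mult)
  have inverse: "\<exists>B\<in>\<Gamma>. B ** A = mat 1 \<and> A ** B = mat 1" if A: "A \<in> \<Gamma>" for A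
    using subgroup_torus_Aut_inverse[OF \<Gamma> A] by metis
  have mult_closed: "A ** B \<in> \<Gamma>" if "A \<in> \<Gamma>" "B \<in> \<Gamma>" for A B
    using subgroup.m_closed[OF \<Gamma> that] by (simp add: torus_Aut_def)
  have image_W: "L A ` W = W" if A: "A \<in> \<Gamma>" for A
  proof
    show "L A ` W \<subseteq> W" using W(3)[OF A] by auto
    show "W \<subseteq> L A ` W"
    proof
      fix w assume "w \<in> W"
      moreover obtain v where "w = L A v"
        using bij[OF A] by (metis bij_pointE)
      ultimately show "w \<in> L A ` W"
        using W(3)[OF A] by auto
    qed
  qed
  have spanning_act: "spanning (act A xs) \<longleftrightarrow> spanning xs" if A: "A \<in> \<Gamma>" for A xs
  proof -
    have "span (int_vec ` set (act A xs)) = L A ` span (int_vec ` set xs)"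
      unfolding int_vec_act by (rule linear_span_image[OF lin])
    then show ?thesis
      unfolding spanning_def using image_W[OF A] bij_is_inj[OF bij[OF A]]
      by (metis inj_image_eq_iff)
  qed
  have i_eq: "?i A = ?i B" if xs: "spanning xs" and eq: "act A xs = act B xs" and AB: "A \<in> \<Gamma>" "B \<in> \<Gamma>"
    for A B xs
  proof (rule induced_aut_annihilator_cong[OF S AB])
    fix w
    assume "w \<in> W"
    then have "w \<in> span (int_vec ` set xs)"
      using xs by (simp add: spanning_def)
    moreover have "L A v = L B v" if "v \<in> int_vec ` set xs" for v
      using that eq by (auto simp: L_def act_def int_vec_vector_matrix_mult[symmetric])
    ultimately have "L A w = L B w"
      using linear_eq_on[OF lin lin] by blast
    then show "w v* map_matrix real_of_int A = w v* map_matrix real_of_int B"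
      by (simp add: L_def)
  qed
  define orbit where "orbit xs = (\<lambda>A. act A xs) ` \<Gamma>" for xs
  have orbit_act: "orbit (act A xs) = orbit xs" if A: "A \<in> \<Gamma>" for A xs
  proof -
    obtain B where B: "B \<in> \<Gamma>" "B ** A = mat 1" "A ** B = mat 1"
      using inverse[OF A] by blast
    have "act C xs = act (B ** C) (act A xs)" for C
      by (simp add: act_mult[symmetric] matrix_mul_assoc B)
    then show ?thesis
      unfolding orbit_def using mult_closed A B(1) by (auto simp: act_mult[symmetric])
  qed
  have one: "mat 1 \<in> \<Gamma>"
    using subgroup.one_closed[OF \<Gamma>] by (simp add: torus_Aut_def)
  \<comment> \<open>The choice depends on \<open>xs\<close> only through its orbit, so all lists of
    an orbit share one representative.\<close>
  define rep where "rep xs = (SOME ys. ys \<in> orbit xs)" for xs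
  have rep: "rep xs \<in> orbit xs" for xs
    unfolding rep_def by (rule someI[of _ "act (mat 1) xs"]) (use one in \<open>auto simp: orbit_def\<close>)
  \<comment> \<open>\<open>el xs\<close> is an arbitrary choice; for spanning \<open>xs\<close> its
    image under \<open>?i\<close> is not, by \<open>i_eq\<close>.\<close>
  define el where "el xs = (SOME A. A \<in> \<Gamma> \<and> act A xs = rep xs)" for xs
  have el: "el xs \<in> \<Gamma>" "act (el xs) xs = rep xs" for xs
  proof -
    obtain A where "A \<in> \<Gamma> \<and> act A xs = rep xs"
      using rep[of xs] by (auto simp: orbit_def)
    then have "el xs \<in> \<Gamma> \<and> act (el xs) xs = rep xs"
      unfolding el_def by (rule someI)
    then show "el xs \<in> \<Gamma>" "act (el xs) xs = rep xs"
      by auto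
  qed
  have rep_act: "rep (act A xs) = rep xs" if "A \<in> \<Gamma>" for A xs
    using orbit_act[OF that] by (simp add: rep_def)
  let ?G = "factor_projection \<Gamma> ?S"
  have hom: "?i \<in> hom (torus_Aut \<lparr>carrier := \<Gamma>\<rparr>) (AutoGroup (torus_group Mod ?S))"
    by (rule induced_aut_hom[OF \<Gamma> S])
  have G_mult: "?i A \<otimes>\<^bsub>?G\<^esub> ?i B = ?i (A ** B)" if "A \<in> \<Gamma>" "B \<in> \<Gamma>" for A B
    using hom_mult[OF hom, of A B] that by (simp add: factor_projection_def torus_Aut_def)
  have carrier_G: "carrier ?G = ?i ` \<Gamma>"
    by (simp add: factor_projection_def)
  interpret G: group ?G
    by (rule group_factor_projection[OF \<Gamma> S])
  \<comment> \<open>\<open>act\<close> is a right action, so moving \<open>xs\<close> by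
    \<open>A\<close> divides the group element by \<open>A\<close> on the left; this is why
    invariance of the mean becomes left invariance of \<nu>.\<close>
  have equiv: "?i A \<otimes>\<^bsub>?G\<^esub> ?i (el (act A xs)) = ?i (el xs)" if "spanning xs" "A \<in> \<Gamma>" for A xs
  proof -
    have "act (A ** el (act A xs)) xs = act (el xs) xs"
      using that by (simp add: act_mult el rep_act)
    then have "?i (A ** el (act A xs)) = ?i (el xs)"
      by (rule i_eq[OF that(1)]) (intro el mult_closed that)+
    then show ?thesis
      using that el by (simp add: G_mult)
  qed
  define c where "c = iter_mean M ?r (\<lambda>xs. of_bool (spanning xs))"
  \<comment> \<open>The push-forward of the mean on lists, conditioned on the event, of mass
    \<open>c\<close>, that the list spans \<open>W\<close>.\<close>
  define \<nu> where "\<nu> E = iter_mean M ?r (\<lambda>xs. of_bool (spanning xs \<and> ?i (el xs) \<in> E)) / c" for E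
  have IM: "is_mean (iter_mean M ?r)"
    by (rule is_mean_iter_mean[OF M])
  have "\<delta> ^ ?r \<le> iter_mean M ?r (\<lambda>xs. of_bool (span ({0} \<union> int_vec ` set xs) = W))"
    by (rule iter_mean_spanning[OF M W(1)]) (use \<open>0 < \<delta>\<close> W(1) gap in \<open>auto dest: subspace_0\<close>)
  then have "\<delta> ^ ?r \<le> c"
    by (simp add: c_def spanning_def)
  then have "0 < c"
    using \<open>0 < \<delta>\<close> by (meson less_le_trans zero_less_power)
  have "amenable ?G"
    unfolding amenable_def
  proof (intro conjI exI[of _ \<nu>] allI impI G.is_group)
    show "0 \<le> \<nu> E" for E
      unfolding \<nu>_def using \<open>0 < c\<close> by (intro divide_nonneg_pos mean_nonneg[OF IM]) auto
    have "?i (el xs) \<in> carrier ?G" for xs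
      using el by (simp add: carrier_G)
    then show "\<nu> (carrier ?G) = 1"
      using \<open>0 < c\<close> by (simp add: \<nu>_def c_def)
    show "\<nu> (E \<union> F) = \<nu> E + \<nu> F" if "E \<inter> F = {}" for E F
    proof -
      have "(\<lambda>xs. of_bool (spanning xs \<and> ?i (el xs) \<in> E \<union> F) :: real)
          = (\<lambda>xs. of_bool (spanning xs \<and> ?i (el xs) \<in> E) + of_bool (spanning xs \<and> ?i (el xs) \<in> F))"
        using that by (auto simp: fun_eq_iff)
      then show ?thesis
        by (simp add: \<nu>_def mean_add[OF IM] add_divide_distrib)
    qed
    show "\<nu> (g <#\<^bsub>?G\<^esub> E) = \<nu> E" if g: "g \<in> carrier ?G" and E: "E \<subseteq> carrier ?G" for g E
    proof -
      obtain A where A: "A \<in> \<Gamma>" "g = ?i A"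
        using g by (auto simp: carrier_G)
      have iff: "?i (el xs) \<in> g <#\<^bsub>?G\<^esub> E \<longleftrightarrow> ?i (el (act A xs)) \<in> E" if "spanning xs" for xs
      proof -
        let ?y = "?i (el (act A xs))"
        have y: "?y \<in> carrier ?G"
          using el by (simp add: carrier_G)
        have eq: "?i (el xs) = g \<otimes>\<^bsub>?G\<^esub> ?y"
          using equiv[OF that A(1)] A(2) by simp
        show ?thesis
        proof
          assume "?i (el xs) \<in> g <#\<^bsub>?G\<^esub> E"
          then obtain e where e: "e \<in> E" "g \<otimes>\<^bsub>?G\<^esub> ?y = g \<otimes>\<^bsub>?G\<^esub> e"
            unfolding eq l_coset_def by blast
          moreover have "e \<in> carrier ?G"
            using e E by blast
          ultimately show "?y \<in> E"
            using G.Units_l_cancel[of g ?y e] g y by (simp add: G.Units_eq)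
        next
          assume "?y \<in> E"
          then show "?i (el xs) \<in> g <#\<^bsub>?G\<^esub> E"
            unfolding eq l_coset_def by blast
        qed
      qed
      have "(\<lambda>xs. of_bool (spanning xs \<and> ?i (el xs) \<in> g <#\<^bsub>?G\<^esub> E) :: real)
          = (\<lambda>xs. of_bool (spanning (act A xs) \<and> ?i (el (act A xs)) \<in> E))"
        using iff by (auto simp: fun_eq_iff spanning_act[OF A(1)])
      moreover have "iter_mean M ?r (\<lambda>xs. of_bool (spanning (act A xs) \<and> ?i (el (act A xs)) \<in> E))
          = iter_mean M ?r (\<lambda>xs. of_bool (spanning xs \<and> ?i (el xs) \<in> E))"
        unfolding act_def
        by (rule iter_mean_map[OF M inv[OF A(1)], of "\<lambda>xs. of_bool (spanning xs \<and> ?i (el xs) \<in> E)"]) auto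
      ultimately show ?thesis
        by (simp add: \<nu>_def)
    qed
  qed
  with S \<open>?S \<noteq> UNIV\<close> show ?thesis
    by blast
qed

section \<open>Averaging operators without spectral gap\<close>

text \<open>Tychonoff's theorem gives a generalised limit: the functionals lie in a product of
  compact intervals, and a cluster point inherits linearity and positivity. Limits that exist along
  the sequence are kept, which yields the normalisation here and the invariance later.\<close>

lemma mean_of_approximate_means:
  fixes \<Phi> :: "nat \<Rightarrow> ('a \<Rightarrow> real) \<Rightarrow> real"
  assumes bound: "\<And>n h B. (\<And>x. \<bar>h x\<bar> \<le> B) \<Longrightarrow> \<bar>\<Phi> n h\<bar> \<le> B"
    and add: "\<And>n f g. bdd_fun f \<Longrightarrow> bdd_fun g \<Longrightarrow> \<Phi> n (\<lambda>x. f x + g x) = \<Phi> n f + \<Phi> n g"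
    and cmult: "\<And>n f c. bdd_fun f \<Longrightarrow> \<Phi> n (\<lambda>x. c * f x) = c * \<Phi> n f"
    and nonneg: "\<And>n f. bdd_fun f \<Longrightarrow> (\<And>x. 0 \<le> f x) \<Longrightarrow> 0 \<le> \<Phi> n f"
    and one: "(\<lambda>n. \<Phi> n (\<lambda>x. 1)) \<longlonglongrightarrow> 1"
  obtains M where "is_mean M" "\<And>h c. bdd_fun h \<Longrightarrow> (\<lambda>n. \<Phi> n h) \<longlonglongrightarrow> c \<Longrightarrow> M h = c"
proof -
  define bnd where "bnd h = (if bdd_fun h then SOME B. \<forall>x. \<bar>h x\<bar> \<le> B else 0)" for h :: "'a \<Rightarrow> real"
  \<comment> \<open>On unbounded functions the interval shrinks to the point 0, so
    \<open>\<Psi> n\<close> must vanish there to lie in \<open>K\<close>.\<close>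
  define \<Psi> where "\<Psi> n h = (if bdd_fun h then \<Phi> n h else 0)" for n h
  define K where "K = PiE UNIV (\<lambda>h. {- bnd h .. bnd h})"
  have "compactin (product_topology (\<lambda>h::'a \<Rightarrow> real. euclidean) UNIV) K"
    unfolding K_def by (subst compactin_PiE) auto
  then have "compact K"
    by (simp add: euclidean_product_topology)
  have bnd: "\<bar>h x\<bar> \<le> bnd h" if "bdd_fun h" for h x
    using that someI_ex[of "\<lambda>B. \<forall>x. \<bar>h x\<bar> \<le> B"] unfolding bnd_def by (simp add: bdd_fun_def)
  have "\<bar>\<Psi> n h\<bar> \<le> bnd h" for n h
    using bound[of h "bnd h" n] bnd[of h] by (cases "bdd_fun h") (auto simp: \<Psi>_def bnd_def)
  then have "\<Psi> n \<in> K" for n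
    unfolding K_def by (auto simp: abs_le_iff) (metis minus_le_iff)
  then have "eventually (\<lambda>\<phi>. \<phi> \<in> K) (filtermap \<Psi> sequentially)"
    by (simp add: eventually_filtermap)
  then obtain M where M: "inf (nhds M) (filtermap \<Psi> sequentially) \<noteq> bot"
    using \<open>compact K\<close>[unfolded compact_filter, rule_format, of "filtermap \<Psi> sequentially"]
    by (auto simp: filtermap_bot_iff)
  \<comment> \<open>A proper filter finer than both: along it the coordinates converge to those of
    \<open>M\<close>, and whatever holds for all \<open>\<Psi> n\<close> holds eventually.\<close>
  define H where "H = inf (nhds M) (filtermap \<Psi> sequentially)"
  have "H \<noteq> bot" using M by (simp add: H_def)
  have lim: "((\<lambda>\<phi>. \<phi> h) \<longlongrightarrow> M h) H" for h
  proof -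
    have "((\<lambda>\<phi>. \<phi> h) \<longlongrightarrow> M h) (nhds M)"
    proof (rule topological_tendstoI)
      fix S :: "real set"
      assume "open S" "M h \<in> S"
      moreover have "open ((\<lambda>\<phi>. \<phi> h) -` S)"
        using \<open>open S\<close> by (intro open_vimage) simp_all
      ultimately show "eventually (\<lambda>\<phi>. \<phi> h \<in> S) (nhds M)"
        unfolding eventually_nhds by blast
    qed
    then show ?thesis
      unfolding H_def by (rule filterlim_mono) auto
  qed
  have ev: "eventually P H" if "\<And>n. P (\<Psi> n)" for P
    using that unfolding H_def by (intro filter_leD[OF inf_le2]) (simp add: eventually_filtermap)
  have lim_eq: "M h = c" if "bdd_fun h" "(\<lambda>n. \<Phi> n h) \<longlonglongrightarrow> c" for h c
  proof -
    have "((\<lambda>\<phi>. \<phi> h) \<longlongrightarrow> c) (filtermap \<Psi> sequentially)"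
      using that by (simp add: filterlim_filtermap \<Psi>_def)
    then have "((\<lambda>\<phi>. \<phi> h) \<longlongrightarrow> c) H"
      unfolding H_def by (rule filterlim_mono) auto
    then show ?thesis
      using lim tendsto_unique \<open>H \<noteq> bot\<close> by blast
  qed
  have "is_mean M"
    unfolding is_mean_def
  proof (intro conjI allI impI)
    fix f g :: "'a \<Rightarrow> real"
    assume fg: "bdd_fun f" "bdd_fun g"
    then have "bdd_fun (\<lambda>x. f x + g x)" by (rule bdd_fun_add)
    with fg have "eventually (\<lambda>\<phi>. \<phi> (\<lambda>x. f x + g x) = \<phi> f + \<phi> g) H"
      by (intro ev) (simp add: \<Psi>_def add)
    then have "((\<lambda>\<phi>. \<phi> (\<lambda>x. f x + g x)) \<longlongrightarrow> M f + M g) H"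
      using tendsto_add[OF lim[of f] lim[of g]] by (simp add: tendsto_cong)
    then show "M (\<lambda>x. f x + g x) = M f + M g"
      using lim tendsto_unique \<open>H \<noteq> bot\<close> by blast
  next
    fix f :: "'a \<Rightarrow> real" and c
    assume f: "bdd_fun f"
    then have "bdd_fun (\<lambda>x. c * f x)" by (rule bdd_fun_cmult)
    with f have "eventually (\<lambda>\<phi>. \<phi> (\<lambda>x. c * f x) = c * \<phi> f) H"
      by (intro ev) (simp add: \<Psi>_def cmult)
    then have "((\<lambda>\<phi>. \<phi> (\<lambda>x. c * f x)) \<longlongrightarrow> c * M f) H"
      using tendsto_mult_left[OF lim[of f], of c] by (simp add: tendsto_cong)
    then show "M (\<lambda>x. c * f x) = c * M f"
      using lim tendsto_unique \<open>H \<noteq> bot\<close> by blast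
  next
    fix f :: "'a \<Rightarrow> real"
    assume "bdd_fun f" "\<forall>x. 0 \<le> f x"
    then have "eventually (\<lambda>\<phi>. 0 \<le> \<phi> f) H"
      by (intro ev) (simp add: \<Psi>_def nonneg)
    then show "0 \<le> M f"
      using lim tendsto_lowerbound \<open>H \<noteq> bot\<close> by blast
  qed (use one in \<open>auto intro: lim_eq\<close>)
  then show ?thesis
    using lim_eq that by blast
qed

text \<open>The squared l2 norm, valued in \<open>ennreal\<close> so that sums can be exchanged and
  compared before finiteness is known.\<close>

definition sq_norm :: "('a \<Rightarrow> real) \<Rightarrow> ennreal" where
  "sq_norm f = (\<integral>\<^sup>+x. ennreal ((f x)\<^sup>2) \<partial>count_space UNIV)"

definition avg_op :: "'g pmf \<Rightarrow> ('g \<Rightarrow> 'a \<Rightarrow> 'a) \<Rightarrow> ('a \<Rightarrow> real) \<Rightarrow> 'a \<Rightarrow> real" where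
  "avg_op \<mu> T f x = measure_pmf.expectation \<mu> (\<lambda>g. f (T g x))"

lemma integrable_pmf_bdd:
  assumes "bdd_fun f"
  shows "integrable (measure_pmf \<mu>) (\<lambda>g. f (h g))"
proof -
  obtain B where "\<bar>f x\<bar> \<le> B" for x
    using assms by (auto simp: bdd_fun_def)
  then show ?thesis
    by (intro measure_pmf.integrable_const_bound[of _ B]) auto
qed

lemma avg_op_nonneg: "(\<And>x. 0 \<le> f x) \<Longrightarrow> 0 \<le> avg_op \<mu> T f x"
  by (simp add: avg_op_def)

lemma bdd_fun_avg_op:
  assumes "bdd_fun f"
  shows "bdd_fun (avg_op \<mu> T f)"
proof -
  obtain B where B: "\<bar>f x\<bar> \<le> B" for x
    using assms by (auto simp: bdd_fun_def)
  have "\<bar>avg_op \<mu> T f x\<bar> \<le> B" for x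
  proof -
    have "\<bar>avg_op \<mu> T f x\<bar> \<le> (\<integral>g. \<bar>f (T g x)\<bar> \<partial>measure_pmf \<mu>)"
      unfolding avg_op_def by (rule integral_abs_bound)
    also have "\<dots> \<le> (\<integral>g. B \<partial>measure_pmf \<mu>)"
      by (rule integral_mono) (use integrable_abs[OF integrable_pmf_bdd[OF assms]] B in auto)
    finally show ?thesis by simp
  qed
  then show ?thesis by (rule bdd_funI)
qed

lemma sq_norm_compose_bij:
  assumes "bij T"
  shows "sq_norm (\<lambda>x. f (T x)) = sq_norm f"
  unfolding sq_norm_def using nn_integral_bij_count_space[OF assms, of "\<lambda>x. ennreal ((f x)\<^sup>2)"] by simp

text \<open>The variance of \<open>g \<mapsto> f (T g x)\<close> is at least the contribution of a single atom.\<close>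

lemma sq_norm_avg_op:
  fixes T :: "'g \<Rightarrow> 'a::countable \<Rightarrow> 'a"
  assumes bij: "\<And>g. g \<in> set_pmf \<mu> \<Longrightarrow> bij (T g)" and f: "bdd_fun f" and g: "g \<in> set_pmf \<mu>"
  shows "ennreal (pmf \<mu> g) * sq_norm (\<lambda>x. f (T g x) - avg_op \<mu> T f x) + sq_norm (avg_op \<mu> T f)
    \<le> sq_norm f"
proof -
  let ?P = "avg_op \<mu> T f"
  have sq: "bdd_fun (\<lambda>x. (f x)\<^sup>2)"
  proof -
    obtain B where "\<bar>f x\<bar> \<le> B" for x
      using f by (auto simp: bdd_fun_def)
    then show ?thesis
      by (intro bdd_funI[of _ "B\<^sup>2"]) (simp add: abs_le_square_iff[symmetric] order_trans[OF _ abs_ge_self])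
  qed
  have le: "pmf \<mu> g * (f (T g x) - ?P x)\<^sup>2 + (?P x)\<^sup>2 \<le> (\<integral>g. (f (T g x))\<^sup>2 \<partial>measure_pmf \<mu>)" for x
  proof -
    note [simp] = integrable_pmf_bdd[OF f] integrable_pmf_bdd[OF sq]
    have int: "integrable (measure_pmf \<mu>) (\<lambda>g. (f (T g x) - ?P x)\<^sup>2)"
      by (simp add: power2_diff)
    have "integrable (measure_pmf \<mu>) (\<lambda>g'. indicator {g} g' * (f (T g x) - ?P x)\<^sup>2)"
      by (intro measure_pmf.integrable_const_bound[of _ "(f (T g x) - ?P x)\<^sup>2"])
        (auto simp: indicator_def)
    have "pmf \<mu> g * (f (T g x) - ?P x)\<^sup>2
        = (\<integral>g'. indicator {g} g' * (f (T g x) - ?P x)\<^sup>2 \<partial>measure_pmf \<mu>)"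
      unfolding integral_mult_left_zero by (simp add: measure_pmf_single)
    also have "\<dots> \<le> (\<integral>g. (f (T g x) - ?P x)\<^sup>2 \<partial>measure_pmf \<mu>)"
      by (rule integral_mono) (fact, fact int, auto simp: indicator_def)
    also have "\<dots> = (\<integral>g. (f (T g x))\<^sup>2 \<partial>measure_pmf \<mu>) - (?P x)\<^sup>2"
      unfolding power2_diff by (simp add: avg_op_def[of \<mu> T f x, symmetric] power2_eq_square[of "?P x"])
    finally show ?thesis by simp
  qed
  have "ennreal (pmf \<mu> g) * sq_norm (\<lambda>x. f (T g x) - ?P x) + sq_norm ?P
      = (\<integral>\<^sup>+x. ennreal (pmf \<mu> g * (f (T g x) - ?P x)\<^sup>2 + (?P x)\<^sup>2) \<partial>count_space UNIV)"
    unfolding sq_norm_def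
    by (simp add: nn_integral_cmult[symmetric] nn_integral_add[symmetric] ennreal_mult ennreal_plus)
  also have "\<dots> \<le> (\<integral>\<^sup>+x. (\<integral>\<^sup>+g. ennreal ((f (T g x))\<^sup>2) \<partial>measure_pmf \<mu>) \<partial>count_space UNIV)"
  proof (rule nn_integral_mono)
    fix x
    have "(\<integral>\<^sup>+g. ennreal ((f (T g x))\<^sup>2) \<partial>measure_pmf \<mu>) = ennreal (\<integral>g. (f (T g x))\<^sup>2 \<partial>measure_pmf \<mu>)"
      by (rule nn_integral_eq_integral) (auto intro: integrable_pmf_bdd[OF sq])
    then show "ennreal (pmf \<mu> g * (f (T g x) - ?P x)\<^sup>2 + (?P x)\<^sup>2)
        \<le> (\<integral>\<^sup>+g. ennreal ((f (T g x))\<^sup>2) \<partial>measure_pmf \<mu>)"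
      using ennreal_leI[OF le[of x]] by simp
  qed
  \<comment> \<open>Sum and expectation are exchanged; each \<open>T g\<close> is a bijection of the
    index set, so every translate has the norm of \<open>f\<close>.\<close>
  also have "\<dots> = (\<integral>\<^sup>+g. sq_norm (\<lambda>x. f (T g x)) \<partial>measure_pmf \<mu>)"
    unfolding sq_norm_def by (rule nn_integral_count_space_nn_integral[symmetric]) auto
  also have "\<dots> = (\<integral>\<^sup>+g. sq_norm f \<partial>measure_pmf \<mu>)"
    by (intro nn_integral_cong_AE AE_pmfI) (simp add: sq_norm_compose_bij bij)
  finally show ?thesis by simp
qed

lemma sq_norm_avg_op_le:
  fixes T :: "'g \<Rightarrow> 'a::countable \<Rightarrow> 'a"
  assumes "\<And>g. g \<in> set_pmf \<mu> \<Longrightarrow> bij (T g)" "bdd_fun f"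
  shows "sq_norm (avg_op \<mu> T f) \<le> sq_norm f"
proof -
  obtain g where "g \<in> set_pmf \<mu>"
    using set_pmf_not_empty[of \<mu>] by blast
  then have "ennreal (pmf \<mu> g) * sq_norm (\<lambda>x. f (T g x) - avg_op \<mu> T f x) + sq_norm (avg_op \<mu> T f)
      \<le> sq_norm f"
    by (intro sq_norm_avg_op assms)
  then show ?thesis
    by (rule order_trans[rotated]) (rule add_increasing, simp_all)
qed


text \<open>If no power of the averaging operator contracts the \<open>\<ell>\<^sup>2\<close> norm, there are functions whose
  norm is nearly preserved by a long stretch of powers. The squares of these powers, averaged over the
  stretch, are approximately invariant probability weights, because a step that nearly preserves the
  norm nearly identifies \<open>P f\<close> with every translate of \<^term>\<open>f\<close>.\<close>

lemma gap_or_invariant_mean: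
  fixes T :: "'g \<Rightarrow> 'a::countable \<Rightarrow> 'a"
  assumes bij: "\<And>g. g \<in> set_pmf \<mu> \<Longrightarrow> bij (T g)" and z: "\<And>g. g \<in> set_pmf \<mu> \<Longrightarrow> T g z = z"
  assumes no_gap: "\<not> (\<exists>K q. 0 < K \<and> 0 \<le> q \<and> q < (1::real) \<and>
    (\<forall>f. bdd_fun f \<longrightarrow> (\<forall>x. 0 \<le> f x) \<longrightarrow> f z = 0 \<longrightarrow> sq_norm f < \<infinity> \<longrightarrow>
      sq_norm ((avg_op \<mu> T ^^ K) f) \<le> ennreal q * sq_norm f))"
  obtains M where "is_mean M" "\<And>g h. g \<in> set_pmf \<mu> \<Longrightarrow> bdd_fun h \<Longrightarrow> M (\<lambda>x. h (T g x)) = M h"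
    "M (\<lambda>x. of_bool (x = z)) = 0"
proof -
  let ?P = "avg_op \<mu> T" and ?cs = "count_space UNIV :: 'a measure"
  \<comment> \<open>The \<open>n + 1\<close> steps of the stretch lose less than the fraction
    \<open>\<epsilon> n\<close> of the squared norm; the same number bounds the end terms when the
    average is shifted by one.\<close>
  define \<epsilon> where "\<epsilon> n = 1 / real (Suc n)" for n
  have \<epsilon>: "0 < \<epsilon> n" "\<epsilon> n \<le> 1" for n
    by (simp_all add: \<epsilon>_def)
  have "\<exists>f. bdd_fun f \<and> (\<forall>x. 0 \<le> f x) \<and> f z = 0 \<and> sq_norm f < \<infinity> \<and>
      ennreal (1 - \<epsilon> n) * sq_norm f < sq_norm ((?P ^^ Suc n) f)" for n
  proof (rule ccontr)
    assume "\<not> ?thesis"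
    then have "\<forall>f. bdd_fun f \<longrightarrow> (\<forall>x. 0 \<le> f x) \<longrightarrow> f z = 0 \<longrightarrow> sq_norm f < \<infinity> \<longrightarrow>
        sq_norm ((?P ^^ Suc n) f) \<le> ennreal (1 - \<epsilon> n) * sq_norm f"
      by (meson not_less)
    moreover have "0 < Suc n" "0 \<le> 1 - \<epsilon> n" "1 - \<epsilon> n < 1"
      using \<epsilon>[of n] by simp_all
    ultimately show False
      using no_gap by blast
  qed
  then obtain f where f: "\<And>n. bdd_fun (f n)" "\<And>n x. 0 \<le> f n x" "\<And>n. f n z = 0" "\<And>n. sq_norm (f n) < \<infinity>"
    and big: "\<And>n. ennreal (1 - \<epsilon> n) * sq_norm (f n) < sq_norm ((?P ^^ Suc n) (f n))"
    by metis
  define F where "F n k = (?P ^^ k) (f n)" for n k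
  have F_0: "F n 0 = f n" and F_Suc: "F n (Suc k) = ?P (F n k)" for n k
    by (simp_all add: F_def)
  have bdd: "bdd_fun (F n k)" for n k
    by (induction k) (simp_all add: F_0 F_Suc f bdd_fun_avg_op)
  have F_z: "F n k z = 0" for n k
  proof (induction k)
    case (Suc k)
    have "F n (Suc k) z = (\<integral>g. 0 \<partial>measure_pmf \<mu>)"
      unfolding F_Suc avg_op_def by (rule integral_cong_AE) (auto intro!: AE_pmfI simp: z Suc)
    then show ?case by simp
  qed (simp add: F_0 f)
  define a where "a n k = enn2real (sq_norm (F n k))" for n k
  have step: "sq_norm (F n (Suc k)) \<le> sq_norm (F n k)" for n k
    unfolding F_Suc by (rule sq_norm_avg_op_le[OF bij bdd])
  have le0: "sq_norm (F n k) \<le> sq_norm (f n)" for n k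
    by (induction k) (auto simp: F_0 intro: order_trans step)
  have fin: "sq_norm (F n k) < \<infinity>" for n k
    using le0 f(4) by (rule le_less_trans)
  have a: "sq_norm (F n k) = ennreal (a n k)" and a_nonneg: "0 \<le> a n k" for n k
    using fin[of n k] by (simp_all add: a_def less_top)
  have a_dec: "a n (Suc k) \<le> a n k" for n k
    using step[of n k] by (simp add: a a_nonneg)
  have a_mono: "a n l \<le> a n k" if "k \<le> l" for n k l
    using that a_dec[of n] by (intro decseqD[of "a n"]) (simp_all add: decseq_Suc_iff)
  have a_big: "(1 - \<epsilon> n) * a n 0 < a n (Suc n)" for n
    using big[of n] \<epsilon>[of n] unfolding F_def[of n "Suc n", symmetric] unfolding F_0[symmetric] a
    by (simp add: a_nonneg ennreal_mult[symmetric] ennreal_less_iff)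
  have a_pos: "0 < a n 0" for n
    using a_big[of n] a_mono[of 0 "Suc n" n] \<epsilon>[of n] a_nonneg[of n 0] by (cases "a n 0 = 0") auto
  define I where "I n k h = (\<integral>x. (F n k x)\<^sup>2 * h x \<partial>?cs)" for n k h
  have int_sq: "integrable ?cs (\<lambda>x. (F n k x)\<^sup>2)" for n k
    using fin[of n k] by (intro integrableI_nonneg) (auto simp: sq_norm_def)
  have int_sq_h: "integrable ?cs (\<lambda>x. (F n k x)\<^sup>2 * h x)" if h: "bdd_fun h" for n k h
  proof -
    obtain B where B: "\<bar>h x\<bar> \<le> B" for x
      using h by (auto simp: bdd_fun_def)
    show ?thesis
    proof (rule Bochner_Integration.integrable_bound)
      show "integrable ?cs (\<lambda>x. B * (F n k x)\<^sup>2)"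
        using int_sq by simp
      have "\<bar>h x\<bar> * (F n k x)\<^sup>2 \<le> \<bar>B\<bar> * (F n k x)\<^sup>2" for x
        using B[of x] by (intro mult_right_mono) auto
      then show "AE x in ?cs. norm ((F n k x)\<^sup>2 * h x) \<le> norm (B * (F n k x)\<^sup>2)"
        by (simp add: abs_mult mult.commute)
    qed simp
  qed
  have I_one: "I n k (\<lambda>x. 1) = a n k" for n k
    unfolding I_def a_def sq_norm_def by (simp add: integral_eq_nn_integral)
  have I_abs: "\<bar>I n k h\<bar> \<le> B * a n 0" if h: "\<And>x. \<bar>h x\<bar> \<le> B" for n k h B
  proof -
    have "0 \<le> B" using h[of z] by linarith
    have "\<bar>I n k h\<bar> \<le> (\<integral>x. \<bar>(F n k x)\<^sup>2 * h x\<bar> \<partial>?cs)"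
      unfolding I_def by (rule integral_abs_bound)
    also have "\<dots> \<le> (\<integral>x. B * (F n k x)\<^sup>2 \<partial>?cs)"
    proof (rule integral_mono)
      show "integrable ?cs (\<lambda>x. \<bar>(F n k x)\<^sup>2 * h x\<bar>)"
        using int_sq_h[OF bdd_funI[OF h]] by (rule integrable_abs)
      show "\<bar>(F n k x)\<^sup>2 * h x\<bar> \<le> B * (F n k x)\<^sup>2" for x
        using mult_right_mono[OF h[of x], of "(F n k x)\<^sup>2"] by (simp add: abs_mult mult.commute)
    qed (use int_sq in simp)
    also have "\<dots> = B * a n k"
      using I_one[of n k] by (simp add: I_def)
    also have "\<dots> \<le> B * a n 0"
      using \<open>0 \<le> B\<close> a_mono by (intro mult_left_mono) auto
    finally show ?thesis .
  qed
  have I_step: "\<bar>I n k h - I n (Suc k) (\<lambda>x. h (T g x))\<bar> \<le> B * a n 0 * sqrt (\<epsilon> n) * (1 / (2 * pmf \<mu> g) + 2)"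
    if h: "\<And>x. \<bar>h x\<bar> \<le> B" and g: "g \<in> set_pmf \<mu>" and k: "k \<le> n" for n k h B g
  proof -
    have "0 \<le> B" using h[of z] by linarith
    have p: "0 < pmf \<mu> g" using g by (simp add: pmf_positive)
    \<comment> \<open>The parameter of Young's inequality below: \<open>D\<close> is of order
      \<open>\<epsilon> n\<close>, so the terms with \<open>D / ?t\<close> and with
      \<open>?t\<close> become equally small.\<close>
    let ?t = "sqrt (\<epsilon> n)"
    define u where "u x = F n k (T g x)" for x
    define v where "v x = F n (Suc k) x" for x
    define D where "D = enn2real (sq_norm (\<lambda>x. u x - v x))"
    have var: "ennreal (pmf \<mu> g) * sq_norm (\<lambda>x. u x - v x) + ennreal (a n (Suc k)) \<le> ennreal (a n k)"
      using sq_norm_avg_op[of \<mu> T, OF bij bdd[of n k] g] by (simp add: u_def v_def F_Suc[symmetric] a)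
    have "sq_norm (\<lambda>x. u x - v x) \<noteq> \<infinity>"
      using var p by (auto simp: ennreal_mult_top ennreal_top_mult top_unique)
    then have D: "sq_norm (\<lambda>x. u x - v x) = ennreal D" "0 \<le> D"
      by (simp_all add: D_def less_top)
    have "pmf \<mu> g * D + a n (Suc k) \<le> a n k"
      using var D a_nonneg by (simp add: ennreal_mult[symmetric] ennreal_plus[symmetric] del: ennreal_plus)
    \<comment> \<open>All of \<open>a n 0\<close>, ..., \<open>a n (n + 1)\<close> lie within
      \<open>\<epsilon> n * a n 0\<close> of each other, so no single drop exceeds that
      amount.\<close>
    moreover have "a n (Suc n) \<le> a n (Suc k)" "a n k \<le> a n 0"
      using k by (auto intro: a_mono)
    ultimately have "pmf \<mu> g * D \<le> \<epsilon> n * a n 0"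
      using a_big[of n] by (simp add: algebra_simps)
    then have D_le: "D \<le> \<epsilon> n * a n 0 / pmf \<mu> g"
      using p by (simp add: field_simps)
    have int_u: "integrable ?cs (\<lambda>x. (u x)\<^sup>2)" and int_u_val: "(\<integral>x. (u x)\<^sup>2 \<partial>?cs) = a n k"
    proof -
      have "sq_norm u = sq_norm (F n k)"
        unfolding u_def using sq_norm_compose_bij[OF bij[OF g], of "F n k"] .
      then show "integrable ?cs (\<lambda>x. (u x)\<^sup>2)" "(\<integral>x. (u x)\<^sup>2 \<partial>?cs) = a n k"
        using fin[of n k] by (auto intro!: integrableI_nonneg simp: integral_eq_nn_integral a_def sq_norm_def)
    qed
    have int_d: "integrable ?cs (\<lambda>x. (u x - v x)\<^sup>2)" "(\<integral>x. (u x - v x)\<^sup>2 \<partial>?cs) = D"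
    proof -
      have "sq_norm (\<lambda>x. u x - v x) < \<infinity>"
        using D(1) by simp
      then show "integrable ?cs (\<lambda>x. (u x - v x)\<^sup>2)" "(\<integral>x. (u x - v x)\<^sup>2 \<partial>?cs) = D"
        by (auto intro!: integrableI_nonneg simp: integral_eq_nn_integral D_def sq_norm_def)
    qed
    have int_v: "integrable ?cs (\<lambda>x. (v x)\<^sup>2)" "(\<integral>x. (v x)\<^sup>2 \<partial>?cs) = a n (Suc k)"
      using int_sq[of n "Suc k"] I_one[of n "Suc k"] by (simp_all add: v_def I_def)
    \<comment> \<open>Reindexing by the bijection \<open>T g\<close> puts both integrals against the
      same function \<open>h (T g x)\<close>, so only \<open>u\<close> and \<open>v\<close> are left
      to compare.\<close>
    have "I n k h = (\<integral>x. (u x)\<^sup>2 * h (T g x) \<partial>?cs)"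
      unfolding I_def u_def
      using integral_bij_count_space[OF bij[OF g], of "\<lambda>x. (F n k x)\<^sup>2 * h x"] by simp
    moreover have int_uh: "integrable ?cs (\<lambda>x. (u x)\<^sup>2 * h (T g x))"
      unfolding u_def
      using int_sq_h[OF bdd_funI[OF h], of n k] integrable_bij_count_space[OF bij[OF g], of "\<lambda>x. (F n k x)\<^sup>2 * h x"] by simp
    moreover have int_vh: "integrable ?cs (\<lambda>x. (v x)\<^sup>2 * h (T g x))"
      unfolding v_def by (rule int_sq_h[OF bdd_funI[of _ B]]) (rule h)
    ultimately have "I n k h - I n (Suc k) (\<lambda>x. h (T g x)) = (\<integral>x. (u x)\<^sup>2 * h (T g x) - (v x)\<^sup>2 * h (T g x) \<partial>?cs)"
      by (simp add: I_def v_def)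
    also have "\<bar>\<dots>\<bar> \<le> (\<integral>x. \<bar>(u x)\<^sup>2 * h (T g x) - (v x)\<^sup>2 * h (T g x)\<bar> \<partial>?cs)"
      by (rule integral_abs_bound)
    also have "\<dots> \<le> (\<integral>x. B * ((u x - v x)\<^sup>2 / (2 * ?t) + ?t * ((u x)\<^sup>2 + (v x)\<^sup>2)) \<partial>?cs)"
    proof (rule integral_mono)
      fix x
      have t: "0 < ?t" using \<epsilon> by simp
      have "\<bar>(u x)\<^sup>2 * h (T g x) - (v x)\<^sup>2 * h (T g x)\<bar> = \<bar>h (T g x)\<bar> * \<bar>(u x)\<^sup>2 - (v x)\<^sup>2\<bar>"
        by (simp add: abs_mult[symmetric] algebra_simps)
      also have "\<dots> \<le> B * \<bar>(u x)\<^sup>2 - (v x)\<^sup>2\<bar>"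
        using h by (intro mult_right_mono) auto
      also have "\<bar>(u x)\<^sup>2 - (v x)\<^sup>2\<bar> = \<bar>u x - v x\<bar> * \<bar>u x + v x\<bar>"
        by (simp add: abs_mult[symmetric] power2_eq_square algebra_simps)
      also have "\<bar>u x - v x\<bar> * \<bar>u x + v x\<bar> \<le> (u x - v x)\<^sup>2 / (2 * ?t) + ?t * (u x + v x)\<^sup>2 / 2"
      proof -
        have young: "p * q \<le> p\<^sup>2 / (2 * t) + t * q\<^sup>2 / 2" if "0 < t" for p q t :: real
        proof -
          have "0 \<le> (p - t * q)\<^sup>2 / (2 * t)"
            using that by simp
          also have "\<dots> = p\<^sup>2 / (2 * t) + t * q\<^sup>2 / 2 - p * q"
            using that by (simp add: field_simps power2_eq_square)
          finally show ?thesis by simp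
        qed
        show ?thesis
          using young[OF t, of "\<bar>u x - v x\<bar>" "\<bar>u x + v x\<bar>"] by simp
      qed
      also have "?t * (u x + v x)\<^sup>2 / 2 \<le> ?t * ((u x)\<^sup>2 + (v x)\<^sup>2)"
      proof -
        have "(u x + v x)\<^sup>2 \<le> 2 * ((u x)\<^sup>2 + (v x)\<^sup>2)"
          using zero_le_power2[of "u x - v x"] by (simp add: power2_eq_square algebra_simps)
        then have "?t * (u x + v x)\<^sup>2 \<le> ?t * (2 * ((u x)\<^sup>2 + (v x)\<^sup>2))"
          using t by (intro mult_left_mono) auto
        then show ?thesis by (simp add: algebra_simps)
      qed
      finally show "\<bar>(u x)\<^sup>2 * h (T g x) - (v x)\<^sup>2 * h (T g x)\<bar>
          \<le> B * ((u x - v x)\<^sup>2 / (2 * ?t) + ?t * ((u x)\<^sup>2 + (v x)\<^sup>2))"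
        using \<open>0 \<le> B\<close> by (simp add: mult_left_mono)
    qed (use int_uh int_vh int_u int_v int_d in auto)
    also have "\<dots> = B * (D / (2 * ?t) + ?t * (a n k + a n (Suc k)))"
      using int_u int_u_val int_v int_d by simp
    also have "\<dots> \<le> B * ((\<epsilon> n * a n 0 / pmf \<mu> g) / (2 * ?t) + ?t * (a n 0 + a n 0))"
      using \<open>0 \<le> B\<close> D_le \<epsilon>[of n] a_mono[of 0 _ n]
      by (intro mult_left_mono add_mono divide_right_mono) auto
    also have "\<dots> = B * a n 0 * ?t * (1 / (2 * pmf \<mu> g) + 2)"
    proof -
      have "\<epsilon> n / ?t = ?t" using \<epsilon>[of n] by (simp add: real_div_sqrt)
      then have "(\<epsilon> n * a n 0 / pmf \<mu> g) / (2 * ?t) = a n 0 / (2 * pmf \<mu> g) * ?t"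
        by (metis (no_types, lifting) mult.commute times_divide_times_eq times_divide_eq_right divide_divide_eq_left)
      then show ?thesis by (simp add: algebra_simps)
    qed
    finally show ?thesis .
  qed
  \<comment> \<open>All powers are normalised by the one number \<open>a n 0\<close>, so that
    \<open>I_step\<close> can be summed; in return the constant 1 is sent only close to 1.\<close>
  define \<Phi> where "\<Phi> n h = (\<Sum>k\<le>n. I n k h) / (real (Suc n) * a n 0)" for n h
  have den: "0 < real (Suc n) * a n 0" for n
    using a_pos[of n] by simp
  have \<Phi>_abs: "\<bar>\<Phi> n h\<bar> \<le> B" if h: "\<And>x. \<bar>h x\<bar> \<le> B" for n h B
  proof -
    have "\<bar>\<Sum>k\<le>n. I n k h\<bar> \<le> (\<Sum>k\<le>n. \<bar>I n k h\<bar>)"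
      by (rule sum_abs)
    also have "\<dots> \<le> (\<Sum>k\<le>n. B * a n 0)"
      by (intro sum_mono I_abs h)
    also have "\<dots> = B * (real (Suc n) * a n 0)"
      by simp
    finally show ?thesis
      using den[of n] unfolding \<Phi>_def abs_divide by (simp add: pos_divide_le_eq)
  qed
  have \<Phi>_add: "\<Phi> n (\<lambda>x. f x + g x) = \<Phi> n f + \<Phi> n g" if "bdd_fun f" "bdd_fun g" for n f g
    using int_sq_h[OF that(1)] int_sq_h[OF that(2)]
    by (simp add: \<Phi>_def I_def distrib_left sum.distrib add_divide_distrib)
  have \<Phi>_cmult: "\<Phi> n (\<lambda>x. c * f x) = c * \<Phi> n f" for n c f
  proof -
    have "I n k (\<lambda>x. c * f x) = c * I n k f" for k
      by (simp add: I_def mult.left_commute)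
    then show ?thesis
      by (simp add: \<Phi>_def sum_distrib_left)
  qed
  have \<Phi>_nonneg: "0 \<le> \<Phi> n f" if "\<And>x. 0 \<le> f x" for n f
    unfolding \<Phi>_def I_def using den[of n] that
    by (intro divide_nonneg_pos sum_nonneg Bochner_Integration.integral_nonneg) auto
  have \<epsilon>_lim: "\<epsilon> \<longlonglongrightarrow> 0"
    unfolding \<epsilon>_def using LIMSEQ_inverse_real_of_nat by (simp add: inverse_eq_divide)
  have \<Phi>_one: "(\<lambda>n. \<Phi> n (\<lambda>x. 1)) \<longlonglongrightarrow> 1"
  proof (rule tendsto_sandwich)
    show "eventually (\<lambda>n. 1 - \<epsilon> n \<le> \<Phi> n (\<lambda>x. 1)) sequentially"
    proof (intro always_eventually allI)
      fix n
      have "(1 - \<epsilon> n) * (real (Suc n) * a n 0) = (\<Sum>k\<le>n. (1 - \<epsilon> n) * a n 0)"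
        by simp
      also have "\<dots> \<le> (\<Sum>k\<le>n. I n k (\<lambda>x. 1))"
      proof (rule sum_mono)
        fix k assume "k \<in> {..n}"
        then have "a n (Suc n) \<le> a n k" by (intro a_mono) auto
        then show "(1 - \<epsilon> n) * a n 0 \<le> I n k (\<lambda>x. 1)"
          using a_big[of n] by (simp add: I_one)
      qed
      finally show "1 - \<epsilon> n \<le> \<Phi> n (\<lambda>x. 1)"
        using den[of n] by (simp add: \<Phi>_def pos_le_divide_eq)
    qed
    show "eventually (\<lambda>n. \<Phi> n (\<lambda>x. 1) \<le> 1) sequentially"
      using \<Phi>_abs[of "\<lambda>x. 1" 1] by (simp add: abs_le_iff)
    show "(\<lambda>n. 1 - \<epsilon> n) \<longlonglongrightarrow> 1"
      using tendsto_diff[OF tendsto_const \<epsilon>_lim, of 1] by simp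
  qed simp
  obtain M where M: "is_mean M" and lim: "\<And>h c. bdd_fun h \<Longrightarrow> (\<lambda>n. \<Phi> n h) \<longlonglongrightarrow> c \<Longrightarrow> M h = c"
    using mean_of_approximate_means[of \<Phi>, OF \<Phi>_abs \<Phi>_add \<Phi>_cmult \<Phi>_nonneg \<Phi>_one] by blast
  have "M (\<lambda>x. h (T g x)) = M h" if g: "g \<in> set_pmf \<mu>" and h: "bdd_fun h" for g h
  proof -
    obtain B where B: "\<bar>h x\<bar> \<le> B" for x
      using h by (auto simp: bdd_fun_def)
    have hg: "bdd_fun (\<lambda>x. h (T g x))"
      using B by (rule bdd_funI)
    let ?d = "\<lambda>x. h x + (-1) * h (T g x)"
    let ?C = "B * (1 / (2 * pmf \<mu> g) + 2)"
    have "(\<lambda>n. \<Phi> n ?d) \<longlonglongrightarrow> 0"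
    proof (rule Lim_null_comparison)
      show "eventually (\<lambda>n. norm (\<Phi> n ?d) \<le> ?C * sqrt (\<epsilon> n) + 2 * B * \<epsilon> n) sequentially"
      proof (intro always_eventually allI)
        fix n
        let ?h = "\<lambda>x. h (T g x)"
        \<comment> \<open>\<open>I_step\<close> compares power \<open>k\<close> with power
          \<open>k + 1\<close>; shifting the average by one leaves only the two end terms.\<close>
        have "(\<Sum>k\<le>n. I n k ?h) + I n (Suc n) ?h = I n 0 ?h + (\<Sum>k\<le>n. I n (Suc k) ?h)"
          using sum.atMost_Suc[of "\<lambda>k. I n k ?h" n] sum.atMost_Suc_shift[of "\<lambda>k. I n k ?h" n] by simp
        then have "(\<Sum>k\<le>n. I n k h) - (\<Sum>k\<le>n. I n k ?h)
            = (\<Sum>k\<le>n. I n k h - I n (Suc k) ?h) + (I n (Suc n) ?h - I n 0 ?h)"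
          by (simp add: sum_subtractf)
        also have "\<bar>\<dots>\<bar> \<le> (\<Sum>k\<le>n. a n 0 * (?C * sqrt (\<epsilon> n))) + (B * a n 0 + B * a n 0)"
        proof (rule order_trans[OF abs_triangle_ineq add_mono])
          show "\<bar>\<Sum>k\<le>n. I n k h - I n (Suc k) ?h\<bar> \<le> (\<Sum>k\<le>n. a n 0 * (?C * sqrt (\<epsilon> n)))"
          proof (rule order_trans[OF sum_abs sum_mono])
            fix k assume "k \<in> {..n}"
            then show "\<bar>I n k h - I n (Suc k) ?h\<bar> \<le> a n 0 * (?C * sqrt (\<epsilon> n))"
              using I_step[OF B g, of k n] by (simp add: mult_ac)
          qed
          show "\<bar>I n (Suc n) ?h - I n 0 ?h\<bar> \<le> B * a n 0 + B * a n 0"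
            using I_abs[of ?h B n "Suc n"] I_abs[of ?h B n 0] B by simp
        qed
        also have "\<dots> = (?C * sqrt (\<epsilon> n) + 2 * B * \<epsilon> n) * (real (Suc n) * a n 0)"
          by (simp add: \<epsilon>_def field_simps)
        finally have "\<bar>\<Phi> n h - \<Phi> n ?h\<bar> \<le> ?C * sqrt (\<epsilon> n) + 2 * B * \<epsilon> n"
          unfolding \<Phi>_def diff_divide_distrib[symmetric] abs_divide
          using den[of n] by (simp add: pos_divide_le_eq)
        moreover have "\<Phi> n ?d = \<Phi> n h + (-1) * \<Phi> n ?h"
          using \<Phi>_add[OF h bdd_fun_cmult[OF hg, of "-1"]] \<Phi>_cmult[of n "-1" ?h] by simp
        ultimately show "norm (\<Phi> n ?d) \<le> ?C * sqrt (\<epsilon> n) + 2 * B * \<epsilon> n"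
          by simp
      qed
      have "(\<lambda>n. ?C * sqrt (\<epsilon> n) + 2 * B * \<epsilon> n) \<longlonglongrightarrow> ?C * sqrt 0 + 2 * B * 0"
        by (intro tendsto_intros \<epsilon>_lim)
      then show "(\<lambda>n. ?C * sqrt (\<epsilon> n) + 2 * B * \<epsilon> n) \<longlonglongrightarrow> 0"
        by simp
    qed
    then have "M ?d = 0"
      by (intro lim bdd_fun_add h bdd_fun_cmult hg)
    then show ?thesis
      using mean_add[OF M h bdd_fun_cmult[OF hg, of "-1"]] mean_cmult[OF M hg, of "-1"] by simp
  qed
  moreover have "M (\<lambda>x. of_bool (x = z)) = 0"
  proof (rule lim)
    have "(\<lambda>x. (F n k x)\<^sup>2 * of_bool (x = z)) = (\<lambda>x. 0)" for n k
      by (auto simp: fun_eq_iff F_z)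
    then show "(\<lambda>n. \<Phi> n (\<lambda>x. of_bool (x = z))) \<longlonglongrightarrow> 0"
      by (simp add: \<Phi>_def I_def)
  qed simp
  ultimately show ?thesis
    using that M by blast
qed

section \<open>Orthogonality of characters\<close>

lemma prod_cis: "finite A \<Longrightarrow> (\<Prod>i\<in>A. cis (f i)) = cis (\<Sum>i\<in>A. f i)"
  by (induction rule: finite_induct) (simp_all add: cis_mult)

lemma integral_cis_unit_interval:
  assumes "k \<in> \<int>" "k \<noteq> 0"
  shows "(\<integral>t. indicator {0..<1} t *\<^sub>R cis (2 * pi * (k * t)) \<partial>lborel) = 0"
proof -
  define F where "F t = cis (2 * pi * (k * t)) / (2 * pi * k * \<i>)" for t :: real
  have "(\<integral>t. indicator {0..<1} t *\<^sub>R cis (2 * pi * (k * t)) \<partial>lborel)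
      = (\<integral>t. indicator {0..1} t *\<^sub>R cis (2 * pi * (k * t)) \<partial>lborel)"
    by (rule integral_cong_AE) (use AE_lborel_singleton[of 1] in \<open>auto elim!: AE_mp simp: indicator_def cis_conv_exp\<close>)
  also have "\<dots> = F 1 - F 0"
  proof (rule integral_FTC_Icc)
    fix x :: real
    have "((\<lambda>z. exp (\<i> * of_real (2 * pi * k) * z) / (2 * pi * k * \<i>)) has_field_derivative
        exp (\<i> * of_real (2 * pi * k) * of_real x)) (at (of_real x))"
      using assms by (auto intro!: derivative_eq_intros simp: field_simps)
    from has_vector_derivative_real_field[OF this]
    show "(F has_vector_derivative cis (2 * pi * (k * x))) (at x within {0..1})"
      by (simp add: F_def[abs_def] cis_conv_exp mult_ac)
    show "continuous_on {0..1} (\<lambda>x. cis (2 * pi * (k * x)))"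
      by (intro continuous_intros)
  qed simp
  also have "F 1 = F 0"
    using cis_multiple_2pi[OF assms(1)] by (simp add: F_def mult_ac)
  finally show ?thesis by simp
qed

lemma integral_torus_measure:
  fixes f :: "'n::finite torus \<Rightarrow> complex"
  assumes [measurable]: "f \<in> borel_measurable borel"
  shows "(\<integral>x. f x \<partial>torus_measure) = (\<integral>u. indicator unit_cube u *\<^sub>R f (to_torus u) \<partial>lborel)"
  unfolding torus_measure_def
  by (subst integral_distr) (auto simp: integral_restrict_space intro!: measurable_restrict_space1)

text \<open>The integral over the cube factors over the coordinates, and a coordinate with nonzero
  entry integrates over full periods.\<close>

lemma integral_torus_char:
  fixes a :: "int ^ 'n::finite"
  shows "(\<integral>x. torus_char a x \<partial>torus_measure) = of_bool (a = 0)"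
proof (cases "a = 0")
  case True
  interpret prob_space "torus_measure :: 'n torus measure"
    by (rule prob_space_torus_measure)
  show ?thesis
    using True prob_space by simp
next
  case False
  then obtain i where i: "a $ i \<noteq> 0"
    by (auto simp: vec_eq_iff)
  define \<phi> where "\<phi> b t = indicator {0..<1} t *\<^sub>R cis (2 * pi * ((int_vec a \<bullet> b) * t))" for b :: "real ^ 'n" and t :: real
  interpret product_sigma_finite "\<lambda>_ :: real ^ 'n. lborel :: real measure"
    by standard
  have meas[measurable]: "\<phi> b \<in> borel_measurable borel" for b
  proof -
    have [measurable]: "(\<lambda>t. cis (2 * pi * ((int_vec a \<bullet> b) * t))) \<in> borel_measurable borel"
      by (intro borel_measurable_continuous_onI continuous_intros)
    show ?thesis
      unfolding \<phi>_def by measurable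
  qed
  have "(\<integral>x. torus_char a x \<partial>torus_measure)
      = (\<integral>u. indicator unit_cube u *\<^sub>R cis (2 * pi * (int_vec a \<bullet> u)) \<partial>lborel)"
    by (simp add: integral_torus_measure torus_char.abs_eq)
  also have "\<dots> = (\<integral>u. (\<Prod>b\<in>Basis. \<phi> b (u \<bullet> b)) \<partial>lborel)"
  proof (rule Bochner_Integration.integral_cong[OF refl])
    fix u :: "real ^ 'n"
    have "(indicator unit_cube u :: real) = (\<Prod>b\<in>Basis. indicator {0..<1} (u \<bullet> b))"
    proof (cases "u \<in> unit_cube")
      case False
      then obtain j where "u $ j \<notin> {0..<1}"
        by (auto simp: unit_cube_def)
      then show ?thesis
        using False by (subst prod_zero[where A = Basis]) (auto intro!: bexI[of _ "axis j 1"] simp: inner_axis)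
    next
      case True
      then have "(\<Prod>b\<in>Basis. indicator {0..<1} (u \<bullet> b)) = (1 :: real)"
        by (intro prod.neutral) (auto simp: unit_cube_def Basis_vec_def inner_axis)
      then show ?thesis
        using True by simp
    qed
    moreover have "cis (2 * pi * (int_vec a \<bullet> u)) = (\<Prod>b\<in>Basis. cis (2 * pi * ((int_vec a \<bullet> b) * (u \<bullet> b))))"
      by (simp add: prod_cis euclidean_inner[of "int_vec a" u] sum_distrib_left)
    ultimately show "indicator unit_cube u *\<^sub>R cis (2 * pi * (int_vec a \<bullet> u)) = (\<Prod>b\<in>Basis. \<phi> b (u \<bullet> b))"
      by (simp add: \<phi>_def scaleR_conv_of_real prod.distrib)
  qed
  also have "\<dots> = (\<integral>x. (\<Prod>b\<in>Basis. \<phi> b (x b)) \<partial>(\<Pi>\<^sub>M b\<in>Basis. lborel))"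
    by (subst lborel_eq) (simp add: integral_distr)
  also have "\<dots> = (\<Prod>b\<in>Basis. \<integral>t. \<phi> b t \<partial>lborel)"
  proof (rule product_integral_prod)
    fix b :: "real ^ 'n"
    show "integrable lborel (\<phi> b)"
    proof (rule Bochner_Integration.integrable_bound)
      show "integrable lborel (indicator {0..<1} :: real \<Rightarrow> real)"
        by simp
    qed (auto simp: \<phi>_def)
  qed simp
  also have "\<dots> = 0"
  proof (rule prod_zero)
    have "int_vec a \<bullet> axis i 1 = real_of_int (a $ i)"
      by (simp add: inner_axis int_vec_def)
    then have "(\<integral>t. \<phi> (axis i 1) t \<partial>lborel) = 0"
      unfolding \<phi>_def using i by (intro integral_cis_unit_interval) simp_all
    then show "\<exists>b\<in>Basis. (\<integral>t. \<phi> b t \<partial>lborel) = 0"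
      by (intro bexI[of _ "axis i 1"]) simp_all
  qed simp
  finally show ?thesis using False by simp
qed

lemma to_torus_surj: "\<exists>u. x = to_torus u"
  by (induction x rule: torus.abs_induct) blast

section \<open>A peak kernel on the torus\<close>

text \<open>The base is cos^2(pi t), written in the form that is visibly 1-periodic, as the passage
  to the quotient requires.\<close>

lift_definition torus_kernel :: "nat \<Rightarrow> 'n::finite torus \<Rightarrow> real"
  is "\<lambda>M u. \<Prod>i\<in>UNIV. ((1 + cos (2 * pi * u $ i)) / 2) ^ M"
proof (intro prod.cong refl)
  fix M and u v :: "real ^ 'n" and i
  assume "torus_rel u v"
  then have "u $ i - v $ i \<in> \<int>"
    by (simp add: torus_rel_def int_lattice_def)
  from arg_cong[OF cis_2pi_add_Ints[OF this, of "v $ i"], of Re]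
  show "((1 + cos (2 * pi * u $ i)) / 2) ^ M = ((1 + cos (2 * pi * v $ i)) / 2) ^ M"
    by simp
qed

text \<open>The Fourier coefficient of the kernel, but only for \<open>a\<close> in
  \<open>freq_box M\<close>: for an entry below \<open>- M\<close>, the truncation by
  \<open>nat\<close> leaves the factor \<open>1 / 4 ^ M\<close> instead of 0.\<close>

definition kernel_coeff :: "nat \<Rightarrow> int ^ 'n::finite \<Rightarrow> real" where
  "kernel_coeff M a = (\<Prod>i\<in>UNIV. real (2 * M choose nat (a $ i + int M)) / 4 ^ M)"

definition freq_box :: "nat \<Rightarrow> (int ^ 'n::finite) set" where
  "freq_box M = {a. \<forall>i. a $ i \<in> {- int M..int M}}"

lemma freq_box_eq_image: "freq_box M = (\<lambda>j. \<chi> i. j i) ` (UNIV \<rightarrow>\<^sub>E {- int M..int M})"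
proof (intro subset_antisym subsetI)
  fix a :: "int ^ 'a"
  assume "a \<in> freq_box M"
  then show "a \<in> (\<lambda>j. \<chi> i. j i) ` (UNIV \<rightarrow>\<^sub>E {- int M..int M})"
    by (intro image_eqI[of _ _ "($) a"]) (auto simp: freq_box_def)
qed (auto simp: freq_box_def PiE_iff)

lemma finite_freq_box [simp]: "finite (freq_box M)"
  unfolding freq_box_eq_image by (intro finite_imageI finite_PiE) auto

lemma zero_in_freq_box [simp]: "0 \<in> freq_box M"
  by (simp add: freq_box_def)

text \<open>The binomial theorem for the power 2M of (e^(i pi t) + e^(-i pi t)) / 2: the exponents
  are i pi t times the even numbers 2(k - M), so the frequencies are integers.\<close>

lemma cos_power_expansion:
  "complex_of_real (((1 + cos (2 * pi * t)) / 2) ^ M)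
    = (\<Sum>k=-int M..int M. of_real (real (2 * M choose nat (k + int M)) / 4 ^ M) * cis (2 * pi * (of_int k * t)))"
proof -
  have "complex_of_real ((1 + cos (2 * pi * t)) / 2) = ((cis (pi * t) + cis (- (pi * t))) / 2)\<^sup>2"
    using cos_double_cos[of "pi * t"]
    by (simp add: cis_conv_exp[symmetric] complex_eq_iff power2_eq_square mult_ac)
  then have "complex_of_real (((1 + cos (2 * pi * t)) / 2) ^ M)
      = (cis (pi * t) + cis (- (pi * t))) ^ (2 * M) / 4 ^ M"
    unfolding of_real_power by (simp only: power_mult power_divide) simp
  also have "\<dots> = (\<Sum>k\<le>2 * M. of_real (real (2 * M choose k) / 4 ^ M) * cis (2 * pi * ((real k - real M) * t)))"
    unfolding binomial_ring sum_divide_distrib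
  proof (intro sum.cong refl)
    fix k
    assume k: "k \<in> {..2 * M}"
    have "cis (pi * t) ^ k * cis (- (pi * t)) ^ (2 * M - k)
        = cis (real k * (pi * t) + real (2 * M - k) * (- (pi * t)))"
      by (simp only: Complex.DeMoivre cis_mult)
    also have "real k * (pi * t) + real (2 * M - k) * (- (pi * t)) = 2 * pi * ((real k - real M) * t)"
      using k by (simp add: of_nat_diff algebra_simps)
    finally show "of_nat (2 * M choose k) * cis (pi * t) ^ k * cis (- (pi * t)) ^ (2 * M - k) / 4 ^ M
        = of_real (real (2 * M choose k) / 4 ^ M) * cis (2 * pi * ((real k - real M) * t))"
      by (simp add: mult.assoc)
  qed
  also have "\<dots> = (\<Sum>k=-int M..int M. of_real (real (2 * M choose nat (k + int M)) / 4 ^ M) * cis (2 * pi * (of_int k * t)))"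
    by (rule sum.reindex_bij_witness[of _ "\<lambda>k. nat (k + int M)" "\<lambda>k. int k - int M"]) auto
  finally show ?thesis .
qed

lemma torus_kernel_expansion:
  "complex_of_real (torus_kernel M x) = (\<Sum>a\<in>freq_box M. of_real (kernel_coeff M a) * torus_char a x)"
proof transfer
  fix M and u :: "real ^ 'n"
  let ?J = "{- int M..int M}"
  let ?b = "\<lambda>k. complex_of_real (real (2 * M choose nat (k + int M)) / 4 ^ M)"
  have "complex_of_real (\<Prod>i\<in>UNIV. ((1 + cos (2 * pi * u $ i)) / 2) ^ M)
      = (\<Prod>i\<in>UNIV. \<Sum>k\<in>?J. ?b k * cis (2 * pi * (of_int k * u $ i)))"
    by (simp only: of_real_prod cos_power_expansion)
  also have "\<dots> = (\<Sum>j\<in>UNIV \<rightarrow>\<^sub>E ?J. \<Prod>i\<in>UNIV. ?b (j i) * cis (2 * pi * (of_int (j i) * u $ i)))"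
    by (rule prod_sum_PiE) simp_all
  also have "\<dots> = (\<Sum>j\<in>UNIV \<rightarrow>\<^sub>E ?J. of_real (kernel_coeff M (\<chi> i. j i)) * cis (2 * pi * (int_vec (\<chi> i. j i) \<bullet> u)))"
    by (simp only: prod.distrib prod_cis finite kernel_coeff_def int_vec_inner of_real_prod vec_lambda_beta
        sum_distrib_left)
  also have "\<dots> = (\<Sum>a\<in>freq_box M. of_real (kernel_coeff M a) * cis (2 * pi * (int_vec a \<bullet> u)))"
    unfolding freq_box_eq_image by (subst sum.reindex) (auto simp: inj_on_def vec_eq_iff)
  finally show "complex_of_real (\<Prod>i\<in>UNIV. ((1 + cos (2 * pi * u $ i)) / 2) ^ M)
      = (\<Sum>a\<in>freq_box M. of_real (kernel_coeff M a) * cis (2 * pi * (int_vec a \<bullet> u)))" .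
qed

lemma kernel_coeff_nonneg: "0 \<le> kernel_coeff M a"
  unfolding kernel_coeff_def by (intro prod_nonneg) simp

lemma kernel_coeff_0: "kernel_coeff M (0 :: int ^ 'n::finite) = (real (2 * M choose M) / 4 ^ M) ^ CARD('n)"
  by (simp add: kernel_coeff_def)

lemma kernel_coeff_le: "kernel_coeff M a \<le> kernel_coeff M (0 :: int ^ 'n::finite)" for a :: "int ^ 'n"
  unfolding kernel_coeff_def
  by (intro prod_mono conjI divide_right_mono) (auto simp: binomial_maximum')

lemma sum_kernel_coeff: "(\<Sum>a\<in>freq_box M. kernel_coeff M (a :: int ^ 'n::finite)) = 1"
proof -
  have "torus_kernel M (0 :: 'n torus) = 1"
    by transfer simp
  then have "complex_of_real (\<Sum>a\<in>freq_box M. kernel_coeff M (a :: int ^ 'n)) = complex_of_real 1"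
    using torus_kernel_expansion[of M "0 :: 'n torus"] by simp
  then show ?thesis
    by (simp only: of_real_eq_iff)
qed

text \<open>The coefficients sum to 1 and none exceeds the one at 0, which is the mean of the
  kernel. The bound of the variance by the mean rests on this.\<close>

lemma sum_kernel_coeff_squares: "(\<Sum>a\<in>freq_box M. (kernel_coeff M (a :: int ^ 'n::finite))\<^sup>2) \<le> kernel_coeff M (0 :: int ^ 'n)"
proof -
  have "(\<Sum>a\<in>freq_box M. (kernel_coeff M (a :: int ^ 'n))\<^sup>2) \<le> (\<Sum>a\<in>freq_box M. kernel_coeff M (0 :: int ^ 'n) * kernel_coeff M (a :: int ^ 'n))"
    unfolding power2_eq_square by (intro sum_mono mult_right_mono kernel_coeff_le kernel_coeff_nonneg)
  then show ?thesis
    by (simp add: sum_distrib_left[symmetric] sum_kernel_coeff)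
qed

section \<open>Size of the central binomial coefficient\<close>

lemma central_binomial_Suc:
  "real (2 * Suc M choose Suc M) / 4 ^ Suc M = real (2 * M choose M) / 4 ^ M * ((2 * real M + 1) / (2 * real M + 2))"
proof -
  have e: "2 * Suc M = Suc (Suc (2 * M))"
    by simp
  have "Suc M * (2 * Suc M choose Suc M) = 2 * Suc M * (Suc (2 * M) choose M)"
    unfolding e by (rule Suc_times_binomial)
  then have 1: "(2 * Suc M choose Suc M) = 2 * (Suc (2 * M) choose M)"
    by (simp del: binomial_Suc_Suc mult_Suc mult_Suc_right add: mult.assoc mult.left_commute[of 2])
  have "Suc M * (Suc (2 * M) choose M) = Suc (2 * M) * (2 * M choose M)"
    using Suc_times_binomial[of M "2 * M"] binomial_symmetric[of "Suc M" "Suc (2 * M)"] by simp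
  then have 3: "real (Suc M) * real (Suc (2 * M) choose M) = real (Suc (2 * M)) * real (2 * M choose M)"
    by (simp only: of_nat_mult[symmetric])
  have e2: "2 * real M + 2 = 2 * (real M + 1)"
    by simp
  have gen: "2 * (A * X / N) / (4 * p) = X / p * (A / (2 * N))" if "0 < N" "0 < p" for A X N p :: real
    using that by (simp add: field_simps)
  have 2: "real (Suc (2 * M) choose M) = (2 * real M + 1) * real (2 * M choose M) / (real M + 1)"
    using 3 by (simp add: field_simps)
  show ?thesis
    unfolding 1 of_nat_mult 2 power_Suc e2 of_nat_numeral by (rule gen) simp_all
qed

text \<open>With the factor \<open>2 * M + 1\<close> the left side decreases in \<open>M\<close> and
  is 1 at \<open>M = 0\<close>. The weaker factor \<open>M + 1\<close> suits a degree obtained by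
  rounding down.\<close>

lemma central_binomial_sq_upper: "(real (2 * M choose M) / 4 ^ M)\<^sup>2 * (real M + 1) \<le> 1"
proof -
  have "(real (2 * M choose M) / 4 ^ M)\<^sup>2 * (2 * real M + 1) \<le> 1"
  proof (induction M)
    case (Suc M)
    let ?b = "(real (2 * M choose M) / 4 ^ M)\<^sup>2 * (2 * real M + 1)"
    have eq: "(real (2 * Suc M choose Suc M) / 4 ^ Suc M)\<^sup>2 * (2 * real (Suc M) + 1)
        = ?b * ((2 * real M + 1) * (2 * real M + 3) / (2 * real M + 2)\<^sup>2)"
      unfolding central_binomial_Suc power_mult_distrib power_divide
      by (simp add: power2_eq_square field_simps)
    have "(2 * real M + 1) * (2 * real M + 3) \<le> (2 * real M + 2)\<^sup>2"
      by (simp add: power2_eq_square algebra_simps)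
    then have "?b * ((2 * real M + 1) * (2 * real M + 3) / (2 * real M + 2)\<^sup>2) \<le> ?b * 1"
      by (intro mult_left_mono) simp_all
    then show ?case unfolding eq using Suc by linarith
  qed simp
  moreover have "(real (2 * M choose M) / 4 ^ M)\<^sup>2 * (real M + 1) \<le> (real (2 * M choose M) / 4 ^ M)\<^sup>2 * (2 * real M + 1)"
    by (intro mult_left_mono) auto
  ultimately show ?thesis by linarith
qed

text \<open>The right side increases in \<open>M\<close> and equals 1 at \<open>M = 1\<close>, where
  the induction really starts.\<close>

lemma central_binomial_sq_lower: "0 < M \<Longrightarrow> 1 \<le> (real (2 * M choose M) / 4 ^ M)\<^sup>2 * (4 * real M)"
proof (induction M)
  case (Suc M)
  show ?case
  proof (cases "M = 0")
    case False
    let ?b = "(real (2 * M choose M) / 4 ^ M)\<^sup>2 * (4 * real M)"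
    have "4 * real M * (real M + 1) \<le> (2 * real M + 1)\<^sup>2"
      by (simp add: power2_eq_square algebra_simps)
    moreover have "0 < 4 * real M * (real M + 1)"
      using False by simp
    ultimately have "?b * 1 \<le> ?b * ((2 * real M + 1)\<^sup>2 / (4 * real M * (real M + 1)))"
      by (intro mult_left_mono) (simp_all only: le_divide_eq_1_pos, simp)
    also have "\<dots> = (real (2 * Suc M choose Suc M) / 4 ^ Suc M)\<^sup>2 * (4 * real (Suc M))"
    proof -
      have "B\<^sup>2 * (4 * m) * (p\<^sup>2 / (4 * m * N)) = (B * (p / (2 * N)))\<^sup>2 * (4 * N)"
        if "0 < m" "0 < N" for B m p N :: real
        using that by (simp add: field_simps power2_eq_square)
      moreover have "2 * real M + 2 = 2 * (real M + 1)"
        by simp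
      ultimately show ?thesis
        unfolding central_binomial_Suc using False by (simp only: of_nat_Suc add.commute[of 1])
    qed
    finally show ?thesis using Suc False by simp
  qed (simp add: power2_eq_square numeral_2_eq_2)
qed simp

section \<open>Pointwise bounds for the kernel\<close>

lemma torus_kernel_nonneg: "0 \<le> torus_kernel M x"
proof transfer
  fix M and u :: "real ^ 'a"
  have "0 \<le> 1 + cos (2 * pi * u $ i)" for i
    using cos_ge_minus_one[of "2 * pi * u $ i"] by linarith
  then show "0 \<le> (\<Prod>i\<in>UNIV. ((1 + cos (2 * pi * u $ i)) / 2) ^ M)"
    by (intro prod_nonneg) simp
qed

lemma half_one_plus_cos: "(1 + cos (2 * pi * s)) / 2 = 1 - (sin (pi * s))\<^sup>2"
  using cos_double_sin[of "pi * s"] by (simp add: mult_ac)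

text \<open>The factors are powers of 1 - sin^2(pi s_i), and the squared sines sum to at most (pi
  r)^2. Weierstrass' inequality bounds the product below by 1 minus this sum, Bernoulli's its M-th
  power.\<close>

lemma torus_kernel_ge_half:
  assumes x: "dist x 0 < r" and M: "real M * (pi * r)\<^sup>2 \<le> 1 / 2"
  shows "1 / 2 \<le> torus_kernel M x"
proof (cases "M = 0")
  case True
  then show ?thesis by (simp add: torus_kernel_def)
next
  case False
  obtain u where u: "x = to_torus u"
    using to_torus_surj by blast
  have ne: "(int_lattice :: (real ^ 'a) set) \<noteq> {}"
    using int_lattice_0 by blast
  have "infdist u int_lattice < r"
    using x unfolding u zero_torus_def by (simp add: dist_torus.abs_eq)
  then obtain z where z: "z \<in> int_lattice" "dist u z < r"
    using infdist_notempty[OF ne, of u] cINF_less_iff[OF ne, of "dist u" r] by auto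
  define s where "s = u - z"
  have xs: "x = to_torus s"
    unfolding u s_def using z by (simp add: torus.abs_eq_iff torus_rel_def)
  have s: "norm s < r"
    using z by (simp add: s_def dist_norm)
  let ?y = "\<lambda>i. (sin (pi * s $ i))\<^sup>2"
  have y: "?y i \<in> {0..1}" for i
    by (simp add: abs_square_le_1)
  have "(\<Sum>i\<in>UNIV. ?y i) \<le> (\<Sum>i\<in>UNIV. (pi * s $ i)\<^sup>2)"
    by (intro sum_mono) (metis abs_sin_x_le_abs_x abs_le_square_iff)
  also have "\<dots> = (pi * norm s)\<^sup>2"
    by (simp add: norm_vec_def L2_set_def power_mult_distrib sum_distrib_left[symmetric] sum_nonneg)
  also have "\<dots> \<le> (pi * r)\<^sup>2"
    using s by (intro power_mono mult_left_mono) auto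
  finally have y_le: "(\<Sum>i\<in>UNIV. ?y i) \<le> (pi * r)\<^sup>2" .
  \<comment> \<open>The M-th power is monotone only on nonnegative bases, so the sum of squared
    sines must not exceed 1. The bound on \<open>M\<close> gives this once \<open>M\<close> is at
    least 1, hence the separate case \<open>M = 0\<close>.\<close>
  have "1 * (pi * r)\<^sup>2 \<le> real M * (pi * r)\<^sup>2"
    using False by (intro mult_right_mono) auto
  then have small: "(pi * r)\<^sup>2 \<le> 1 / 2" using M by simp
  have "1 / 2 \<le> 1 + real M * (- (\<Sum>i\<in>UNIV. ?y i))"
    using mult_left_mono[OF y_le, of "real M"] M by simp
  also have "\<dots> \<le> (1 + - (\<Sum>i\<in>UNIV. ?y i)) ^ M"
    using y_le small by (intro Bernoulli_inequality) simp
  also have "\<dots> \<le> (\<Prod>i\<in>UNIV. 1 - ?y i) ^ M"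
    using Weierstrass_prod_ineq[of UNIV ?y] y y_le small by (intro power_mono) auto
  also have "\<dots> = torus_kernel M x"
    unfolding xs by (simp add: torus_kernel.abs_eq half_one_plus_cos prod_power_distrib)
  finally show ?thesis .
qed

lemma sin_pi_ge:
  assumes "0 \<le> s" "s \<le> 1 / 2"
  shows "s \<le> sin (pi * s)"
proof -
  define x where "x = pi * s"
  have x: "0 \<le> x" "x \<le> 1.6"
    using assms pi_approx mult_mono[of pi "3.1415926535899" s "1/2"] by (auto simp: x_def)
  have "\<bar>sin x - x\<bar> \<le> x ^ 3 / 6"
    using Maclaurin_sin_bound[of x 3] x by (simp add: sin_coeff_def eval_nat_numeral)
  \<comment> \<open>As \<open>x\<close> is at most 1.6, its square is below 3 and the Taylor error
    x^3 / 6 is at most x / 2.\<close>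
  moreover have "x ^ 3 \<le> 3 * x"
  proof -
    have "x * x \<le> 1.6 * 1.6" using x by (intro mult_mono) auto
    then have "x * (x * x) \<le> x * 3" using x by (intro mult_left_mono) auto
    then show ?thesis by (simp add: power3_eq_cube mult_ac)
  qed
  ultimately have "x / 2 \<le> sin x" by linarith
  moreover have "2 * s \<le> pi * s"
    using assms pi_ge_two by (intro mult_right_mono) auto
  ultimately show ?thesis by (simp add: x_def)
qed

text \<open>Rounding puts every coordinate into [-1/2, 1/2], where |sin(pi s)| is at least |s|. Each
  base is then at most 1 - s^2, hence at most exp(-s^2), and the exponents add up to the squared
  norm.\<close>

lemma torus_kernel_le_exp:
  assumes r: "0 \<le> r" "r \<le> dist x 0"
  shows "torus_kernel M x \<le> exp (- (real M * r\<^sup>2))"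
proof -
  obtain u where u: "x = to_torus u"
    using to_torus_surj by blast
  define z :: "real ^ 'a" where "z = (\<chi> i. of_int (round (u $ i)))"
  define s where "s = u - z"
  have z: "z \<in> int_lattice" by (simp add: z_def int_lattice_def)
  have xs: "x = to_torus s"
    unfolding u s_def using z by (simp add: torus.abs_eq_iff torus_rel_def)
  have "r \<le> infdist u int_lattice"
    using r unfolding u zero_torus_def by (simp add: dist_torus.abs_eq)
  also have "\<dots> \<le> norm s"
    using infdist_le[OF z, of u] by (simp add: s_def dist_norm)
  finally have s: "r \<le> norm s" .
  have half: "\<bar>s $ i\<bar> \<le> 1 / 2" for i
    using of_int_round_abs_le[of "u $ i"] by (simp add: s_def z_def abs_minus_commute)
  have le: "(1 + cos (2 * pi * s $ i)) / 2 \<le> exp (- (s $ i)\<^sup>2)" for i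
  proof -
    have "\<bar>s $ i\<bar> \<le> sin (pi * \<bar>s $ i\<bar>)"
      using half by (intro sin_pi_ge) auto
    also have "\<dots> \<le> \<bar>sin (pi * s $ i)\<bar>"
      by (cases "0 \<le> s $ i") (auto simp: abs_if)
    finally have "(s $ i)\<^sup>2 \<le> (sin (pi * s $ i))\<^sup>2"
      by (simp add: abs_le_square_iff)
    then have "(1 + cos (2 * pi * s $ i)) / 2 \<le> 1 + - (s $ i)\<^sup>2"
      by (simp add: half_one_plus_cos)
    also have "\<dots> \<le> exp (- (s $ i)\<^sup>2)"
      by (rule exp_ge_add_one_self)
    finally show ?thesis .
  qed
  have nonneg: "0 \<le> (1 + cos (2 * pi * s $ i)) / 2" for i
  proof -
    have "0 \<le> 1 + cos (2 * pi * s $ i)"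
      using cos_ge_minus_one[of "2 * pi * s $ i"] by linarith
    then show ?thesis by simp
  qed
  have "torus_kernel M x \<le> (\<Prod>i\<in>UNIV. exp (- (s $ i)\<^sup>2) ^ M)"
    unfolding xs torus_kernel.abs_eq
    by (intro prod_mono conjI power_mono le nonneg zero_le_power)
  also have "\<dots> = exp (- (real M * (\<Sum>i\<in>UNIV. (s $ i)\<^sup>2)))"
    by (simp add: exp_sum[symmetric] exp_of_nat_mult[symmetric] sum_negf sum_distrib_left)
  also have "(\<Sum>i\<in>UNIV. (s $ i)\<^sup>2) = (norm s)\<^sup>2"
    by (simp add: norm_vec_def L2_set_def sum_nonneg)
  also have "exp (- (real M * (norm s)\<^sup>2)) \<le> exp (- (real M * r\<^sup>2))"
    using s r by (simp add: mult_left_mono power_mono)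
  finally show ?thesis .
qed

section \<open>Decay of correlations\<close>

text \<open>The class of functions to which the gap applies is stable under averaging, so the gap
  can be iterated.\<close>

lemma funpow_avg_op:
  assumes "bdd_fun f" "\<And>x. 0 \<le> f x" "f z = 0" "sq_norm f < \<infinity>"
    and bij: "\<And>g. g \<in> set_pmf \<mu> \<Longrightarrow> bij (T g :: 'a::countable \<Rightarrow> 'a)"
    and z: "\<And>g. g \<in> set_pmf \<mu> \<Longrightarrow> T g z = z"
  shows "bdd_fun ((avg_op \<mu> T ^^ k) f) \<and> (\<forall>x. 0 \<le> (avg_op \<mu> T ^^ k) f x) \<and> (avg_op \<mu> T ^^ k) f z = 0 \<and>
    sq_norm ((avg_op \<mu> T ^^ k) f) \<le> sq_norm f"
proof (induction k)
  case (Suc k)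
  let ?f = "(avg_op \<mu> T ^^ k) f"
  have "avg_op \<mu> T ?f z = (\<integral>g. 0 \<partial>measure_pmf \<mu>)"
    unfolding avg_op_def[of \<mu> T ?f] by (rule integral_cong_AE) (use Suc in \<open>auto intro!: AE_pmfI simp: z\<close>)
  moreover have "sq_norm (avg_op \<mu> T ?f) \<le> sq_norm f"
    using sq_norm_avg_op_le[of \<mu> T ?f] bij Suc by (meson order_trans)
  ultimately show ?case
    using Suc by (auto intro!: bdd_fun_avg_op avg_op_nonneg)
qed (use assms in auto)

text \<open>Each full block of \<open>K\<close> steps gains a factor \<open>q\<close>; the remaining
  \<open>k mod K\<close> steps do not increase the norm.\<close>

lemma sq_norm_funpow_avg_op:
  fixes T :: "'g \<Rightarrow> 'a::countable \<Rightarrow> 'a"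
  assumes bij: "\<And>g. g \<in> set_pmf \<mu> \<Longrightarrow> bij (T g)" and z: "\<And>g. g \<in> set_pmf \<mu> \<Longrightarrow> T g z = z"
    and K: "0 < K" and q: "0 \<le> q"
    and gap: "\<And>f. bdd_fun f \<Longrightarrow> (\<And>x. 0 \<le> f x) \<Longrightarrow> f z = 0 \<Longrightarrow> sq_norm f < \<infinity> \<Longrightarrow>
      sq_norm ((avg_op \<mu> T ^^ K) f) \<le> ennreal q * sq_norm f"
    and f: "bdd_fun f" "\<And>x. 0 \<le> f x" "f z = 0" "sq_norm f < \<infinity>"
  shows "sq_norm ((avg_op \<mu> T ^^ k) f) \<le> ennreal (q ^ (k div K)) * sq_norm f"
proof -
  let ?P = "avg_op \<mu> T"
  note pow = funpow_avg_op[of f z \<mu> T, OF f bij z]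
  have *: "sq_norm ((?P ^^ (K * j)) f) \<le> ennreal (q ^ j) * sq_norm f" for j
  proof (induction j)
    case (Suc j)
    let ?h = "(?P ^^ (K * j)) f"
    have "sq_norm ((?P ^^ (K * Suc j)) f) = sq_norm ((?P ^^ K) ?h)"
      by (simp add: funpow_add)
    also have "\<dots> \<le> ennreal q * sq_norm ?h"
      using pow[of "K * j"] f(4) by (intro gap) (auto intro: le_less_trans)
    also have "\<dots> \<le> ennreal q * (ennreal (q ^ j) * sq_norm f)"
      using Suc by (intro mult_left_mono) auto
    also have "\<dots> = ennreal (q ^ Suc j) * sq_norm f"
      using q by (simp add: ennreal_mult mult.assoc)
    finally show ?case .
  qed simp
  let ?h = "(?P ^^ (K * (k div K))) f"
  have h: "bdd_fun ?h" "\<And>x. 0 \<le> ?h x" "?h z = 0" "sq_norm ?h < \<infinity>"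
    using pow[of "K * (k div K)"] f(4) by (auto intro: le_less_trans)
  have "sq_norm ((?P ^^ k) f) = sq_norm ((?P ^^ (k mod K)) ?h)"
    by (metis comp_apply funpow_add mod_mult_div_eq)
  also have "\<dots> \<le> sq_norm ?h"
    using funpow_avg_op[of ?h z \<mu> T, OF h bij z, of "k mod K"] by simp
  also have "\<dots> \<le> ennreal (q ^ (k div K)) * sq_norm f"
    by (rule *)
  finally show ?thesis .
qed

text \<open>Dual to \<^const>\<open>walk\<close>: the matrices act on the characters from the right, so the last increment
  is applied first.\<close>

primrec freq_walk :: "(nat \<Rightarrow> int ^ 'n::finite ^ 'n) \<Rightarrow> int ^ 'n \<Rightarrow> nat \<Rightarrow> int ^ 'n" where
  "freq_walk g a 0 = a"
| "freq_walk g a (Suc n) = freq_walk g (a v* g n) n"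

lemma torus_char_walk: "torus_char a (walk g x n) = torus_char (freq_walk g a n) x"
  by (induction n arbitrary: a) (simp_all add: torus_char_act)

text \<open>The last \<open>k\<close> increments act first and the first \<open>n\<close> act last.
  In a correlation between times \<open>n\<close> and \<open>n + k\<close> the first
  \<open>n\<close> thus form a common injective map, which cancels.\<close>

lemma freq_walk_add: "freq_walk g b (n + k) = freq_walk g (freq_walk (\<lambda>i. g (n + i)) b k) n"
  by (induction k arbitrary: b) simp_all

lemma bij_vector_matrix_mult:
  assumes "A \<in> carrier torus_Aut"
  shows "bij (\<lambda>a :: int ^ 'n::finite. a v* A)"
proof -
  interpret group torus_Aut by (rule group_torus_Aut)
  obtain B where "B ** A = mat 1" "A ** B = mat 1"
    using l_inv[OF assms] r_inv[OF assms] by (auto simp: torus_Aut_def)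
  then show ?thesis
    by (intro o_bij[of "\<lambda>a. a v* B"]) (auto simp: fun_eq_iff vector_matrix_mul_assoc)
qed

lemma inj_freq_walk:
  assumes "\<And>i. g i \<in> carrier torus_Aut"
  shows "inj (\<lambda>a. freq_walk g a n)"
proof (induction n)
  case (Suc n)
  then show ?case
    using inj_compose[OF Suc bij_is_inj[OF bij_vector_matrix_mult[OF assms, of n]]] by (simp add: o_def)
qed simp

lemma freq_walk_eq_iff:
  assumes "\<forall>i. g i \<in> carrier torus_Aut"
  shows "freq_walk g a n = freq_walk g b n \<longleftrightarrow> a = b"
  using inj_freq_walk[of g n] assms by (auto simp: inj_def)

lemma freq_walk_0 [simp]: "freq_walk g 0 n = 0"
  by (induction n) simp_all

section \<open>The probability space of the walk\<close>

abbreviation increments :: "'a pmf \<Rightarrow> (nat \<Rightarrow> 'a) measure" where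
  "increments \<mu> \<equiv> \<Pi>\<^sub>M i\<in>(UNIV::nat set). measure_pmf \<mu>"

lemma sets_torus_measure [simp, measurable_cong]: "sets torus_measure = sets borel"
  by (simp add: torus_measure_def)

lemma space_torus_measure [simp]: "space torus_measure = UNIV"
  by (simp add: torus_measure_def)

lemma prob_space_increments: "prob_space (increments \<mu>)"
  by (intro prob_space_PiM measure_pmf.prob_space_axioms)

lemma prob_space_walk_measure: "prob_space (walk_measure \<mu>)"
proof -
  interpret P: pair_prob_space "increments \<mu>" "torus_measure :: 'a torus measure"
    by (intro pair_prob_space.intro pair_sigma_finite.intro prob_space_imp_sigma_finite
        prob_space_increments prob_space_torus_measure)
  show ?thesis
    unfolding walk_measure_def by unfold_locales
qed

lemma measurable_increment [measurable]: "(\<lambda>g. g n) \<in> increments \<mu> \<rightarrow>\<^sub>M count_space UNIV"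
proof -
  have "(\<lambda>g. g n) \<in> increments \<mu> \<rightarrow>\<^sub>M measure_pmf \<mu>"
    by (rule measurable_component_singleton) simp
  then show ?thesis
    by (simp cong: measurable_cong_sets)
qed

lemma measurable_freq_walk [measurable]:
  fixes a :: "int ^ 'n::finite"
  shows "(\<lambda>g. freq_walk g a n) \<in> increments \<mu> \<rightarrow>\<^sub>M count_space UNIV"
proof (induction n arbitrary: a)
  case (Suc n)
  have "(\<lambda>g. freq_walk g (a v* g n) n) \<in> increments \<mu> \<rightarrow>\<^sub>M count_space UNIV"
    by (rule measurable_compose_countable'[where I = UNIV and g = "\<lambda>g. a v* g n"
          and f = "\<lambda>b g. freq_walk g (b :: int ^ 'n) n"])
      (use Suc in \<open>auto intro: measurable_compose[OF measurable_increment]\<close>)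
  then show ?case by simp
qed simp

lemma measurable_torus_char_freq_walk [measurable]:
  fixes a :: "int ^ 'n::finite"
  shows "(\<lambda>p. torus_char (freq_walk (fst p) a n) (snd p)) \<in> borel_measurable (walk_measure \<mu>)"
  unfolding walk_measure_def
  by (rule measurable_compose_countable'[where I = UNIV and g = "\<lambda>p. freq_walk (fst p) a n"
        and f = "\<lambda>b p. torus_char (b :: int ^ 'n) (snd p)"])
    (auto intro: measurable_compose[OF measurable_fst measurable_freq_walk])

lemma measurable_freq_walk_eq:
  fixes a b :: "int ^ 'n::finite"
  shows "(\<lambda>g. of_bool (freq_walk g a n = freq_walk g b m) :: complex) \<in> borel_measurable (increments \<mu>)"
  by (rule measurable_compose_countable'[where I = UNIV and g = "\<lambda>g. freq_walk g b m"
        and f = "\<lambda>c g. of_bool (freq_walk g a n = (c :: int ^ 'n))"])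
    (auto intro: measurable_compose[OF measurable_freq_walk])

lemma distr_shift_increments:
  "distr (increments \<mu>) (increments \<mu>) (\<lambda>g i. g (n + i)) = increments \<mu>"
  using distr_PiM_reindex[of UNIV "\<lambda>_. measure_pmf \<mu>" "(+) n" UNIV]
  by (simp add: measure_pmf.prob_space_axioms inj_def restrict_UNIV)

lemma measurable_shift: "(\<lambda>g i. g (n + i)) \<in> increments \<mu> \<rightarrow>\<^sub>M increments \<mu>"
  by (rule measurable_PiM_single') auto

text \<open>The increment \<open>g 0\<close> acts last, on the result of the others. Integrating
  over it first turns \<open>f\<close> into its average, to which the induction hypothesis
  applies.\<close>

lemma integral_freq_walk:
  fixes f :: "int ^ 'n::finite \<Rightarrow> real"
  assumes "bdd_fun f"
  shows "(\<integral>g. f (freq_walk g b k) \<partial>increments \<mu>) = (avg_op \<mu> (\<lambda>A a. a v* A) ^^ k) f b"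
  using assms
proof (induction k arbitrary: f)
  case 0
  interpret prob_space "increments \<mu>" by (rule prob_space_increments)
  show ?case using prob_space by simp
next
  case (Suc k)
  let ?S = "increments \<mu>" and ?P = "avg_op \<mu> (\<lambda>A a. a v* A)"
  interpret sequence_space "measure_pmf \<mu>"
    by unfold_locales
  interpret P: pair_prob_space "measure_pmf \<mu>" ?S
    by (intro pair_prob_space.intro pair_sigma_finite.intro prob_space_imp_sigma_finite
        prob_space_increments measure_pmf.prob_space_axioms)
  obtain B where B: "\<bar>f a\<bar> \<le> B" for a
    using Suc.prems by (auto simp: bdd_fun_def)
  have step: "freq_walk (case_nat A \<omega>) b (Suc k) = freq_walk \<omega> b k v* A" for A \<omega>
    using freq_walk_add[of "case_nat A \<omega>" b 1 k] by simp
  have [measurable]: "(\<lambda>p. f (freq_walk (snd p) b k v* fst p)) \<in> borel_measurable (measure_pmf \<mu> \<Otimes>\<^sub>M ?S)"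
  proof (rule measurable_compose_countable'[where I = UNIV and f = "\<lambda>a p. f (a v* fst p)"])
    show "(\<lambda>p. freq_walk (snd p) b k) \<in> measure_pmf \<mu> \<Otimes>\<^sub>M ?S \<rightarrow>\<^sub>M count_space UNIV"
      by (rule measurable_compose[OF measurable_snd measurable_freq_walk])
    show "(\<lambda>p. f (a v* fst p)) \<in> borel_measurable (measure_pmf \<mu> \<Otimes>\<^sub>M ?S)" for a
      by (rule measurable_compose[OF measurable_fst]) simp
  qed auto
  have "(\<integral>g. f (freq_walk g b (Suc k)) \<partial>?S)
      = (\<integral>g. f (freq_walk g b (Suc k)) \<partial>distr (measure_pmf \<mu> \<Otimes>\<^sub>M ?S) ?S (\<lambda>(s, \<omega>). case_nat s \<omega>))"
    by (simp only: PiM_iter)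
  also have "\<dots> = (\<integral>p. f (freq_walk (case_nat (fst p) (snd p)) b (Suc k)) \<partial>(measure_pmf \<mu> \<Otimes>\<^sub>M ?S))"
    by (subst integral_distr)
      (auto simp: case_prod_beta simp del: freq_walk.simps intro: measurable_compose[OF measurable_freq_walk])
  also have "\<dots> = (\<integral>(A, \<omega>). f (freq_walk \<omega> b k v* A) \<partial>(measure_pmf \<mu> \<Otimes>\<^sub>M ?S))"
    by (simp add: step case_prod_unfold del: freq_walk.simps)
  also have "\<dots> = (\<integral>\<omega>. (\<integral>A. f (freq_walk \<omega> b k v* A) \<partial>measure_pmf \<mu>) \<partial>?S)"
    by (rule P.integral_snd[symmetric], rule P.P.integrable_const_bound[of _ B])
      (auto simp: case_prod_beta B)
  also have "\<dots> = (\<integral>\<omega>. ?P f (freq_walk \<omega> b k) \<partial>?S)"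
    by (simp add: avg_op_def)
  also have "\<dots> = (?P ^^ k) (?P f) b"
    by (rule Suc.IH) (rule bdd_fun_avg_op[OF Suc.prems])
  finally show ?case
    by (simp add: funpow_swap1)
qed

lemma integral_freq_walk_shift:
  fixes f :: "int ^ 'n::finite \<Rightarrow> real"
  assumes "bdd_fun f"
  shows "(\<integral>g. f (freq_walk (\<lambda>i. g (n + i)) b k) \<partial>increments \<mu>) = (avg_op \<mu> (\<lambda>A a. a v* A) ^^ k) f b"
proof -
  have "(\<integral>g. f (freq_walk g b k) \<partial>distr (increments \<mu>) (increments \<mu>) (\<lambda>g i. g (n + i)))
      = (\<integral>g. f (freq_walk (\<lambda>i. g (n + i)) b k) \<partial>increments \<mu>)"
    by (rule integral_distr[OF measurable_shift]) (rule measurable_compose[OF measurable_freq_walk], simp)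
  then show ?thesis
    unfolding distr_shift_increments by (simp add: integral_freq_walk[OF assms])
qed

lemma integral_walk_measure:
  fixes f :: "(nat \<Rightarrow> int ^ 'n::finite ^ 'n) \<Rightarrow> 'n torus \<Rightarrow> complex"
  assumes "integrable (walk_measure \<mu>) (\<lambda>p. f (fst p) (snd p))"
  shows "(\<integral>p. f (fst p) (snd p) \<partial>walk_measure \<mu>) = (\<integral>g. (\<integral>x. f g x \<partial>torus_measure) \<partial>increments \<mu>)"
proof -
  interpret P: pair_prob_space "increments \<mu>" "torus_measure :: 'n torus measure"
    by (intro pair_prob_space.intro pair_sigma_finite.intro prob_space_imp_sigma_finite
        prob_space_increments prob_space_torus_measure)
  show ?thesis
    using P.integral_fst'[OF assms[unfolded walk_measure_def]] by (simp add: walk_measure_def)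
qed

lemma measurable_cnj [measurable (raw)]:
  "f \<in> borel_measurable M \<Longrightarrow> (\<lambda>x. cnj (f x)) \<in> borel_measurable M"
  by (rule borel_measurable_continuous_on[OF continuous_on_cnj[OF continuous_on_id]])

text \<open>Each value of \<open>k div K\<close> is taken by \<open>K\<close> consecutive
  \<open>k\<close>, so the sum is at most \<open>K\<close> times a geometric series.\<close>

lemma sum_power_div_le:
  fixes r :: real
  assumes r: "0 \<le> r" "r < 1" and K: "0 < K" and B: "finite (B :: nat set)"
  shows "(\<Sum>k\<in>B. r ^ (k div K)) \<le> real K / (1 - r)"
proof -
  obtain L where L: "B \<subseteq> {..<L}"
    using B finite_nat_iff_bounded by blast
  have "(\<Sum>k\<in>B. r ^ (k div K)) \<le> (\<Sum>k<L * K. r ^ (k div K))"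
  proof (rule sum_mono2)
    have "L \<le> L * K" using K by simp
    with L show "B \<subseteq> {..<L * K}"
      by (meson lessThan_subset_iff order_trans)
  qed (use r in auto)
  also have "\<dots> = (\<Sum>j<L. \<Sum>k=j * K..<j * K + K. r ^ (k div K))"
    by (rule sum.nat_group[symmetric])
  also have "\<dots> = (\<Sum>j<L. real K * r ^ j)"
  proof (rule sum.cong[OF refl])
    fix j
    have "(\<Sum>k=j * K..<j * K + K. r ^ (k div K)) = (\<Sum>k=j * K..<j * K + K. r ^ j)"
    proof (rule sum.cong[OF refl])
      fix k assume k: "k \<in> {j * K..<j * K + K}"
      then have "k div K = j"
        by (intro div_nat_eqI) (auto simp: mult.commute)
      then show "r ^ (k div K) = r ^ j" by simp
    qed
    then show "(\<Sum>k=j * K..<j * K + K. r ^ (k div K)) = real K * r ^ j" by simp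
  qed
  also have "\<dots> = real K * ((1 - r ^ L) / (1 - r))"
    using r by (simp add: sum_distrib_left[symmetric] sum_gp_strict)
  also have "\<dots> \<le> real K * (1 / (1 - r))"
    using r by (intro mult_left_mono divide_right_mono) auto
  finally show ?thesis by simp
qed

text \<open>With truncated subtraction, \<^term>\<open>(n - m) + (m - n)\<close> is the distance of two natural numbers.\<close>

lemma sum_power_dist_div_le:
  fixes r :: real
  assumes r: "0 \<le> r" "r < 1" and K: "0 < K" and I: "finite (I :: nat set)"
  shows "(\<Sum>m\<in>I. r ^ (((n - m) + (m - n)) div K)) \<le> 2 * real K / (1 - r)"
proof -
  let ?A = "I \<inter> {n..}" and ?B = "I - {n..}"
  have "(\<Sum>m\<in>?A. r ^ (((n - m) + (m - n)) div K)) = (\<Sum>k\<in>(\<lambda>m. m - n) ` ?A. r ^ (k div K))"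
    by (subst sum.reindex) (auto simp: inj_on_def)
  moreover have "(\<Sum>m\<in>?B. r ^ (((n - m) + (m - n)) div K)) = (\<Sum>k\<in>(\<lambda>m. n - m) ` ?B. r ^ (k div K))"
    by (subst sum.reindex) (auto simp: inj_on_def)
  moreover have "(\<Sum>m\<in>I. r ^ (((n - m) + (m - n)) div K))
      = (\<Sum>m\<in>?A. r ^ (((n - m) + (m - n)) div K)) + (\<Sum>m\<in>?B. r ^ (((n - m) + (m - n)) div K))"
    using I by (rule sum.Int_Diff)
  ultimately show ?thesis
    using sum_power_div_le[OF r K, of "(\<lambda>m. m - n) ` ?A"] sum_power_div_le[OF r K, of "(\<lambda>m. n - m) ` ?B"] I
    by simp
qed

lemma sq_norm_eq_sum:
  assumes "finite F" "\<And>x. x \<notin> F \<Longrightarrow> f x = 0"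
  shows "sq_norm f = ennreal (\<Sum>x\<in>F. (f x)\<^sup>2)"
proof -
  have "sq_norm f = (\<Sum>x\<in>F. ennreal ((f x)\<^sup>2))"
    unfolding sq_norm_def using assms by (intro nn_integral_count_space') auto
  then show ?thesis
    by (simp add: sum_ennreal)
qed

lemma sum_squares_le_sq_norm:
  assumes "finite F"
  shows "ennreal (\<Sum>x\<in>F. (f x)\<^sup>2) \<le> sq_norm f"
proof -
  have "ennreal (\<Sum>x\<in>F. (f x)\<^sup>2) = sq_norm (\<lambda>x. of_bool (x \<in> F) * f x)"
    using sq_norm_eq_sum[OF assms, of "\<lambda>x. of_bool (x \<in> F) * f x"] by simp
  also have "\<dots> \<le> sq_norm f"
    unfolding sq_norm_def by (intro nn_integral_mono ennreal_leI) (auto simp: of_bool_def)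
  finally show ?thesis .
qed

section \<open>Correlations and variance along the walk\<close>

context
  fixes \<mu> :: "(int ^ 'n::finite ^ 'n) pmf"
  assumes \<mu>: "set_pmf \<mu> \<subseteq> carrier torus_Aut"
begin

lemma AE_increments: "AE g in increments \<mu>. \<forall>i. g i \<in> carrier torus_Aut"
proof -
  have "AE g in increments \<mu>. g i \<in> carrier torus_Aut" for i
    by (rule AE_PiM_component[of UNIV]) (use \<mu> in \<open>auto simp: measure_pmf.prob_space_axioms intro!: AE_pmfI\<close>)
  then show ?thesis
    by (simp add: AE_all_countable)
qed

interpretation W: prob_space "walk_measure \<mu>"
  by (rule prob_space_walk_measure)

lemma integrable_bounded_walk_measure:
  fixes f :: "(nat \<Rightarrow> int ^ 'n ^ 'n) \<times> 'n torus \<Rightarrow> 'b::{banach, second_countable_topology}"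
  assumes "f \<in> borel_measurable (walk_measure \<mu>)" "\<And>p. norm (f p) \<le> B"
  shows "integrable (walk_measure \<mu>) f"
  using assms by (intro W.integrable_const_bound[of _ B]) auto

lemma integral_torus_char_walk:
  "(\<integral>p. torus_char (freq_walk (fst p) a n) (snd p) \<partial>walk_measure \<mu>) = of_bool (a = 0)"
proof -
  interpret prob_space "increments \<mu>" by (rule prob_space_increments)
  have "AE g in increments \<mu>. freq_walk g a n = 0 \<longleftrightarrow> a = 0"
    using AE_increments by (elim AE_mp) (use freq_walk_eq_iff[of _ a n 0] in \<open>auto intro!: AE_I2\<close>)
  then have "(\<integral>g. of_bool (freq_walk g a n = 0) \<partial>increments \<mu>) = (\<integral>g. of_bool (a = 0) \<partial>increments \<mu> :: complex)"
    by (intro integral_cong_AE) auto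
  moreover have "(\<integral>p. torus_char (freq_walk (fst p) a n) (snd p) \<partial>walk_measure \<mu>)
      = (\<integral>g. (\<integral>x. torus_char (freq_walk g a n) x \<partial>torus_measure) \<partial>increments \<mu>)"
    by (rule integral_walk_measure) (rule integrable_bounded_walk_measure[of _ 1], auto)
  ultimately show ?thesis
    using prob_space by (simp add: integral_torus_char)
qed

text \<open>Integration over the starting point leaves the event that the two transported
  frequencies agree; the first \<open>n\<close> increments act injectively on both and drop
  out.\<close>

lemma integral_torus_char_correlation:
  "(\<integral>p. torus_char (freq_walk (fst p) a n) (snd p) * cnj (torus_char (freq_walk (fst p) b (n + k)) (snd p))
     \<partial>walk_measure \<mu>)
   = (\<integral>g. of_bool (a = freq_walk (\<lambda>i. g (n + i)) b k) \<partial>increments \<mu>)"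
proof -
  have [measurable]: "(\<lambda>g. freq_walk (\<lambda>i. g (n + i)) b k) \<in> increments \<mu> \<rightarrow>\<^sub>M count_space UNIV"
    by (rule measurable_compose[OF measurable_shift measurable_freq_walk])
  have "AE g in increments \<mu>. freq_walk g a n - freq_walk g b (n + k) = 0 \<longleftrightarrow> a = freq_walk (\<lambda>i. g (n + i)) b k"
    using AE_increments by (elim AE_mp) (auto intro!: AE_I2 simp: freq_walk_add freq_walk_eq_iff)
  then have "(\<integral>g. of_bool (freq_walk g a n - freq_walk g b (n + k) = 0) \<partial>increments \<mu>)
      = (\<integral>g. of_bool (a = freq_walk (\<lambda>i. g (n + i)) b k) \<partial>increments \<mu> :: complex)"
    by (intro integral_cong_AE) (auto intro: measurable_freq_walk_eq)
  moreover have "(\<integral>p. torus_char (freq_walk (fst p) a n) (snd p) * cnj (torus_char (freq_walk (fst p) b (n + k)) (snd p))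
     \<partial>walk_measure \<mu>)
     = (\<integral>g. (\<integral>x. torus_char (freq_walk g a n) x * cnj (torus_char (freq_walk g b (n + k)) x) \<partial>torus_measure) \<partial>increments \<mu>)"
    by (rule integral_walk_measure) (rule integrable_bounded_walk_measure[of _ 1], auto simp: norm_mult)
  ultimately show ?thesis
    by (simp add: torus_char_mult_cnj integral_torus_char)
qed


context
  fixes K :: nat and q :: real
  assumes K: "0 < K" and q: "0 \<le> q" "q < 1"
    and gap: "\<And>f. bdd_fun f \<Longrightarrow> (\<And>x. 0 \<le> f x) \<Longrightarrow> f 0 = 0 \<Longrightarrow> sq_norm f < \<infinity> \<Longrightarrow>
      sq_norm ((avg_op \<mu> (\<lambda>A a. a v* A) ^^ K) f) \<le> ennreal q * sq_norm f"
begin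

text \<open>With absolute values inside, the double sum is the inner product of |c| with its
  \<open>k\<close>-fold average, and Cauchy-Schwarz and the gap finish. The root of \<open>q\<close>
  appears because \<open>sq_norm\<close> is a squared norm. Only the sum of squares of the
  coefficients enters, so the degree does not matter.\<close>

lemma correlation_le:
  fixes c :: "int ^ 'n \<Rightarrow> complex" and F :: "(int ^ 'n) set"
  defines "Z \<equiv> \<lambda>n p. \<Sum>a\<in>F. c a * torus_char (freq_walk (fst p) a n) (snd p)"
  assumes F: "finite F" "0 \<notin> F"
  shows "norm (\<integral>p. Z n p * cnj (Z (n + k) p) \<partial>walk_measure \<mu>)
    \<le> (\<Sum>a\<in>F. (norm (c a))\<^sup>2) * sqrt q ^ (k div K)"
proof -
  let ?P = "avg_op \<mu> (\<lambda>A a. a v* A)"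
  define f where "f a = of_bool (a \<in> F) * norm (c a)" for a
  define Q where "Q = (\<Sum>a\<in>F. (norm (c a))\<^sup>2)"
  define corr :: "int ^ 'n \<Rightarrow> int ^ 'n \<Rightarrow> complex"
    where "corr a b = (\<integral>g. of_bool (a = freq_walk (\<lambda>i. g (n + i)) b k) \<partial>increments \<mu>)" for a b :: "int ^ 'n"
  have [measurable]: "(\<lambda>g. freq_walk (\<lambda>i. g (n + i)) b k) \<in> increments \<mu> \<rightarrow>\<^sub>M count_space UNIV" for b :: "int ^ 'n"
    by (rule measurable_compose[OF measurable_shift measurable_freq_walk])
  interpret S: prob_space "increments \<mu>" by (rule prob_space_increments)
  have f_bound: "\<bar>f a\<bar> \<le> (\<Sum>a\<in>F. norm (c a))" for a
    using F(1) by (auto simp: f_def intro: member_le_sum sum_nonneg)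
  then have f_bdd: "bdd_fun f" by (rule bdd_funI)
  have f: "0 \<le> f a" "f 0 = 0" for a
    using F by (auto simp: f_def)
  have Q: "sq_norm f = ennreal Q" "0 \<le> Q"
    using sq_norm_eq_sum[OF F(1), of f] by (auto simp: f_def Q_def sum_nonneg)
  have int: "integrable (walk_measure \<mu>)
      (\<lambda>p. torus_char (freq_walk (fst p) a n) (snd p) * cnj (torus_char (freq_walk (fst p) b (n + k)) (snd p)))" for a b
    by (rule integrable_bounded_walk_measure[of _ 1]) (auto simp: norm_mult)
  have "Z n p * cnj (Z (n + k) p) = (\<Sum>b\<in>F. \<Sum>a\<in>F. c a * cnj (c b) *
      (torus_char (freq_walk (fst p) a n) (snd p) * cnj (torus_char (freq_walk (fst p) b (n + k)) (snd p))))" for p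
    unfolding Z_def cnj_sum sum_product by (subst sum.swap) (simp add: mult_ac)
  then have "(\<integral>p. Z n p * cnj (Z (n + k) p) \<partial>walk_measure \<mu>) = (\<Sum>b\<in>F. \<Sum>a\<in>F. c a * cnj (c b) * corr a b)"
    using int by (simp add: corr_def integral_torus_char_correlation)
  also have "norm \<dots> \<le> (\<Sum>b\<in>F. \<Sum>a\<in>F. norm (c a) * norm (c b) * norm (corr a b))"
    by (intro order_trans[OF norm_sum] sum_mono) (simp add: norm_mult)
  also have "\<dots> \<le> (\<Sum>b\<in>F. \<Sum>a\<in>F. norm (c a) * norm (c b) *
      (\<integral>g. of_bool (a = freq_walk (\<lambda>i. g (n + i)) b k) \<partial>increments \<mu>))"
  proof (intro sum_mono mult_left_mono)
    fix a b :: "int ^ 'n"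
    show "norm (corr a b) \<le> (\<integral>g. of_bool (a = freq_walk (\<lambda>i. g (n + i)) b k) \<partial>increments \<mu>)"
    proof -
      have "norm (of_bool P :: complex) = of_bool P" for P
        by (cases P) simp_all
      then show ?thesis
        unfolding corr_def by (intro order_trans[OF integral_norm_bound]) simp
    qed
  qed auto
  also have "\<dots> = (\<Sum>b\<in>F. f b * (?P ^^ k) f b)"
  proof (rule sum.cong[OF refl])
    fix b assume b: "b \<in> F"
    have sum_f: "(\<Sum>a\<in>F. norm (c a) * of_bool (a = d)) = f d" for d
      using F(1) by (auto simp: f_def of_bool_def if_distrib sum.delta cong: if_cong)
    have "(\<Sum>a\<in>F. norm (c a) * norm (c b) * (\<integral>g. of_bool (a = freq_walk (\<lambda>i. g (n + i)) b k) \<partial>increments \<mu>))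
        = norm (c b) * (\<integral>g. (\<Sum>a\<in>F. norm (c a) * of_bool (a = freq_walk (\<lambda>i. g (n + i)) b k)) \<partial>increments \<mu>)"
    proof -
      have "integrable (increments \<mu>) (\<lambda>g. of_bool (a = freq_walk (\<lambda>i. g (n + i)) b k) :: real)" for a
        by (rule S.integrable_const_bound[of _ 1]) auto
      then show ?thesis
        by (simp add: sum_distrib_left mult_ac)
    qed
    also have "\<dots> = norm (c b) * (\<integral>g. f (freq_walk (\<lambda>i. g (n + i)) b k) \<partial>increments \<mu>)"
      unfolding sum_f ..
    also have "\<dots> = f b * (?P ^^ k) f b"
      unfolding integral_freq_walk_shift[OF f_bdd] using b by (simp add: f_def[of b])
    finally show "(\<Sum>a\<in>F. norm (c a) * norm (c b) * (\<integral>g. of_bool (a = freq_walk (\<lambda>i. g (n + i)) b k) \<partial>increments \<mu>))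
        = f b * (?P ^^ k) f b" .
  qed
  also have "\<dots> \<le> sqrt (\<Sum>b\<in>F. (f b)\<^sup>2) * sqrt (\<Sum>b\<in>F. ((?P ^^ k) f b)\<^sup>2)"
    using L2_set_mult_ineq[of f "(?P ^^ k) f" F] sum_mono[of F "\<lambda>b. f b * (?P ^^ k) f b" "\<lambda>b. \<bar>f b\<bar> * \<bar>(?P ^^ k) f b\<bar>"]
    by (force simp: L2_set_def abs_mult[symmetric])
  also have "(\<Sum>b\<in>F. (f b)\<^sup>2) = Q"
    by (simp add: Q_def f_def)
  also have "(\<Sum>b\<in>F. ((?P ^^ k) f b)\<^sup>2) \<le> q ^ (k div K) * Q"
  proof -
    have "ennreal (\<Sum>b\<in>F. ((?P ^^ k) f b)\<^sup>2) \<le> sq_norm ((?P ^^ k) f)"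
      by (rule sum_squares_le_sq_norm[OF F(1)])
    also have "\<dots> \<le> ennreal (q ^ (k div K)) * sq_norm f"
      using \<mu> f f_bdd Q
      by (intro sq_norm_funpow_avg_op[where z = 0, OF _ _ K q(1) gap]) (auto intro: bij_vector_matrix_mult)
    finally show ?thesis
      using q Q by (simp add: ennreal_mult[symmetric])
  qed
  also have "sqrt Q * sqrt (q ^ (k div K) * Q) = Q * sqrt q ^ (k div K)"
    using Q by (simp add: real_sqrt_mult real_sqrt_power)
  finally show ?thesis
    using Q by (simp add: Q_def mult_left_mono)
qed

text \<open>Expanded over pairs of times, the correlations decay geometrically in the time
  difference, so each of the \<open>card I\<close> rows has a bounded sum.\<close>

lemma variance_le:
  fixes c :: "int ^ 'n \<Rightarrow> complex" and F :: "(int ^ 'n) set"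
  defines "Z \<equiv> \<lambda>n p. \<Sum>a\<in>F. c a * torus_char (freq_walk (fst p) a n) (snd p)"
  assumes F: "finite F" "0 \<notin> F" and I: "finite I"
  shows "(\<integral>p. (norm (\<Sum>n\<in>I. Z n p))\<^sup>2 \<partial>walk_measure \<mu>)
    \<le> (\<Sum>a\<in>F. (norm (c a))\<^sup>2) * (real (card I) * (2 * real K / (1 - sqrt q)))"
proof -
  define Q where "Q = (\<Sum>a\<in>F. (norm (c a))\<^sup>2)"
  have [measurable]: "Z n \<in> borel_measurable (walk_measure \<mu>)" for n
    unfolding Z_def by measurable
  have Z_bound: "norm (Z n p) \<le> (\<Sum>a\<in>F. norm (c a))" for n p
    unfolding Z_def by (rule order_trans[OF norm_sum]) (simp add: norm_mult)
  have int: "integrable (walk_measure \<mu>) (\<lambda>p. Z n p * cnj (Z m p))" for n m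
    by (rule integrable_bounded_walk_measure[of _ "(\<Sum>a\<in>F. norm (c a)) * (\<Sum>a\<in>F. norm (c a))"])
      (auto simp: norm_mult intro!: mult_mono Z_bound sum_nonneg)
  have corr: "norm (\<integral>p. Z n p * cnj (Z m p) \<partial>walk_measure \<mu>) \<le> Q * sqrt q ^ (((n - m) + (m - n)) div K)" for n m
  proof (cases "n \<le> m")
    case True
    then show ?thesis
      using correlation_le[OF F, of c n "m - n"] by (simp add: Z_def Q_def)
  next
    case False
    have "(\<integral>p. Z n p * cnj (Z m p) \<partial>walk_measure \<mu>) = (\<integral>p. cnj (Z m p * cnj (Z n p)) \<partial>walk_measure \<mu>)"
      by (simp add: mult.commute)
    also have "\<dots> = cnj (\<integral>p. Z m p * cnj (Z n p) \<partial>walk_measure \<mu>)"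
      by (rule integral_bounded_linear[OF bounded_linear_cnj int])
    finally show ?thesis
      using correlation_le[OF F, of c m "n - m"] False by (simp add: Z_def Q_def)
  qed
  have "complex_of_real (\<integral>p. (norm (\<Sum>n\<in>I. Z n p))\<^sup>2 \<partial>walk_measure \<mu>)
      = (\<integral>p. (\<Sum>n\<in>I. \<Sum>m\<in>I. Z n p * cnj (Z m p)) \<partial>walk_measure \<mu>)"
    unfolding integral_complex_of_real[symmetric] complex_norm_square cnj_sum sum_product ..
  also have "\<dots> = (\<Sum>n\<in>I. \<Sum>m\<in>I. (\<integral>p. Z n p * cnj (Z m p) \<partial>walk_measure \<mu>))"
    using int by simp
  finally have "norm (complex_of_real (\<integral>p. (norm (\<Sum>n\<in>I. Z n p))\<^sup>2 \<partial>walk_measure \<mu>))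
      = norm (\<Sum>n\<in>I. \<Sum>m\<in>I. (\<integral>p. Z n p * cnj (Z m p) \<partial>walk_measure \<mu>))"
    by (rule arg_cong)
  also have "\<dots> \<le> (\<Sum>n\<in>I. \<Sum>m\<in>I. Q * sqrt q ^ (((n - m) + (m - n)) div K))"
    by (intro order_trans[OF norm_sum] sum_mono corr)
  also have "\<dots> \<le> (\<Sum>n\<in>I. Q * (2 * real K / (1 - sqrt q)))"
    unfolding sum_distrib_left[symmetric] using q K I
    by (intro sum_mono mult_left_mono sum_power_dist_div_le) (simp_all add: Q_def sum_nonneg real_sqrt_lt_1_iff)
  also have "\<dots> = Q * (real (card I) * (2 * real K / (1 - sqrt q)))"
    by simp
  finally show ?thesis
    unfolding norm_of_real by (simp add: Q_def)
qed

end

end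

section \<open>Visits to shrinking balls\<close>

lemma dist_torus_diff_0: "dist (x - y) 0 = dist x (y :: 'n::finite torus)"
  by transfer simp

text \<open>The zero frequency is split off: its coefficient is the mean, and the rest has the form
  to which \<open>variance_le\<close> applies.\<close>

lemma torus_kernel_walk:
  "complex_of_real (torus_kernel M (walk g x n - x0)) = of_real (kernel_coeff M (0 :: int ^ 'n::finite)) +
    (\<Sum>a\<in>freq_box M - {0}. (of_real (kernel_coeff M a) * cnj (torus_char a (x0 :: 'n torus))) * torus_char (freq_walk g a n) x)"
  unfolding torus_kernel_expansion
  by (subst sum.remove[of _ 0]) (auto simp: torus_char_diff torus_char_walk mult_ac)

lemma measurable_torus_kernel_walk [measurable]:
  "(\<lambda>p. torus_kernel M (walk (fst p) (snd p) n - x0)) \<in> borel_measurable (walk_measure \<mu>)"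
proof -
  have "(\<lambda>p. Re (complex_of_real (torus_kernel M (walk (fst p) (snd p) n - x0)))) \<in> borel_measurable (walk_measure \<mu>)"
    unfolding torus_kernel_walk by measurable
  then show ?thesis by simp
qed

lemma torus_kernel_le_1: "torus_kernel M x \<le> 1"
  using torus_kernel_le_exp[of 0 x M] by simp

context
  fixes \<mu> :: "(int ^ 'n::finite ^ 'n) pmf"
  assumes \<mu>: "set_pmf \<mu> \<subseteq> carrier torus_Aut"
begin

interpretation W: prob_space "walk_measure \<mu>"
  by (rule prob_space_walk_measure)

lemma expectation_torus_kernel:
  "(\<integral>p. torus_kernel M (walk (fst p) (snd p) n - x0) \<partial>walk_measure \<mu>) = kernel_coeff M (0 :: int ^ 'n)"
proof -
  have int: "integrable (walk_measure \<mu>) (\<lambda>p. torus_char (freq_walk (fst p) a n) (snd p))" for a :: "int ^ 'n"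
    by (rule W.integrable_const_bound[of _ 1]) auto
  have "complex_of_real (\<integral>p. torus_kernel M (walk (fst p) (snd p) n - x0) \<partial>walk_measure \<mu>)
      = complex_of_real (kernel_coeff M (0 :: int ^ 'n))"
    unfolding integral_complex_of_real[symmetric] torus_kernel_walk
    using int W.prob_space by (simp add: integral_torus_char_walk[OF \<mu>])
  then show ?thesis
    by (simp only: of_real_eq_iff)
qed

lemma prob_torus_kernel_ge:
  "measure (walk_measure \<mu>) {p \<in> space (walk_measure \<mu>). 1 / 2 \<le> torus_kernel M (walk (fst p) (snd p) n - x0)}
    \<le> 2 * kernel_coeff M (0 :: int ^ 'n)"
proof -
  have "integrable (walk_measure \<mu>) (\<lambda>p. torus_kernel M (walk (fst p) (snd p) n - x0))"
    by (rule W.integrable_const_bound[of _ 1]) (auto simp: torus_kernel_nonneg torus_kernel_le_1)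
  from integral_Markov_inequality_measure[OF this sets.top, of "1 / 2"]
  show ?thesis
    by (simp add: torus_kernel_nonneg expectation_torus_kernel)
qed

lemma AE_eventually_far:
  fixes x0 :: "'n torus"
  assumes "0 < \<epsilon>"
  shows "AE p in walk_measure \<mu>. eventually (\<lambda>n.
    real n powr (- (1 + \<epsilon>) / real CARD('n)) \<le> dist (walk (fst p) (snd p) n) x0) sequentially"
proof -
  let ?d = "real CARD('n)"
  define r where "r n = real n powr (- (1 + \<epsilon>) / ?d)" for n
  \<comment> \<open>The largest degree that \<open>torus_kernel_ge_half\<close> admits:
    \<open>y n * (pi * r n)^2\<close> is 1/2. The mean of the kernel is then at most of order
    y^(-d/2), that is n^(-(1 + \<epsilon>)), which is summable.\<close>
  define y where "y n = real n powr (2 * (1 + \<epsilon>) / ?d) / (2 * pi\<^sup>2)" for n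
  define M where "M n = nat \<lfloor>y n\<rfloor>" for n
  define A where "A n = {p \<in> space (walk_measure \<mu>). 1 / 2 \<le> torus_kernel (M n) (walk (fst p) (snd p) n - x0)}" for n
  have y: "0 \<le> y n" for n
    by (simp add: y_def)
  have A [measurable]: "A n \<in> sets (walk_measure \<mu>)" for n
    unfolding A_def by measurable
  have bound: "measure (walk_measure \<mu>) (A n) \<le> 2 * (2 * pi\<^sup>2) powr (?d / 2) * real n powr (- (1 + \<epsilon>))" if "0 < n" for n
  proof -
    let ?b = "real (2 * M n choose M n) / 4 ^ M n"
    have y_pos: "0 < y n" using that by (simp add: y_def)
    have "y n \<le> real (M n) + 1"
      unfolding M_def using y[of n] by linarith
    then have "?b\<^sup>2 * y n \<le> ?b\<^sup>2 * (real (M n) + 1)"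
      by (intro mult_left_mono) auto
    also have "\<dots> \<le> 1"
      by (rule central_binomial_sq_upper)
    finally have "?b\<^sup>2 \<le> 1 / y n"
      using y_pos by (simp add: field_simps)
    then have "sqrt (?b\<^sup>2) \<le> sqrt (1 / y n)"
      by (rule real_sqrt_le_mono)
    then have "?b \<le> y n powr (- 1 / 2)"
      using y_pos by (simp add: powr_minus_divide powr_half_sqrt real_sqrt_divide)
    then have "?b ^ CARD('n) \<le> (y n powr (- 1 / 2)) ^ CARD('n)"
      by (intro power_mono) auto
    also have "\<dots> = y n powr (- ?d / 2)"
      using y_pos by (simp add: powr_realpow[symmetric] powr_powr)
    also have "\<dots> = (2 * pi\<^sup>2) powr (?d / 2) * real n powr (- (1 + \<epsilon>))"
    proof -
      have "2 * (1 + \<epsilon>) / ?d * (- ?d / 2) = - (1 + \<epsilon>)"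
        by (simp add: field_simps)
      then have "(real n powr (2 * (1 + \<epsilon>) / ?d)) powr (- ?d / 2) = real n powr (- (1 + \<epsilon>))"
        by (simp only: powr_powr)
      moreover have "y n powr (- ?d / 2) = (real n powr (2 * (1 + \<epsilon>) / ?d)) powr (- ?d / 2) / (2 * pi\<^sup>2) powr (- (?d / 2))"
        by (simp add: y_def powr_divide)
      moreover have "(2 * pi\<^sup>2) powr (- (?d / 2)) = inverse ((2 * pi\<^sup>2) powr (?d / 2))"
        by (rule powr_minus)
      ultimately show ?thesis
        by (simp only: divide_inverse inverse_inverse_eq mult.commute)
    qed
    finally have "kernel_coeff (M n) (0 :: int ^ 'n) \<le> (2 * pi\<^sup>2) powr (?d / 2) * real n powr (- (1 + \<epsilon>))"
      by (simp add: kernel_coeff_0)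
    then show ?thesis
      using prob_torus_kernel_ge[of "M n" n x0] by (simp add: A_def)
  qed
  have "summable (\<lambda>n. 2 * (2 * pi\<^sup>2) powr (?d / 2) * real n powr (- (1 + \<epsilon>)))"
    using assms by (intro summable_mult) (simp add: summable_real_powr_iff)
  then have "summable (\<lambda>n. measure (walk_measure \<mu>) (A n))"
    by (rule summable_comparison_test'[where N = 1]) (use bound in simp)
  then have "AE p in walk_measure \<mu>. eventually (\<lambda>n. p \<in> space (walk_measure \<mu>) - A n) sequentially"
    using A by (intro borel_cantelli_AE1) (auto simp: W.emeasure_eq_measure)
  then show ?thesis
  proof (rule AE_mp, intro AE_I2 impI)
    fix p
    assume ev: "eventually (\<lambda>n. p \<in> space (walk_measure \<mu>) - A n) sequentially"
    show "eventually (\<lambda>n. real n powr (- (1 + \<epsilon>) / ?d) \<le> dist (walk (fst p) (snd p) n) x0) sequentially"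
      using ev eventually_gt_at_top[of 0]
    proof eventually_elim
      case (elim n)
      have "real (M n) \<le> y n"
        unfolding M_def using y[of n] by linarith
      then have "real (M n) * (pi * r n)\<^sup>2 \<le> y n * (pi * r n)\<^sup>2"
        by (intro mult_right_mono) auto
      also have "\<dots> = 1 / 2"
      proof -
        have "real n powr (2 * (1 + \<epsilon>) / ?d) * (r n)\<^sup>2 = 1"
          unfolding r_def power2_eq_square using elim
          by (simp add: powr_add[symmetric] add_divide_distrib[symmetric] diff_divide_distrib[symmetric])
        then show ?thesis
          by (simp add: y_def power_mult_distrib)
      qed
      finally have M: "real (M n) * (pi * r n)\<^sup>2 \<le> 1 / 2" .
      have "r n \<le> dist (walk (fst p) (snd p) n - x0) 0"
      proof (rule ccontr)
        assume "\<not> ?thesis"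
        then have "1 / 2 \<le> torus_kernel (M n) (walk (fst p) (snd p) n - x0)"
          using M by (intro torus_kernel_ge_half[of _ "r n"]) auto
        then show False
          using elim by (simp add: A_def)
      qed
      then show ?case
        by (simp add: r_def dist_torus_diff_0)
    qed
  qed
qed

context
  fixes K :: nat and q :: real
  assumes K: "0 < K" and q: "0 \<le> q" "q < 1"
    and gap: "\<And>f. bdd_fun f \<Longrightarrow> (\<And>x. 0 \<le> f x) \<Longrightarrow> f 0 = 0 \<Longrightarrow> sq_norm f < \<infinity> \<Longrightarrow>
      sq_norm ((avg_op \<mu> (\<lambda>A a. a v* A) ^^ K) f) \<le> ennreal q * sq_norm f"
begin

text \<open>Chebyshev's inequality: on this event the real part of the centred sum is at most -|I|
  c0 / 2, while the variance is at most |I| c0 times 2K / (1 - sqrt q). The constant is 8 = 2 *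
  4.\<close>

lemma prob_torus_kernel_small:
  fixes x0 :: "'n torus"
  assumes I: "finite I" "I \<noteq> {}" and M: "0 < M"
  shows "measure (walk_measure \<mu>) {p \<in> space (walk_measure \<mu>).
      \<forall>n\<in>I. torus_kernel M (walk (fst p) (snd p) n - x0) \<le> kernel_coeff M (0 :: int ^ 'n) / 2}
    \<le> 8 * real K / (1 - sqrt q) / (real (card I) * kernel_coeff M (0 :: int ^ 'n))"
proof -
  define c0 where "c0 = kernel_coeff M (0 :: int ^ 'n)"
  let ?F = "freq_box M - {0} :: (int ^ 'n) set"
  define c where "c a = of_real (kernel_coeff M a) * cnj (torus_char a x0)" for a
  define Z where "Z n p = (\<Sum>a\<in>?F. c a * torus_char (freq_walk (fst p) a n) (snd p))" for n and p :: "(nat \<Rightarrow> int ^ 'n ^ 'n) \<times> 'n torus"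
  let ?V = "\<lambda>p. (norm (\<Sum>n\<in>I. Z n p))\<^sup>2"
  have [measurable]: "Z n \<in> borel_measurable (walk_measure \<mu>)" for n
    unfolding Z_def by measurable
  have "0 < real (2 * M choose M)"
    by (simp add: zero_less_binomial)
  then have c0: "0 < c0"
    by (simp add: c0_def kernel_coeff_0)
  have N: "0 < real (card I)"
    using I by (simp add: card_gt_0_iff)
  have Y: "complex_of_real (torus_kernel M (walk (fst p) (snd p) n - x0)) = of_real c0 + Z n p" for n p
    unfolding torus_kernel_walk by (simp add: c0_def Z_def c_def)
  have "(\<Sum>a\<in>?F. (norm (c a))\<^sup>2) \<le> (\<Sum>a\<in>freq_box M. (kernel_coeff M (a :: int ^ 'n))\<^sup>2)"
    by (rule order_trans[OF _ sum_mono2[of "freq_box M" ?F]]) (auto simp: c_def norm_mult)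
  also have "\<dots> \<le> c0"
    unfolding c0_def by (rule sum_kernel_coeff_squares)
  finally have Q: "(\<Sum>a\<in>?F. (norm (c a))\<^sup>2) \<le> c0" .
  have "(\<integral>p. ?V p \<partial>walk_measure \<mu>) \<le> (\<Sum>a\<in>?F. (norm (c a))\<^sup>2) * (real (card I) * (2 * real K / (1 - sqrt q)))"
    unfolding Z_def using I by (intro variance_le[OF \<mu> K q gap]) auto
  also have "\<dots> \<le> c0 * (real (card I) * (2 * real K / (1 - sqrt q)))"
    using Q q by (intro mult_right_mono) auto
  finally have var: "(\<integral>p. ?V p \<partial>walk_measure \<mu>) \<le> c0 * (real (card I) * (2 * real K / (1 - sqrt q)))" .
  have Z_bound: "norm (Z n p) \<le> (\<Sum>a\<in>?F. norm (c a))" for n p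
    unfolding Z_def by (rule order_trans[OF norm_sum]) (simp add: norm_mult)
  have int: "integrable (walk_measure \<mu>) ?V"
  proof (rule W.integrable_const_bound)
    have "norm (\<Sum>n\<in>I. Z n p) \<le> real (card I) * (\<Sum>a\<in>?F. norm (c a))" for p
      by (rule order_trans[OF norm_sum sum_bounded_above]) (rule Z_bound)
    then show "AE p in walk_measure \<mu>. norm (?V p) \<le> (real (card I) * (\<Sum>a\<in>?F. norm (c a)))\<^sup>2"
      by (intro AE_I2) (simp add: power_mono)
  qed measurable
  have "measure (walk_measure \<mu>) {p \<in> space (walk_measure \<mu>).
      \<forall>n\<in>I. torus_kernel M (walk (fst p) (snd p) n - x0) \<le> c0 / 2}
      \<le> measure (walk_measure \<mu>) {p \<in> space (walk_measure \<mu>). (real (card I) * (c0 / 2))\<^sup>2 \<le> ?V p}"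
  proof (rule W.finite_measure_mono, safe)
    fix g :: "nat \<Rightarrow> int ^ 'n ^ 'n" and x :: "'n torus"
    let ?p = "(g, x)"
    assume small: "\<forall>n\<in>I. torus_kernel M (walk (fst ?p) (snd ?p) n - x0) \<le> c0 / 2"
    have "Re (Z n ?p) \<le> - (c0 / 2)" if "n \<in> I" for n
      using small that arg_cong[OF Y[of ?p n], of Re] by force
    then have "(\<Sum>n\<in>I. Re (Z n ?p)) \<le> (\<Sum>n\<in>I. - (c0 / 2))"
      by (rule sum_mono)
    then have "real (card I) * (c0 / 2) \<le> \<bar>Re (\<Sum>n\<in>I. Z n ?p)\<bar>"
      by simp
    also have "\<dots> \<le> norm (\<Sum>n\<in>I. Z n ?p)"
      by (rule abs_Re_le_cmod)
    finally show "(real (card I) * (c0 / 2))\<^sup>2 \<le> (norm (\<Sum>n\<in>I. Z n ?p))\<^sup>2"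
      using c0 by (intro power_mono) auto
  qed measurable
  also have "\<dots> \<le> (\<integral>p. ?V p \<partial>walk_measure \<mu>) / (real (card I) * (c0 / 2))\<^sup>2"
    using c0 N by (intro integral_Markov_inequality_measure[OF int sets.top]) auto
  also have "\<dots> \<le> c0 * (real (card I) * (2 * real K / (1 - sqrt q))) / (real (card I) * (c0 / 2))\<^sup>2"
    using var by (rule divide_right_mono) simp
  also have "\<dots> = 8 * real K / (1 - sqrt q) / (real (card I) * c0)"
    using c0 N by (simp add: power2_eq_square)
  finally show ?thesis
    unfolding c0_def .
qed

lemma AE_eventually_near:
  fixes x0 :: "'n torus"
  assumes \<epsilon>: "0 < \<epsilon>" "\<epsilon> < 1"
  shows "AE p in walk_measure \<mu>. eventually (\<lambda>j. \<exists>n\<in>{2 ^ j..<2 * 2 ^ j}.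
    dist (walk (fst p) (snd p) n) x0 < (2 ^ j) powr (- (1 - \<epsilon>) / real CARD('n))) sequentially"
proof -
  let ?d = "real CARD('n)"
  have d: "0 < ?d" by simp
  \<comment> \<open>\<open>M j\<close> is about 2^(js), between two requirements. Its product with
    the squared radius is about 2^(j \<epsilon> / d), which grows and suppresses the tail of the
    kernel. The mean is at least of order 2^(-j (1 - \<epsilon> / 2)), so the expected total over a
    block of 2^j times still grows, like 2^(j \<epsilon> / 2).\<close>
  define s where "s = (2 - \<epsilon>) / ?d"
  have s: "0 < s" using \<epsilon> by (simp add: s_def)
  define r where "r j = (2 ^ j) powr (- (1 - \<epsilon>) / ?d)" for j :: nat
  define M where "M j = nat \<lceil>(2 ^ j :: real) powr s\<rceil>" for j :: nat
  define I where "I j = {2 ^ j..<2 * 2 ^ j :: nat}" for j :: nat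
  define c0 where "c0 j = kernel_coeff (M j) (0 :: int ^ 'n)" for j
  define A where "A j = {p \<in> space (walk_measure \<mu>). \<forall>n\<in>I j. torus_kernel (M j) (walk (fst p) (snd p) n - x0) \<le> c0 j / 2}" for j
  have p1: "1 \<le> (2 ^ j :: real) powr s" for j
    using s by (intro ge_one_powr_ge_zero) auto
  have M_ge: "(2 ^ j) powr s \<le> real (M j)" and M_le: "real (M j) \<le> 2 * (2 ^ j) powr s" and M_pos: "0 < M j" for j
    unfolding M_def using p1[of j] by linarith+
  have I: "finite (I j)" "I j \<noteq> {}" "real (card (I j)) = 2 ^ j" for j
    by (auto simp: I_def)
  have c0_ge: "8 powr (- ?d / 2) * (2 ^ j) powr (- (1 - \<epsilon> / 2)) \<le> c0 j" for j
  proof -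
    \<comment> \<open>The factor 8 is the 4 of \<open>central_binomial_sq_lower\<close> times the 2
      lost by rounding up.\<close>
    let ?b = "real (2 * M j choose M j) / 4 ^ M j" and ?y = "8 * (2 ^ j) powr s"
    have "1 \<le> ?b\<^sup>2 * (4 * real (M j))"
      using central_binomial_sq_lower[OF M_pos] .
    also have "\<dots> \<le> ?b\<^sup>2 * ?y"
      using M_le[of j] by (intro mult_left_mono) auto
    finally have "1 / ?y \<le> ?b\<^sup>2"
      by (simp add: field_simps)
    then have "sqrt (1 / ?y) \<le> sqrt (?b\<^sup>2)"
      by (rule real_sqrt_le_mono)
    then have "?y powr (- 1 / 2) \<le> ?b"
      by (simp add: powr_minus_divide powr_half_sqrt real_sqrt_divide)
    then have "(?y powr (- 1 / 2)) ^ CARD('n) \<le> c0 j"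
      unfolding c0_def kernel_coeff_0 by (intro power_mono) auto
    moreover have "(?y powr (- 1 / 2)) ^ CARD('n) = ?y powr (- ?d / 2)"
      by (simp add: powr_realpow[symmetric] powr_powr)
    moreover have "?y powr (- ?d / 2) = 8 powr (- ?d / 2) * (2 ^ j) powr (s * (- ?d / 2))"
      by (simp add: powr_mult powr_powr)
    moreover have "s * (- ?d / 2) = - (1 - \<epsilon> / 2)"
      using d by (simp add: s_def field_simps)
    ultimately show ?thesis
      by (simp only:)
  qed
  have A [measurable]: "A j \<in> sets (walk_measure \<mu>)" for j
    unfolding A_def using I by measurable
  define C where "C = 8 * real K / (1 - sqrt q)"
  have C: "0 \<le> C" using q by (simp add: C_def)
  have le: "measure (walk_measure \<mu>) (A j) \<le> C * 8 powr (?d / 2) * (2 powr (- (\<epsilon> / 2))) ^ j" for j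
  proof -
    have pos: "0 < 8 powr (- ?d / 2) * (2 ^ j :: real) powr (- (1 - \<epsilon> / 2))"
      by simp
    have "measure (walk_measure \<mu>) (A j) \<le> C / (2 ^ j * c0 j)"
      using prob_torus_kernel_small[OF I(1,2)[of j] M_pos[of j], of x0] by (simp add: A_def c0_def C_def I)
    also have "\<dots> \<le> C / (2 ^ j * (8 powr (- ?d / 2) * (2 ^ j) powr (- (1 - \<epsilon> / 2))))"
      using c0_ge[of j] C pos less_le_trans[OF pos c0_ge[of j]]
      by (intro divide_left_mono mult_left_mono mult_pos_pos) auto
    also have "2 ^ j * (8 powr (- ?d / 2) * (2 ^ j) powr (- (1 - \<epsilon> / 2))) = 8 powr (- ?d / 2) * (2 ^ j) powr (\<epsilon> / 2)"
    proof -
      have "(2 ^ j :: real) powr (\<epsilon> / 2) = (2 ^ j) powr (1 + - (1 - \<epsilon> / 2))"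
        by simp
      also have "\<dots> = 2 ^ j * (2 ^ j) powr (- (1 - \<epsilon> / 2))"
        by (subst powr_add) simp
      finally show ?thesis by simp
    qed
    also have "C / (8 powr (- ?d / 2) * (2 ^ j) powr (\<epsilon> / 2)) = C * 8 powr (?d / 2) * (2 ^ j) powr (- (\<epsilon> / 2))"
      by (simp add: powr_minus_divide)
    also have "(2 ^ j :: real) powr (- (\<epsilon> / 2)) = (2 powr (- (\<epsilon> / 2))) ^ j"
      by (simp add: powr_realpow[symmetric] powr_powr mult.commute)
    finally show ?thesis .
  qed
  have "summable (\<lambda>j. C * 8 powr (?d / 2) * (2 powr (- (\<epsilon> / 2))) ^ j)"
  proof -
    have "2 powr (- (\<epsilon> / 2)) < (2 :: real) powr 0"
      using \<epsilon> by (intro powr_less_mono) auto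
    then show ?thesis
      by (intro summable_mult summable_geometric) simp
  qed
  then have "summable (\<lambda>j. measure (walk_measure \<mu>) (A j))"
    by (rule summable_comparison_test'[where N = 0]) (simp add: le)
  then have "AE p in walk_measure \<mu>. eventually (\<lambda>j. p \<in> space (walk_measure \<mu>) - A j) sequentially"
    using A by (intro borel_cantelli_AE1) (auto simp: W.emeasure_eq_measure)
  then show ?thesis
  proof (rule AE_mp, intro AE_I2 impI)
    fix p
    assume ev: "eventually (\<lambda>j. p \<in> space (walk_measure \<mu>) - A j) sequentially"
    \<comment> \<open>The left side bounds the kernel outside the ball and eventually falls below
      half its mean; so a value above half the mean forces the point into the ball.\<close>
    have "eventually (\<lambda>x :: real. exp (- (x powr (\<epsilon> / ?d))) < 8 powr (- ?d / 2) * x powr (- (1 - \<epsilon> / 2)) / 2) at_top"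
    proof -
      have "0 < \<epsilon> / ?d" "0 < 8 powr (- ?d / 2)" using \<epsilon> d by simp_all
      then show ?thesis
        by real_asymp
    qed
    moreover have "filterlim (\<lambda>j :: nat. 2 ^ j :: real) at_top sequentially"
      by real_asymp
    ultimately have "eventually (\<lambda>j :: nat. exp (- ((2 ^ j) powr (\<epsilon> / ?d))) < 8 powr (- ?d / 2) * (2 ^ j) powr (- (1 - \<epsilon> / 2)) / 2) sequentially"
      by (rule eventually_compose_filterlim)
    with ev show "eventually (\<lambda>j. \<exists>n\<in>{2 ^ j..<2 * 2 ^ j}.
        dist (walk (fst p) (snd p) n) x0 < (2 ^ j) powr (- (1 - \<epsilon>) / ?d)) sequentially"
    proof eventually_elim
      case (elim j)
      then obtain n where n: "n \<in> I j" "c0 j / 2 < torus_kernel (M j) (walk (fst p) (snd p) n - x0)"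
        by (auto simp: A_def not_le)
      have "(2 ^ j) powr (\<epsilon> / ?d) = (2 ^ j) powr s * (r j)\<^sup>2"
      proof -
        have "(2 ^ j :: real) powr (\<epsilon> / ?d) = (2 ^ j) powr (s + (- (1 - \<epsilon>) / ?d + - (1 - \<epsilon>) / ?d))"
          using d by (intro arg_cong[where f = "(powr) (2 ^ j)"]) (simp add: s_def field_simps)
        then show ?thesis
          by (simp only: powr_add r_def power2_eq_square)
      qed
      also have "\<dots> \<le> real (M j) * (r j)\<^sup>2"
        using M_ge[of j] by (intro mult_right_mono) auto
      finally have "exp (- (real (M j) * (r j)\<^sup>2)) \<le> exp (- ((2 ^ j) powr (\<epsilon> / ?d)))"
        by simp
      then have less: "exp (- (real (M j) * (r j)\<^sup>2)) < torus_kernel (M j) (walk (fst p) (snd p) n - x0)"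
        using elim c0_ge[of j] n by linarith
      have "\<not> r j \<le> dist (walk (fst p) (snd p) n - x0) 0"
        using torus_kernel_le_exp[of "r j" "walk (fst p) (snd p) n - x0" "M j"] less by (auto simp: r_def)
      then show ?case
        using n by (auto simp: r_def dist_torus_diff_0 I_def not_le intro!: bexI[of _ n])
    qed
  qed
qed

end

end

text \<open>The parameter \<open>1 / (k + 2)\<close> takes countably many values, so that almost
  sure events can be intersected; it tends to 0 and stays below 1, as
  \<open>AE_eventually_near\<close> requires.\<close>

lemma limsup_log_dist_eq:
  fixes X :: "nat \<Rightarrow> 'n::finite torus"
  assumes far: "\<And>k. eventually (\<lambda>n. real n powr (- (1 + 1 / real (k + 2)) / real CARD('n)) \<le> dist (X n) x0) sequentially"
    and near: "\<And>k. eventually (\<lambda>j. \<exists>n\<in>{2 ^ j..<2 * 2 ^ j}.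
      dist (X n) x0 < (2 ^ j) powr (- (1 - 1 / real (k + 2)) / real CARD('n))) sequentially"
  shows "limsup (\<lambda>n. log_dist x0 (X n) / ereal (ln (real n))) = ereal (1 / real CARD('n))"
proof (rule antisym)
  let ?d = "real CARD('n)" and ?f = "\<lambda>n. log_dist x0 (X n) / ereal (ln (real n))"
  have d: "0 < ?d" by simp
  have upper: "limsup ?f \<le> ereal ((1 + 1 / real (k + 2)) / ?d)" for k
  proof (rule Limsup_bounded)
    show "eventually (\<lambda>n. ?f n \<le> ereal ((1 + 1 / real (k + 2)) / ?d)) sequentially"
      using far[of k] eventually_ge_at_top[of 2]
    proof eventually_elim
      case (elim n)
      have n: "0 < ln (real n)" using elim by simp
      have pos: "0 < real n powr (- (1 + 1 / real (k + 2)) / ?d)" using elim by simp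
      then have D: "0 < dist (X n) x0" using elim by linarith
      have "ln (real n powr (- (1 + 1 / real (k + 2)) / ?d)) \<le> ln (dist (X n) x0)"
        using elim pos by (intro ln_mono) auto
      also have "- (1 + 1 / real (k + 2)) / ?d = - ((1 + 1 / real (k + 2)) / ?d)"
        by (rule minus_divide_left[symmetric])
      finally have "- ln (dist (X n) x0) \<le> (1 + 1 / real (k + 2)) / ?d * ln (real n)"
        using elim by (simp only: ln_powr mult_minus_left minus_le_iff)
      then have "- ln (dist (X n) x0) / ln (real n) \<le> (1 + 1 / real (k + 2)) / ?d"
        using n by (simp only: pos_divide_le_eq)
      then show ?case
        using D n by (simp add: log_dist_def)
    qed
  qed
  have lim: "(\<lambda>k. ereal ((1 + 1 / real (k + 2)) / ?d)) \<longlonglongrightarrow> ereal (1 / ?d)"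
    by (intro tendsto_ereal tendsto_divide tendsto_const) (real_asymp, simp)
  show "limsup ?f \<le> ereal (1 / ?d)"
    by (rule LIMSEQ_le_const[OF lim]) (use upper in blast)
  have lower: "ereal ((1 - 1 / real (k + 2)) / ?d) \<le> limsup ?f" for k
  proof (rule dense_le)
    fix y :: ereal
    assume y: "y < ereal ((1 - 1 / real (k + 2)) / ?d)"
    let ?c = "(1 - 1 / real (k + 2)) / ?d"
    \<comment> \<open>Within block \<open>j\<close>, \<open>ln n\<close> can reach
      \<open>(j + 1) * ln 2\<close>, while the radius is that of time \<open>2 ^ j\<close>; the
      resulting loss j / (j + 1) tends to 1.\<close>
    have "(\<lambda>j. ereal (?c * (real j / (real j + 1)))) \<longlonglongrightarrow> ereal (?c * 1)"
      by (intro tendsto_ereal tendsto_mult tendsto_const) real_asymp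
    then have "eventually (\<lambda>j. y < ereal (?c * (real j / (real j + 1)))) sequentially"
      using y by (intro order_tendstoD) auto
    then have ev: "eventually (\<lambda>j. \<exists>n\<ge>2 ^ j. y < ?f n) sequentially"
      using near[of k] eventually_gt_at_top[of 0]
    proof eventually_elim
      case (elim j)
      then obtain n where n: "2 ^ j \<le> n" "n < 2 * 2 ^ j" and D: "dist (X n) x0 < (2 ^ j) powr (- (1 - 1 / real (k + 2)) / ?d)"
        by auto
      have "2 ^ 1 \<le> (2 :: nat) ^ j"
        using elim by (intro power_increasing) auto
      then have n2: "2 \<le> n" using n by simp
      have ln_n: "0 < ln (real n)" using n2 by simp
      \<comment> \<open>If \<open>X n = x0\<close>, then \<open>log_dist\<close> is infinite and the
        bound on the quotient is immediate.\<close>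
      have "?c * (real j / (real j + 1)) \<le> - ln (dist (X n) x0) / ln (real n)" if pos: "0 < dist (X n) x0"
      proof -
        have "real n \<le> 2 ^ (j + 1)"
          using n(2) by (metis less_imp_le of_nat_le_iff of_nat_numeral of_nat_power power_Suc Suc_eq_plus1)
        then have "ln (real n) \<le> ln (2 ^ (j + 1))"
          using n2 by (intro ln_mono) auto
        also have "\<dots> = (real j + 1) * ln 2"
          by (subst ln_realpow) auto
        finally have le: "ln (real n) \<le> (real j + 1) * ln 2" .
        have "ln (dist (X n) x0) \<le> ln ((2 ^ j) powr (- (1 - 1 / real (k + 2)) / ?d))"
          using pos D by (intro ln_mono) auto
        also have "\<dots> = - (1 - 1 / real (k + 2)) / ?d * (real j * ln 2)"
          by (simp add: ln_powr ln_realpow)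
        also have "- (1 - 1 / real (k + 2)) / ?d = - ?c"
          by (rule minus_divide_left[symmetric])
        finally have ge: "?c * (real j * ln 2) \<le> - ln (dist (X n) x0)"
          unfolding mult_minus_left by linarith
        have c: "0 \<le> ?c" using d by simp
        have "?c * (real j / (real j + 1)) * ln (real n) \<le> ?c * (real j / (real j + 1)) * ((real j + 1) * ln 2)"
          using le c by (intro mult_left_mono) auto
        also have "\<dots> = ?c * (real j * ln 2)"
          by simp
        also note ge
        finally show ?thesis
          using ln_n by (simp only: pos_le_divide_eq)
      qed
      then have "ereal (?c * (real j / (real j + 1))) \<le> ?f n"
        using ln_n by (auto simp: log_dist_def)
      with elim n show ?case
        by (intro exI[of _ n]) (auto intro: less_le_trans)
    qed
    show "y \<le> limsup ?f"
      unfolding limsup_INF_SUP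
    proof (rule INF_greatest)
      fix m :: nat
      obtain j where j: "m \<le> j" "\<exists>n\<ge>2 ^ j. y < ?f n"
        using ev by (auto simp: eventually_sequentially) (meson le_cases order_trans)
      then obtain n where n: "2 ^ j \<le> n" "y < ?f n"
        by blast
      have "j \<le> 2 ^ j"
        by (simp add: less_imp_le)
      then have "m \<le> n"
        using j(1) n(1) by (meson order_trans)
      then have "n \<in> {m..}"
        by simp
      then have "?f n \<le> (SUP n\<in>{m..}. ?f n)"
        by (rule SUP_upper)
      then show "y \<le> (SUP n\<in>{m..}. ?f n)"
        using n by simp
    qed
  qed
  have lim: "(\<lambda>k. ereal ((1 - 1 / real (k + 2)) / ?d)) \<longlonglongrightarrow> ereal (1 / ?d)"
    by (intro tendsto_ereal tendsto_divide tendsto_const) (real_asymp, simp)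
  show "ereal (1 / ?d) \<le> limsup ?f"
    by (rule LIMSEQ_le_const2[OF lim]) (use lower in blast)
qed

theorem corollary1p2:
  fixes \<mu> :: "(int ^ 'n::finite ^ 'n) pmf" and x0 :: "'n torus"
  defines "G\<^sub>\<mu> \<equiv> generate torus_Aut (set_pmf \<mu>)"
  assumes "set_pmf \<mu> \<subseteq> carrier torus_Aut"
    and "\<not> (\<exists>S. invariant_factor_torus G\<^sub>\<mu> S \<and> S \<noteq> UNIV \<and> amenable (factor_projection G\<^sub>\<mu> S))"
  shows "AE (g, x) in walk_measure \<mu>.
    limsup (\<lambda>n. log_dist x0 (walk g x n) / ereal (ln (real n))) = ereal (1 / real CARD('n))"
proof -
  interpret group torus_Aut by (rule group_torus_Aut)
  let ?T = "\<lambda>(A :: int ^ 'n ^ 'n) a. a v* A"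
  note \<mu> = assms(2)
  have bij: "bij (?T A)" if "A \<in> set_pmf \<mu>" for A
    using \<mu> that by (intro bij_vector_matrix_mult) auto
  have "\<exists>K q. 0 < K \<and> 0 \<le> q \<and> q < (1::real) \<and>
    (\<forall>f. bdd_fun f \<longrightarrow> (\<forall>a. 0 \<le> f a) \<longrightarrow> f 0 = 0 \<longrightarrow> sq_norm f < \<infinity> \<longrightarrow>
      sq_norm ((avg_op \<mu> ?T ^^ K) f) \<le> ennreal q * sq_norm f)"
  proof (rule ccontr)
    assume no_gap: "\<not> ?thesis"
    have "\<exists>M. is_mean M \<and> (\<forall>A h. A \<in> set_pmf \<mu> \<longrightarrow> bdd_fun h \<longrightarrow> M (\<lambda>a. h (a v* A)) = M h) \<and>
        M (\<lambda>a. of_bool (a = 0)) = 0"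
      by (rule gap_or_invariant_mean[of \<mu> ?T 0, OF bij vector_matrix_mult_0 no_gap]) auto
    then obtain M where M: "is_mean M"
      and mean_inv: "\<And>A h. A \<in> set_pmf \<mu> \<Longrightarrow> bdd_fun h \<Longrightarrow> M (\<lambda>a. h (a v* A)) = M h"
      and M0: "M (\<lambda>a. of_bool (a = 0)) = 0"
      by auto
    \<comment> \<open>Invariance under the support passes to the generated group; for an inverse it
      is applied to the function composed with that inverse.\<close>
    have "\<forall>h. bdd_fun h \<longrightarrow> M (\<lambda>a. h (a v* A)) = M h" if "A \<in> G\<^sub>\<mu>" for A
      using that unfolding G\<^sub>\<mu>_def
    proof (induction rule: generate.induct)
      case one
      then show ?case by (simp add: torus_Aut_def)
    next
      case (incl A)
      then show ?case using mean_inv by blast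
    next
      case (inv A)
      show ?case
      proof (intro allI impI)
        fix h :: "int ^ 'n \<Rightarrow> real"
        assume h: "bdd_fun h"
        let ?B = "inv\<^bsub>torus_Aut\<^esub> A"
        have "A ** ?B = mat 1"
          using r_inv[of A] inv \<mu> by (auto simp: torus_Aut_def)
        then have "M h = M (\<lambda>a. h (a v* A v* ?B))"
          by (simp add: vector_matrix_mul_assoc)
        also have "\<dots> = M (\<lambda>a. h (a v* ?B))"
          using mean_inv[OF inv bdd_fun_compose[OF h, of "\<lambda>a. a v* ?B"]] .
        finally show "M (\<lambda>a. h (a v* ?B)) = M h" ..
      qed
    next
      case (eng A B)
      show ?case
      proof (intro allI impI)
        fix h :: "int ^ 'n \<Rightarrow> real"
        assume h: "bdd_fun h"
        have "M (\<lambda>a. h (a v* (A \<otimes>\<^bsub>torus_Aut\<^esub> B))) = M (\<lambda>a. h (a v* A v* B))"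
          by (simp add: torus_Aut_def vector_matrix_mul_assoc)
        also have "\<dots> = M (\<lambda>a. h (a v* B))"
          by (rule eng.IH(1)[rule_format, OF bdd_fun_compose[OF h, of "\<lambda>a. a v* B"]])
        also have "\<dots> = M h"
          using eng.IH(2) h by simp
        finally show "M (\<lambda>a. h (a v* (A \<otimes>\<^bsub>torus_Aut\<^esub> B))) = M h" .
      qed
    qed
    moreover have "subgroup G\<^sub>\<mu> torus_Aut"
      unfolding G\<^sub>\<mu>_def using \<mu> by (rule generate_is_subgroup)
    ultimately show False
      using amenable_factor_of_invariant_mean[of G\<^sub>\<mu> M, OF _ M _ M0] assms(3) by blast
  qed
  then obtain K q where K: "0 < K" and q: "0 \<le> q" "q < 1"
    and gap: "\<And>f. bdd_fun f \<Longrightarrow> (\<And>a. 0 \<le> f a) \<Longrightarrow> f 0 = 0 \<Longrightarrow> sq_norm f < \<infinity> \<Longrightarrow>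
      sq_norm ((avg_op \<mu> ?T ^^ K) f) \<le> ennreal q * sq_norm f"
    by blast
  have far: "AE p in walk_measure \<mu>. \<forall>k. eventually (\<lambda>n.
      real n powr (- (1 + 1 / real (k + 2)) / real CARD('n)) \<le> dist (walk (fst p) (snd p) n) x0) sequentially"
    unfolding AE_all_countable by (intro allI AE_eventually_far[OF \<mu>]) simp
  have near: "AE p in walk_measure \<mu>. \<forall>k. eventually (\<lambda>j. \<exists>n\<in>{2 ^ j..<2 * 2 ^ j}.
      dist (walk (fst p) (snd p) n) x0 < (2 ^ j) powr (- (1 - 1 / real (k + 2)) / real CARD('n))) sequentially"
    unfolding AE_all_countable by (intro allI AE_eventually_near[OF \<mu> K q gap]) auto
  have "AE p in walk_measure \<mu>.
      limsup (\<lambda>n. log_dist x0 (walk (fst p) (snd p) n) / ereal (ln (real n))) = ereal (1 / real CARD('n))"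
    using far near by eventually_elim (intro limsup_log_dist_eq, blast+)
  then show ?thesis
    by (simp add: case_prod_beta')
qed

end
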